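(* There exists an absolute constant $c>0$ such that for every finite nonempty set $S\subset\mathbb{Z}^2$ and every $\phi\in L^2(\mathbb{T}^2)$, \[ \|e^{it\Delta}P_S\phi\|_{L^4_{t,x}([0,\frac{1}{\log\#S}]\times\mathbb{T}^2)}\le c\,\|\phi\|_{L^2(\mathbb{T}^2)}. \]
   Context: $\mathbb{T}^2=(\mathbb{R}/2\pi\mathbb{Z})^2$. For $f:\mathbb{T}^2\to\mathbb{C}$, $\widehat f(\xi)$, $\xi\in\mathbb{Z}^2$, denotes its Fourier coefficients. For $S\subset\mathbb{Z}^2$, $P_S$ is the Fourier multiplier $\widehat{P_Sf}=\chi_S\widehat f$ ($\chi_S$ the indicator of $S$). For $t\in\mathbb{R}$, $e^{it\Delta}\phi$ is defined by $\widehat{e^{it\Delta}\phi}(\xi)=e^{-it|\xi|^2}\widehat\phi(\xi)$. $\#S$ is the cardinality of $S$, and $\log x:=\max\{1,\log_e x\}$ for $x>0$. *)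

theory Defs
  imports "HOL-Analysis.Analysis"
begin

text \<open>The torus T^2 = (R/2 pi Z)^2 is represented by the fundamental domain
  [0,2pi]^2 with Lebesgue measure; functions on T^2 are functions on real \<times> real
  whose values on this box are what matters.\<close>

definition torus_box :: "(real \<times> real) set" where
  "torus_box = cbox (0, 0) (2 * pi, 2 * pi)"

definition in_L2_torus :: "(real \<times> real \<Rightarrow> complex) \<Rightarrow> bool" where
  "in_L2_torus \<phi> \<longleftrightarrow> set_integrable lebesgue torus_box (\<lambda>x. (norm (\<phi> x))\<^sup>2)"

definition L2_norm_torus :: "(real \<times> real \<Rightarrow> complex) \<Rightarrow> real" where
  "L2_norm_torus \<phi> = sqrt (LINT x : torus_box | lebesgue. (norm (\<phi> x))\<^sup>2)"

definition fourier_coeff :: "(real \<times> real \<Rightarrow> complex) \<Rightarrow> int \<times> int \<Rightarrow> complex" where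
  "fourier_coeff \<phi> \<xi> = (1 / (4 * pi\<^sup>2)) *\<^sub>R
     (LINT x : torus_box | lebesgue.
        \<phi> x * exp (- \<i> * complex_of_real (real_of_int (fst \<xi>) * fst x + real_of_int (snd \<xi>) * snd x)))"

definition schrod_proj :: "(int \<times> int) set \<Rightarrow> (real \<times> real \<Rightarrow> complex) \<Rightarrow> real \<Rightarrow> real \<times> real \<Rightarrow> complex" where
  "schrod_proj S \<phi> t x = (\<Sum>\<xi>\<in>S. fourier_coeff \<phi> \<xi> *
      exp (\<i> * complex_of_real (real_of_int (fst \<xi>) * fst x + real_of_int (snd \<xi>) * snd x
            - t * ((real_of_int (fst \<xi>)) ^ 2 + (real_of_int (snd \<xi>)) ^ 2))))"

definition L4_norm_time_torus :: "real \<Rightarrow> (real \<Rightarrow> real \<times> real \<Rightarrow> complex) \<Rightarrow> real" where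
  "L4_norm_time_torus T u =
     (LINT p : {0..T} \<times> torus_box | lebesgue. (norm (u (fst p) (snd p))) ^ 4) powr (1 / 4)"

text \<open>The paper's convention log x := max {1, ln x}.\<close>
definition logm :: "real \<Rightarrow> real" where
  "logm x = max 1 (ln x)"

end

theory Submission
  imports Defs
begin

text \<open>
Let \<open>M = logm (card S)\<close> and \<open>K = \<lfloor>M\<rfloor>\<close>. On \<open>[0, 1 / M]\<close> the Dirichlet kernel \<open>D t = (\<Sum>k<K. cis (k t))\<close> has modulus at
least \<open>K / 2\<close>, so the fourth power of the \<open>L^4\<close> norm is at most \<open>4 / K ^ 2\<close> times the \<open>L^2\<close> norm of \<open>D u^2\<close>
squared over the full period. By Parseval this is \<open>O(1 / K)\<close> times the sum of \<open>f p * f q * f s * f r\<close> over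
parallelograms \<open>p q s r\<close> with \<open>\<bar>(q - p) \<bullet> (r - p)\<bar> < K\<close>, where \<open>f\<close> is the modulus of the Fourier coefficients.
For a fixed side \<open>q - p\<close> with coordinates of greatest common divisor \<open>g\<close>, the inner product is a multiple of \<open>g\<close>, and
the arithmetic-geometric mean inequality replaces the parallelograms by rectangles, each with weight \<open>2 * K / g + 1\<close>.

It remains to bound the sum over non-degenerate rectangles by \<open>O(M)\<close> and the same sum with weight \<open>1 / g\<close> by \<open>O(1)\<close>
times \<open>(\<Sum>p\<in>S. f p ^ 2) ^ 2\<close>. Decompose \<open>S\<close> into levels of size about \<open>4 ^ j\<close> on which \<open>f\<close> is essentially constant, and
call a line heavy for a point of level \<open>j\<close> if it contains at least \<open>2 ^ (j + 2)\<close> points of that level. Rectangles with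
two heavy vertices are controlled by Cauchy-Schwarz in each direction. For the others, drop the vertex of the largest
level and count the right triangles formed by the other three with the Szemeredi-Trotter theorem, which is
deduced from the crossing inequality.
\<close>

section \<open>Geometric graphs and the crossing inequality\<close>

text \<open>The logarithm leaves no slack. Counting rectangles loses a factor M, because for levels
  of equal size every dyadic richness of lines contributes equally to the Szemeredi-Trotter bound;
  the factor 1 / K repays exactly this loss. But multiplying by the kernel spreads each time
  frequency over K integers and relaxes orthogonality to an inner product below K. The resulting
  factor K is harmless only because it comes with 1 / g and the sum with weight 1 / g carries no
  logarithm: on a line through p every value of g occurs at most twice, so most points of a rich
  line weigh little.

  The second obstacle is an uneven f: treating the quadruples of levels one by one would cost
  further logarithms, so each count must gain a power of two in the differences of levels. Dropping
  the vertex of the largest level c gives this gain, since the number of triples depends on the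
  other three levels only while the normalisation still contains 2 ^ (- c). A heavy line may carry
  any number of points of its level, so configurations with two heavy vertices are too numerous to
  be counted and are removed beforehand. Absolute constants are not optimised.\<close>

definition chord :: "('a \<Rightarrow> real) \<Rightarrow> ('a \<Rightarrow> real) \<Rightarrow> 'a \<times> 'a \<Rightarrow> real \<Rightarrow> real" where
  "chord x y e t = y (fst e) + (y (snd e) - y (fst e)) / (x (snd e) - x (fst e)) * (t - x (fst e))"

text \<open>The common abscissa lies strictly inside both edges: edges that merely share an endpoint
  do not cross, whereas overlapping edges on one line do.\<close>

definition crosses :: "('a \<Rightarrow> real) \<Rightarrow> ('a \<Rightarrow> real) \<Rightarrow> 'a \<times> 'a \<Rightarrow> 'a \<times> 'a \<Rightarrow> bool" where
  "crosses x y e e' \<longleftrightarrow> (\<exists>t. x (fst e) < t \<and> t < x (snd e) \<and> x (fst e') < t \<and> t < x (snd e')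
      \<and> chord x y e t = chord x y e' t)"

lemma chord_fst [simp]: "chord x y e (x (fst e)) = y (fst e)"
  by (simp add: chord_def)

lemma chord_snd: "x (fst e) < x (snd e) \<Longrightarrow> chord x y e (x (snd e)) = y (snd e)"
  by (simp add: chord_def)

lemma chord_ivt:
  assumes "s < t" "chord x y e s < chord x y e' s" "chord x y e' t < chord x y e t"
  shows "\<exists>r>s. r < t \<and> chord x y e r = chord x y e' r"
proof -
  let ?d = "\<lambda>r. chord x y e r - chord x y e' r"
  have "\<exists>r. s \<le> r \<and> r \<le> t \<and> ?d r = 0"
  proof (rule IVT)
    define m m' where "m = (y (snd e) - y (fst e)) / (x (snd e) - x (fst e))"
      and "m' = (y (snd e') - y (fst e')) / (x (snd e') - x (fst e'))"
    show "\<forall>r. s \<le> r \<and> r \<le> t \<longrightarrow> isCont ?d r"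
      unfolding chord_def m_def[symmetric] m'_def[symmetric] by (auto intro!: continuous_intros)
  qed (use assms in auto)
  then obtain r where r: "s \<le> r" "r \<le> t" "?d r = 0" by blast
  then have "r \<noteq> s" "r \<noteq> t" using assms by auto
  then show ?thesis using r by (intro exI[of _ r]) auto
qed

text \<open>An edge that is not the steepest one leaving its left endpoint is charged to the leftmost vertex
  in the wedge between it and the next steeper edge; every vertex is charged at most three times.\<close>

lemma noncrossing_card:
  fixes x y :: "'a \<Rightarrow> real"
  assumes V: "finite V" "inj_on x V" and E: "E \<subseteq> V \<times> V"
    and right: "\<And>e. e \<in> E \<Longrightarrow> x (fst e) < x (snd e)"
    and nc: "\<And>e e'. e \<in> E \<Longrightarrow> e' \<in> E \<Longrightarrow> e \<noteq> e' \<Longrightarrow> \<not> crosses x y e e'"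
  shows "card E \<le> 4 * card V"
proof -
  define sl where "sl e = (y (snd e) - y (fst e)) / (x (snd e) - x (fst e))" for e
  have ch: "chord x y e t = y (fst e) + sl e * (t - x (fst e))" for e t
    by (simp add: chord_def sl_def)
  have finE: "finite E" using E V finite_subset by blast
  have slinj: "e = e'" if "e \<in> E" "e' \<in> E" "fst e = fst e'" "sl e = sl e'" for e e'
  proof (rule ccontr)
    assume "e \<noteq> e'"
    define t where "t = (x (fst e) + min (x (snd e)) (x (snd e'))) / 2"
    have "x (fst e) < min (x (snd e)) (x (snd e'))"
      using right[OF that(1)] right[OF that(2)] that by simp
    then have "crosses x y e e'" unfolding crosses_def
      by (intro exI[of _ t]) (use that in \<open>auto simp: t_def ch\<close>)
    then show False using nc that \<open>e \<noteq> e'\<close> by blast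
  qed
  define T where "T = {e \<in> E. \<forall>e'\<in>E. fst e' = fst e \<longrightarrow> sl e' \<le> sl e}"
  have "inj_on fst T"
  proof (rule inj_onI)
    fix e e' assume "e \<in> T" "e' \<in> T" "fst e = fst e'"
    then show "e = e'" by (intro slinj) (auto simp: T_def intro: antisym)
  qed
  moreover have "fst ` T \<subseteq> V" using E by (auto simp: T_def)
  ultimately have cT: "card T \<le> card V" using V card_inj_on_le by blast
  define N where "N = E - T"
  have "\<exists>e'. e' \<in> E \<and> fst e' = fst e \<and> sl e < sl e' \<and>
      (\<forall>e''\<in>E. fst e'' = fst e \<longrightarrow> sl e < sl e'' \<longrightarrow> sl e' \<le> sl e'')" if "e \<in> N" for e
  proof -
    let ?A = "{e'\<in>E. fst e' = fst e \<and> sl e < sl e'}"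
    have A: "finite ?A" "?A \<noteq> {}" using that finE by (auto simp: N_def T_def not_le)
    have "arg_min_on sl ?A \<in> ?A" "\<And>z. z \<in> ?A \<Longrightarrow> sl (arg_min_on sl ?A) \<le> sl z"
      by (rule arg_min_if_finite(1)[OF A], rule arg_min_least[OF A])
    then show ?thesis by (intro exI[of _ "arg_min_on sl ?A"]) blast
  qed
  then have "\<forall>e\<in>N. \<exists>e'. e' \<in> E \<and> fst e' = fst e \<and> sl e < sl e' \<and>
      (\<forall>e''\<in>E. fst e'' = fst e \<longrightarrow> sl e < sl e'' \<longrightarrow> sl e' \<le> sl e'')" by blast
  from bchoice[OF this] obtain nx where nx': "\<forall>e\<in>N. nx e \<in> E \<and> fst (nx e) = fst e \<and> sl e < sl (nx e) \<and>
      (\<forall>e''\<in>E. fst e'' = fst e \<longrightarrow> sl e < sl e'' \<longrightarrow> sl (nx e) \<le> sl e'')" by blast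
  have nx: "\<And>e. e \<in> N \<Longrightarrow> nx e \<in> E" "\<And>e. e \<in> N \<Longrightarrow> fst (nx e) = fst e"
      "\<And>e. e \<in> N \<Longrightarrow> sl e < sl (nx e)"
      "\<And>e e''. e \<in> N \<Longrightarrow> e'' \<in> E \<Longrightarrow> fst e'' = fst e \<Longrightarrow> sl e < sl e'' \<Longrightarrow> sl (nx e) \<le> sl e''"
    using nx' by blast+
  have NE: "e \<in> E" if "e \<in> N" for e using that by (simp add: N_def)
  \<comment> \<open>The wedge to the right of \<open>fst e\<close> between \<open>e\<close> and the
    next steeper edge \<open>nx e\<close>. Both right endpoints belong to it, so both edges reach at
    least as far as its leftmost vertex \<open>u e\<close>.\<close>
  define W where "W e = {u\<in>V. x (fst e) < x u \<and> chord x y e (x u) \<le> y u \<and> y u \<le> chord x y (nx e) (x u)}" for e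
  define u where "u e = arg_min_on x (W e)" for e
  have less: "chord x y e t < chord x y (nx e) t" if "e \<in> N" "x (fst e) < t" for e t
    using nx[OF that(1)] that by (auto simp: ch)
  have sW: "snd e \<in> W e" "snd (nx e) \<in> W e" if "e \<in> N" for e
  proof -
    have 1: "x (fst e) < x (snd e)" "x (fst (nx e)) < x (snd (nx e))"
      using right[OF NE[OF that]] right[OF nx(1)[OF that]] by auto
    have 2: "snd e \<in> V" "snd (nx e) \<in> V" using E NE[OF that] nx(1)[OF that] by auto
    show "snd e \<in> W e" using 1 2 less[OF that 1(1)] chord_snd[OF 1(1), of y] unfolding W_def by simp
    show "snd (nx e) \<in> W e" using 1 2 less[OF that, of "x (snd (nx e))"] chord_snd[OF 1(2), of y] nx(2)[OF that]
      unfolding W_def by simp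
  qed
  have finW: "finite (W e)" for e using V by (simp add: W_def)
  have uW: "u e \<in> W e" and umin: "\<And>z. z \<in> W e \<Longrightarrow> x (u e) \<le> x z" if "e \<in> N" for e
    using arg_min_if_finite(1)[OF finW, of e x] arg_min_least[OF finW, of e _ x] sW[OF that]
    by (auto simp: u_def)
  \<comment> \<open>The charged vertex lies on the lower edge, on the upper edge, or strictly
    between them; this is the multiplicity three.\<close>
  define ty :: "'a \<times> 'a \<Rightarrow> nat" where
    "ty e = (if chord x y e (x (u e)) = y (u e) then 0
       else if y (u e) = chord x y (nx e) (x (u e)) then 1 else 2)" for e
  have key: "e1 = e2" if e: "e1 \<in> N" "e2 \<in> N" "u e1 = u e2" "ty e1 = ty e2" "x (fst e1) \<le> x (fst e2)" for e1 e2
  proof (rule ccontr)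
    assume ne: "e1 \<noteq> e2"
    define w where "w = u e1"
    have w1: "w \<in> W e1" "w \<in> W e2" using uW[OF e(1)] uW[OF e(2)] e(3) by (simp_all add: w_def)
    have lt: "x (fst e1) < x w" "x (fst e2) < x w" using w1 by (auto simp: W_def)
    note l1 = less[OF e(1) lt(1)] and l2 = less[OF e(2) lt(2)]
    \<comment> \<open>Equality would put \<open>w\<close> on the lower edge of one wedge and on the
      upper edge of the other, which are different types.\<close>
    have s: "chord x y e1 (x w) < chord x y (nx e2) (x w)" "chord x y e2 (x w) < chord x y (nx e1) (x w)"
      using w1 l1 l2 e(4) unfolding W_def ty_def e(3)[symmetric] w_def[symmetric] by (auto split: if_splits)
    have ends: "x w \<le> x (snd e1)" "x w \<le> x (snd (nx e1))" "x w \<le> x (snd e2)" "x w \<le> x (snd (nx e2))"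
      using umin[OF e(1) sW(1)[OF e(1)]] umin[OF e(1) sW(2)[OF e(1)]]
        umin[OF e(2) sW(1)[OF e(2)]] umin[OF e(2) sW(2)[OF e(2)]] e(3) by (simp_all add: w_def)
    show False
    proof (cases "fst e1 = fst e2")
      case True
      have "sl e1 \<noteq> sl e2" using ne slinj NE e True by blast
      then consider "sl e1 < sl e2" | "sl e2 < sl e1" by linarith
      then show False
      proof cases
        case 1
        have "sl (nx e1) \<le> sl e2" using nx(4)[OF e(1) NE[OF e(2)]] True 1 by simp
        then have "chord x y (nx e1) (x w) \<le> chord x y e2 (x w)"
          using lt nx(2)[OF e(1)] True by (simp add: ch mult_right_mono)
        then show False using s by simp
      next
        case 2
        have "sl (nx e2) \<le> sl e1" using nx(4)[OF e(2) NE[OF e(1)]] True 2 by simp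
        then have "chord x y (nx e2) (x w) \<le> chord x y e1 (x w)"
          using lt nx(2)[OF e(2)] True by (simp add: ch mult_right_mono)
        then show False using s by simp
      qed
    next
      case False
      define v where "v = fst e2"
      have vV: "v \<in> V" "fst e1 \<in> V" using E NE[OF e(2)] NE[OF e(1)] by (auto simp: v_def)
      then have vlt: "x (fst e1) < x v" using e(5) False V(2) by (force simp: v_def inj_on_def order.strict_iff_order)
      \<comment> \<open>\<open>w\<close> is leftmost in the first wedge and \<open>v\<close> lies to
        the left of \<open>w\<close>, so \<open>v\<close> is below or above that wedge. At
        \<open>w\<close> the two wedges overlap, hence an edge leaving \<open>v\<close> has to cut a
        side of the first wedge on the way.\<close>
      have "v \<notin> W e1" using umin[OF e(1), of v] lt(2) by (auto simp: w_def v_def)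
      then consider "y v < chord x y e1 (x v)" | "chord x y (nx e1) (x v) < y v"
        using vV vlt by (force simp: W_def)
      then show False
      proof cases
        case 1
        have c0: "chord x y (nx e2) (x v) = y v" using chord_fst[of x y "nx e2"] nx(2)[OF e(2)] by (simp add: v_def)
        have "x v < x w" using lt by (simp add: v_def)
        then obtain r where r: "x v < r" "r < x w" "chord x y (nx e2) r = chord x y e1 r"
          using chord_ivt[of "x v" "x w" x y "nx e2" e1] 1 s c0 by auto
        have "crosses x y (nx e2) e1" unfolding crosses_def
          by (intro exI[of _ r]) (use r vlt ends nx(2)[OF e(2)] in \<open>auto simp: v_def\<close>)
        moreover have "nx e2 \<noteq> e1" using nx(2)[OF e(2)] False by auto
        ultimately show False using nc nx(1)[OF e(2)] NE[OF e(1)] by blast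
      next
        case 2
        have c0: "chord x y e2 (x v) = y v" by (simp add: v_def)
        have "x v < x w" using lt by (simp add: v_def)
        then obtain r where r: "x v < r" "r < x w" "chord x y (nx e1) r = chord x y e2 r"
          using chord_ivt[of "x v" "x w" x y "nx e1" e2] 2 s c0 by auto
        have "crosses x y (nx e1) e2" unfolding crosses_def
          by (intro exI[of _ r]) (use r vlt ends nx(2)[OF e(1)] in \<open>auto simp: v_def\<close>)
        moreover have "nx e1 \<noteq> e2" using nx(2)[OF e(1)] False by auto
        ultimately show False using nc nx(1)[OF e(1)] NE[OF e(2)] by blast
      qed
    qed
  qed
  have "inj_on (\<lambda>e. (u e, ty e)) N"
  proof (rule inj_onI)
    fix e1 e2 assume "e1 \<in> N" "e2 \<in> N" "(u e1, ty e1) = (u e2, ty e2)"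
    then show "e1 = e2"
      using key[of e1 e2] key[of e2 e1] by (cases "x (fst e1) \<le> x (fst e2)") auto
  qed
  moreover have "(\<lambda>e. (u e, ty e)) ` N \<subseteq> V \<times> {0,1,2}"
  proof (rule image_subsetI)
    fix e assume "e \<in> N"
    then show "(u e, ty e) \<in> V \<times> {0,1,2}" using uW[of e] by (simp add: W_def ty_def)
  qed
  ultimately have "card N \<le> card (V \<times> {0,1,2::nat})"
    using V by (intro card_inj_on_le) auto
  then have "card N \<le> 3 * card V" by (simp add: card_cartesian_product)
  moreover have "card E = card N + card T"
  proof -
    have "N \<union> T = E" "N \<inter> T = {}" by (auto simp: N_def T_def)
    then show ?thesis using card_Un_disjoint[of N T] finE by (metis finite_Un)
  qed
  ultimately show ?thesis using cT by linarith
qed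

text \<open>Deleting one edge of a crossing pair removes one edge and at least one crossing.
  Repeating this ends in a graph without crossings, where \<open>noncrossing_card\<close>
  applies.\<close>

lemma crossing_pairs_lower_bound:
  fixes x y :: "'a \<Rightarrow> real"
  assumes V: "finite V" "inj_on x V"
  shows "E \<subseteq> V \<times> V \<Longrightarrow> (\<And>e. e \<in> E \<Longrightarrow> x (fst e) < x (snd e)) \<Longrightarrow>
    card E \<le> card {p \<in> E \<times> E. fst p \<noteq> snd p \<and> crosses x y (fst p) (snd p)} + 4 * card V"
proof (induction "card E" arbitrary: E rule: less_induct)
  case less
  let ?X = "\<lambda>E. {p \<in> E \<times> E. fst p \<noteq> snd p \<and> crosses x y (fst p) (snd p)}"
  have finE: "finite E" using less.prems V finite_subset by blast
  show ?case
  proof (cases "?X E = {}")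
    case True
    then have "card E \<le> 4 * card V"
      by (intro noncrossing_card[OF V less.prems]) auto
    then show ?thesis by simp
  next
    case False
    then obtain e e' where e: "(e, e') \<in> ?X E" by auto
    let ?E = "E - {e}"
    have lt: "card ?E < card E" using e finE by (intro psubset_card_mono) auto
    have "card ?E \<le> card (?X ?E) + 4 * card V"
      using less.prems by (intro less.hyps[OF lt]) auto
    moreover have "card (?X ?E) < card (?X E)"
    proof (rule psubset_card_mono)
      show "finite (?X E)" using finite_subset[of "?X E" "E \<times> E"] finE by blast
      have "(e, e') \<notin> ?X ?E" by simp
      then show "?X ?E \<subset> ?X E" using e by blast
    qed
    moreover have "card E = Suc (card ?E)" using e finE by (intro card.remove) auto
    ultimately show ?thesis by linarith
  qed
qed

lemma sum_card_swap:
  assumes "finite A" "finite B"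
  shows "(\<Sum>a\<in>A. card {b \<in> B. R a b}) = (\<Sum>b\<in>B. card {a \<in> A. R a b})"
proof -
  have "(\<Sum>a\<in>A. card {b \<in> B. R a b}) = (\<Sum>a\<in>A. \<Sum>b\<in>B. if R a b then 1 else 0)"
    using assms by (simp add: sum.If_cases Int_def)
  also have "\<dots> = (\<Sum>b\<in>B. \<Sum>a\<in>A. if R a b then 1 else 0)" by (rule sum.swap)
  also have "\<dots> = (\<Sum>b\<in>B. card {a \<in> A. R a b})"
    using assms by (simp add: sum.If_cases Int_def)
  finally show ?thesis .
qed

text \<open>A random function vanishes on \<open>A\<close> with probability 1 /
  \<open>K ^ card A\<close>; the multiplied form stays within the natural numbers.\<close>

lemma card_PiE_zero_on:
  assumes "finite V" "A \<subseteq> V"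
  shows "card {h \<in> V \<rightarrow>\<^sub>E {..<K}. \<forall>v\<in>A. h v = 0} * K ^ card A = (if K = 0 \<and> A \<noteq> {} then 0 else K ^ card V)"
proof (cases "K = 0")
  case True
  then show ?thesis using assms finite_subset[OF assms(2,1)]
    by (cases "A = {}") (auto simp: card_PiE prod_constant)
next
  case False
  then have "{h \<in> V \<rightarrow>\<^sub>E {..<K}. \<forall>v\<in>A. h v = 0} = (\<Pi>\<^sub>E v\<in>V. if v \<in> A then {0} else {..<K})"
    using assms by (auto simp: PiE_iff extensional_def split: if_splits)
  then have "card {h \<in> V \<rightarrow>\<^sub>E {..<K}. \<forall>v\<in>A. h v = 0} = (\<Prod>v\<in>V. if v \<in> A then 1 else K)"
    using assms by (auto simp: card_PiE intro!: prod.cong)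
  also have "\<dots> = K ^ card (V - A)"
    using assms by (subst prod.If_cases) (auto simp: Diff_eq)
  finally show ?thesis using False assms
    by (simp add: power_add[symmetric] card_Diff_subset finite_subset card_mono)
qed

text \<open>The functions \<open>V \<rightarrow> {..<K}\<close> play the role of a random sample: the vertices mapped to \<open>0\<close>
  are kept, which happens with probability \<open>1 / K\<close>.\<close>

lemma crossing_sampling:
  assumes V: "finite V" and E: "E \<subseteq> V \<times> V" "\<And>e. e \<in> E \<Longrightarrow> fst e \<noteq> snd e"
    and X: "X \<subseteq> E \<times> E" "\<And>e e'. (e, e') \<in> X \<Longrightarrow> card {fst e, snd e, fst e', snd e'} = 4"
    and main: "\<And>U. U \<subseteq> V \<Longrightarrow> card {e \<in> E. fst e \<in> U \<and> snd e \<in> U} \<le>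
      card {p \<in> X. {fst (fst p), snd (fst p), fst (snd p), snd (snd p)} \<subseteq> U} + 4 * card U"
    and K: "K \<ge> 1"
  shows "card E * K ^ 2 \<le> card X + 4 * card V * K ^ 3"
proof -
  define H where "H = V \<rightarrow>\<^sub>E {..<K}"
  have finE: "finite E" using finite_subset[OF E(1)] V by simp
  then have fin: "finite H" "finite E" "finite X"
    using V finite_subset[OF X(1)] by (simp_all add: H_def finite_PiE)
  define c where "c A = card {h \<in> H. \<forall>v\<in>A. h v = 0}" for A
  have c: "c A * K ^ card A = K ^ card V" if "A \<subseteq> V" for A
    using card_PiE_zero_on[OF V that, of K] K by (simp add: c_def H_def)
  let ?ends = "\<lambda>p. {fst (fst p), snd (fst p), fst (snd p), snd (snd p)}"
  have endsV: "?ends p \<subseteq> V" if "p \<in> X" for p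
  proof -
    have "fst p \<in> E" "snd p \<in> E" using X(1) that by auto
    then have "fst p \<in> V \<times> V" "snd p \<in> V \<times> V" using E(1) by auto
    then show ?thesis by (simp add: mem_Times_iff)
  qed
  have "(\<Sum>h\<in>H. card {e \<in> E. \<forall>v\<in>{fst e, snd e}. h v = 0}) \<le>
      (\<Sum>h\<in>H. card {p \<in> X. \<forall>v\<in>?ends p. h v = 0} + 4 * card {v \<in> V. \<forall>u\<in>{v}. h u = 0})"
  proof (rule sum_mono)
    fix h assume "h \<in> H"
    let ?U = "{v \<in> V. h v = 0}"
    have 1: "{e \<in> E. \<forall>v\<in>{fst e, snd e}. h v = 0} = {e \<in> E. fst e \<in> ?U \<and> snd e \<in> ?U}"
      using E by auto
    have 2: "{p \<in> X. \<forall>v\<in>?ends p. h v = 0} = {p \<in> X. ?ends p \<subseteq> ?U}"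
    proof (intro Collect_cong conj_cong refl)
      fix p assume p: "p \<in> X"
      define A where "A = ?ends p"
      have "A \<subseteq> V" unfolding A_def by (rule endsV[OF p])
      then show "(\<forall>v\<in>?ends p. h v = 0) = (?ends p \<subseteq> ?U)" unfolding A_def[symmetric] by blast
    qed
    show "card {e \<in> E. \<forall>v\<in>{fst e, snd e}. h v = 0} \<le>
      card {p \<in> X. \<forall>v\<in>?ends p. h v = 0} + 4 * card {v \<in> V. \<forall>u\<in>{v}. h u = 0}"
      unfolding 1 2 using main[of ?U] by simp
  qed
  then have "(\<Sum>e\<in>E. c {fst e, snd e}) \<le> (\<Sum>p\<in>X. c (?ends p)) + 4 * (\<Sum>v\<in>V. c {v})"
    unfolding c_def sum.distrib sum_distrib_left[symmetric]
      sum_card_swap[OF fin(1) fin(2)] sum_card_swap[OF fin(1) fin(3)] sum_card_swap[OF fin(1) V] .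
  \<comment> \<open>Clears all denominators: a vertex survives with probability 1 / K, an edge with
    1 / K^2, and a crossing with 1 / K^4, because its four endpoints are distinct.\<close>
  then have "K^4 * (\<Sum>e\<in>E. c {fst e, snd e}) \<le> K^4 * ((\<Sum>p\<in>X. c (?ends p)) + 4 * (\<Sum>v\<in>V. c {v}))"
    by (rule mult_left_mono) simp
  then have "(\<Sum>e\<in>E. K^4 * c {fst e, snd e}) \<le> (\<Sum>p\<in>X. K^4 * c (?ends p)) + 4 * (\<Sum>v\<in>V. K^4 * c {v})"
    by (simp add: algebra_simps sum_distrib_left)
  moreover have "K^4 * c {fst e, snd e} = K^2 * K ^ card V" if "e \<in> E" for e
  proof -
    have "card {fst e, snd e} = 2" using E(2)[OF that] by simp
    moreover have "{fst e, snd e} \<subseteq> V" using E(1) that by auto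
    ultimately have "c {fst e, snd e} * K^2 = K ^ card V" using c by metis
    then show ?thesis by (simp add: power4_eq_xxxx power2_eq_square algebra_simps)
  qed
  moreover have "K^4 * c (?ends p) = K ^ card V" if "p \<in> X" for p
  proof -
    have "?ends p \<subseteq> V" by (rule endsV[OF that])
    moreover have "card (?ends p) = 4" using X(2)[of "fst p" "snd p"] that by simp
    ultimately show ?thesis using c by (metis mult.commute)
  qed
  moreover have "K^4 * c {v} = K^3 * K ^ card V" if "v \<in> V" for v
    using c[of "{v}"] that by (simp add: power4_eq_xxxx power3_eq_cube algebra_simps)
  ultimately have "card E * (K^2 * K ^ card V) \<le> card X * K ^ card V + 4 * (card V * (K^3 * K ^ card V))"
    by simp
  then have "(card E * K^2) * K ^ card V \<le> (card X + 4 * card V * K^3) * K ^ card V"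
    by (simp add: algebra_simps)
  then show ?thesis using K by simp
qed

text \<open>The edges of the graph join consecutive points of \<open>P\<close> on a line of
  \<open>L\<close>. Two lines meet at most once, so there are at most \<open>card L ^ 2\<close>
  crossings, while the edges on a line account for all its incidences but the last. The parameter
  \<open>K\<close> stays free, to be optimised later.\<close>

lemma incidences_affine:
  fixes x y :: "'a \<Rightarrow> real" and L :: "(real \<times> real) set"
  assumes P: "finite P" "inj_on x P" and L: "finite L" and K: "K \<ge> 1"
  shows "card {(p, l) \<in> P \<times> L. y p = fst l * x p + snd l} * K ^ 2 \<le>
    card L * K ^ 2 + card L ^ 2 + 4 * card P * K ^ 3"
proof -
  define on_l where "on_l p l \<longleftrightarrow> y p = fst l * x p + snd l" for p and l :: "real \<times> real"
  define ln where "ln l t = fst l * t + snd l" for l :: "real \<times> real" and t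
  have ln_eq: "l = l'" if "ln l s = ln l' s" "ln l t = ln l' t" "s \<noteq> t" for l l' s t
  proof -
    have "(fst l - fst l') * (s - t) = 0" using that by (simp add: ln_def algebra_simps)
    then have "fst l = fst l'" using that by simp
    then show ?thesis using that by (simp add: ln_def prod_eq_iff)
  qed
  define cons where "cons p q l \<longleftrightarrow> p \<in> P \<and> q \<in> P \<and> x p < x q \<and> l \<in> L \<and> on_l p l \<and> on_l q l \<and>
    (\<forall>r\<in>P. on_l r l \<longrightarrow> \<not> (x p < x r \<and> x r < x q))" for p q l
  define E where "E = {e. \<exists>l. cons (fst e) (snd e) l}"
  define lf where "lf e = (SOME l. cons (fst e) (snd e) l)" for e
  have lf: "cons (fst e) (snd e) (lf e)" if "e \<in> E" for e
    using that unfolding E_def lf_def by (auto intro: someI_ex)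
  have EP: "E \<subseteq> P \<times> P" by (auto simp: E_def cons_def)
  have right: "x (fst e) < x (snd e)" if "e \<in> E" for e using lf[OF that] by (simp add: cons_def)
  have chord_ln: "chord x y e t = ln (lf e) t" if "e \<in> E" for e t
    using lf[OF that] by (simp add: cons_def on_l_def chord_def ln_def divide_simps) (simp add: algebra_simps)
  have uniq: "e = e'" if "e \<in> E" "e' \<in> E" "lf e = lf e'" "x (fst e) < t" "t < x (snd e)"
    "x (fst e') < t" "t < x (snd e')" for e e' t
  proof -
    note l = lf[OF that(1)] lf[OF that(2)]
    have "\<not> x (fst e) < x (fst e')" "\<not> x (fst e') < x (fst e)"
      "\<not> x (snd e) < x (snd e')" "\<not> x (snd e') < x (snd e)"
      using l that unfolding cons_def by force+
    then have "x (fst e) = x (fst e')" "x (snd e) = x (snd e')" by linarith+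
    moreover have "fst e \<in> P" "fst e' \<in> P" "snd e \<in> P" "snd e' \<in> P" using l by (auto simp: cons_def)
    ultimately have "fst e = fst e'" "snd e = snd e'" using P(2) by (auto dest: inj_onD)
    then show ?thesis by (rule prod_eqI)
  qed
  define X where "X = {p \<in> E \<times> E. fst p \<noteq> snd p \<and> crosses x y (fst p) (snd p)}"
  have crossing: "lf e \<noteq> lf e' \<and> (\<exists>t. x (fst e) < t \<and> t < x (snd e) \<and> x (fst e') < t \<and> t < x (snd e')
      \<and> ln (lf e) t = ln (lf e') t)" if "(e, e') \<in> X" for e e'
  proof -
    have e: "e \<in> E" "e' \<in> E" "e \<noteq> e'" using that by (auto simp: X_def)
    have "crosses x y e e'" using that by (simp add: X_def)
    then obtain t where t: "x (fst e) < t" "t < x (snd e)" "x (fst e') < t" "t < x (snd e')"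
      "chord x y e t = chord x y e' t" unfolding crosses_def by blast
    have "lf e \<noteq> lf e'" using uniq[OF e(1,2) _ t(1-4)] e(3) by blast
    then show ?thesis using t chord_ln[OF e(1)] chord_ln[OF e(2)] by auto
  qed
  have "finite E" using finite_subset[OF EP] P by simp
  then have fin: "finite E" "finite X" using finite_subset[of X "E \<times> E"] by (auto simp: X_def)
  \<comment> \<open>Two different non-vertical lines meet over one abscissa, and at most one edge of
    each line lies over it. So a crossing is determined by its pair of lines.\<close>
  have "inj_on (\<lambda>p. (lf (fst p), lf (snd p))) X"
  proof (rule inj_onI)
    fix p q assume pq: "p \<in> X" "q \<in> X" "(lf (fst p), lf (snd p)) = (lf (fst q), lf (snd q))"
    obtain s where s: "lf (fst p) \<noteq> lf (snd p)" "x (fst (fst p)) < s" "s < x (snd (fst p))"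
      "x (fst (snd p)) < s" "s < x (snd (snd p))" "ln (lf (fst p)) s = ln (lf (snd p)) s"
      using crossing[of "fst p" "snd p"] pq by auto
    obtain t where t: "x (fst (fst q)) < t" "t < x (snd (fst q))"
      "x (fst (snd q)) < t" "t < x (snd (snd q))" "ln (lf (fst q)) t = ln (lf (snd q)) t"
      using crossing[of "fst q" "snd q"] pq by auto
    have "s = t" using ln_eq[of "lf (fst p)" s "lf (snd p)" t] s t pq by auto
    moreover have "fst p \<in> E" "snd p \<in> E" "fst q \<in> E" "snd q \<in> E" using pq by (auto simp: X_def)
    ultimately show "p = q"
      using uniq[of "fst p" "fst q" s] uniq[of "snd p" "snd q" s] s t pq by (simp add: prod_eq_iff)
  qed
  moreover have "(\<lambda>p. (lf (fst p), lf (snd p))) ` X \<subseteq> L \<times> L"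
    using lf by (auto simp: X_def cons_def)
  ultimately have "card X \<le> card (L \<times> L)" using L by (intro card_inj_on_le) auto
  then have cX: "card X \<le> card L ^ 2" by (simp add: card_cartesian_product power2_eq_square)
  have ends: "card {fst e, snd e, fst e', snd e'} = 4" if eX: "(e, e') \<in> X" for e e'
  proof -
    obtain t where t: "lf e \<noteq> lf e'" "x (fst e) < t" "t < x (snd e)"
      "x (fst e') < t" "t < x (snd e')" "ln (lf e) t = ln (lf e') t"
      using crossing[OF eX] by auto
    have eE: "e \<in> E" "e' \<in> E" using eX by (auto simp: X_def)
    have on: "y (fst e) = ln (lf e) (x (fst e))" "y (snd e) = ln (lf e) (x (snd e))"
       "y (fst e') = ln (lf e') (x (fst e'))" "y (snd e') = ln (lf e') (x (snd e'))"
      using lf[OF eE(1)] lf[OF eE(2)] by (auto simp: cons_def on_l_def ln_def)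
    have "v \<noteq> v'" if "v \<in> {fst e, snd e}" "v' \<in> {fst e', snd e'}" for v v'
    proof
      assume "v = v'"
      then have "ln (lf e) (x v) = ln (lf e') (x v)" "x v \<noteq> t" using that on t by auto
      then show False using ln_eq t by blast
    qed
    then have "fst e \<noteq> fst e'" "fst e \<noteq> snd e'" "snd e \<noteq> fst e'" "snd e \<noteq> snd e'" by blast+
    moreover have "fst e \<noteq> snd e" "fst e' \<noteq> snd e'" using right[OF eE(1)] right[OF eE(2)] by auto
    ultimately show ?thesis by simp
  qed
  have "card E * K ^ 2 \<le> card X + 4 * card P * K ^ 3"
  proof (rule crossing_sampling[OF P(1) EP _ _ ends _ K])
    show "fst e \<noteq> snd e" if "e \<in> E" for e using right[OF that] by auto
    show "X \<subseteq> E \<times> E" by (auto simp: X_def)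
    fix U assume U: "U \<subseteq> P"
    let ?E = "{e \<in> E. fst e \<in> U \<and> snd e \<in> U}"
    have "card ?E \<le> card {p \<in> ?E \<times> ?E. fst p \<noteq> snd p \<and> crosses x y (fst p) (snd p)} + 4 * card U"
      using U P right by (intro crossing_pairs_lower_bound) (auto intro: finite_subset inj_on_subset)
    also have "{p \<in> ?E \<times> ?E. fst p \<noteq> snd p \<and> crosses x y (fst p) (snd p)} =
       {p \<in> X. {fst (fst p), snd (fst p), fst (snd p), snd (snd p)} \<subseteq> U}"
      by (auto simp: X_def)
    finally show "card ?E \<le> card {p \<in> X. {fst (fst p), snd (fst p), fst (snd p), snd (snd p)} \<subseteq> U} + 4 * card U" .
  qed auto
  then have cE: "card E * K ^ 2 \<le> card L ^ 2 + 4 * card P * K ^ 3" using cX by linarith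
  define F where "F = {(p, l) \<in> P \<times> L. on_l p l}"
  \<comment> \<open>Incidences whose point has a successor on the line; they inject into the edges,
    and each line has at most one further incidence.\<close>
  define F1 where "F1 = {(p, l) \<in> F. \<exists>q\<in>P. on_l q l \<and> x p < x q}"
  have finF: "finite F" using P L by (auto simp: F_def intro: finite_subset[of _ "P \<times> L"])
  have "\<exists>q. cons (fst f) q (snd f)" if "f \<in> F1" for f
  proof -
    let ?A = "{q \<in> P. on_l q (snd f) \<and> x (fst f) < x q}"
    have A: "finite ?A" "?A \<noteq> {}" using that P by (auto simp: F1_def)
    have "arg_min_on x ?A \<in> ?A" "\<And>z. z \<in> ?A \<Longrightarrow> x (arg_min_on x ?A) \<le> x z"
      using arg_min_if_finite(1)[OF A] arg_min_least[OF A] by auto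
    moreover have "fst f \<in> P" "snd f \<in> L" "on_l (fst f) (snd f)" using that by (auto simp: F1_def F_def)
    ultimately show ?thesis
      by (intro exI[of _ "arg_min_on x ?A"]) (fastforce simp: cons_def)
  qed
  then have "\<forall>f\<in>F1. \<exists>q. cons (fst f) q (snd f)" by blast
  from bchoice[OF this] obtain nx where nx: "\<And>f. f \<in> F1 \<Longrightarrow> cons (fst f) (nx f) (snd f)" by blast
  have "inj_on (\<lambda>f. (fst f, nx f)) F1"
  proof (rule inj_onI)
    fix f g assume fg: "f \<in> F1" "g \<in> F1" "(fst f, nx f) = (fst g, nx g)"
    have "snd f = snd g"
      by (rule ln_eq[of _ "x (fst f)" _ "x (nx f)"])
        (use nx[OF fg(1)] nx[OF fg(2)] fg(3) in \<open>auto simp: cons_def on_l_def ln_def\<close>)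
    then show "f = g" using fg by (simp add: prod_eq_iff)
  qed
  moreover have "(\<lambda>f. (fst f, nx f)) ` F1 \<subseteq> E"
  proof (rule image_subsetI)
    fix f assume "f \<in> F1"
    then show "(fst f, nx f) \<in> E" using nx[of f] unfolding E_def mem_Collect_eq fst_conv snd_conv by blast
  qed
  ultimately have c1: "card F1 \<le> card E" using fin by (intro card_inj_on_le) auto
  have "inj_on snd (F - F1)"
  proof (rule inj_onI)
    fix f g assume fg: "f \<in> F - F1" "g \<in> F - F1" "snd f = snd g"
    have last: "\<not> x (fst f) < x (fst g)" if "f \<in> F - F1" "g \<in> F" "snd f = snd g" for f g
    proof
      assume "x (fst f) < x (fst g)"
      moreover have "fst g \<in> P" "on_l (fst g) (snd f)" using that(2,3) by (auto simp: F_def)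
      ultimately have "f \<in> F1" using that(1) unfolding F1_def case_prod_beta mem_Collect_eq prod.collapse by blast
      then show False using that(1) by blast
    qed
    have "\<not> x (fst f) < x (fst g)" "\<not> x (fst g) < x (fst f)"
      using last[OF fg(1) _ fg(3)] last[OF fg(2) _ fg(3)[symmetric]] fg(1,2) by simp_all
    then have "x (fst f) = x (fst g)" by linarith
    moreover have "fst f \<in> P" "fst g \<in> P" using fg(1,2) by (auto simp: F_def)
    ultimately have "fst f = fst g" using P(2) by (simp add: inj_on_eq_iff)
    then show "f = g" using fg(3) by (rule prod_eqI)
  qed
  moreover have "snd ` (F - F1) \<subseteq> L" by (auto simp: F_def)
  ultimately have c2: "card (F - F1) \<le> card L" using L by (intro card_inj_on_le) auto
  have "card F = card F1 + card (F - F1)"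
  proof -
    have "F1 \<union> (F - F1) = F" "F1 \<inter> (F - F1) = {}" by (auto simp: F1_def)
    then show ?thesis using card_Un_disjoint[of F1 "F - F1"] finF by (metis finite_Un)
  qed
  then have "card F \<le> card E + card L" using c1 c2 by linarith
  then have "card F * K^2 \<le> card E * K^2 + card L * K^2" by (metis add_mult_distrib mult_le_mono1)
  then show ?thesis using cE unfolding F_def on_l_def by linarith
qed

section \<open>The Szemeredi-Trotter theorem\<close>

text \<open>A line is represented by its lattice points, so equations with the same lattice points
  give the same line. The set may be empty or a single point.\<close>

definition int_lines :: "(int \<times> int) set set" where
  "int_lines = {l. \<exists>a b c. (a, b) \<noteq> (0, 0) \<and> l = {p. a * fst p + b * snd p = c}}"

definition incidences :: "(int \<times> int) set \<Rightarrow> (int \<times> int) set set \<Rightarrow> nat" where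
  "incidences P L = card {(p, l) \<in> P \<times> L. p \<in> l}"

lemma finite_int_root:
  assumes "(u, w) \<noteq> (0 :: int, 0 :: int)"
  shows "finite {N :: nat. int N * u + w = 0}"
proof (cases "u = 0")
  case False
  have "{N :: nat. int N * u + w = 0} \<subseteq> {nat ((- w) div u)}"
  proof
    fix N :: nat assume "N \<in> {N. int N * u + w = 0}"
    then have "- w = int N * u" by simp
    then show "N \<in> {nat ((- w) div u)}" using False by simp
  qed
  then show ?thesis using finite_subset by blast
qed (use assms in auto)

text \<open>The coordinates \<open>x = N * fst p + snd p\<close> and \<open>y = fst p\<close> with a generic \<open>N\<close> make the abscissae
  of \<open>P\<close> distinct and every line in \<open>L\<close> non-vertical.\<close>

lemma incidences_bound_sampling:
  assumes P: "finite P" and L: "finite L" "L \<subseteq> int_lines" and K: "K \<ge> 1"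
  shows "incidences P L * K ^ 2 \<le> card L * K ^ 2 + card L ^ 2 + 4 * card P * K ^ 3"
proof -
  have "\<forall>l\<in>L. \<exists>abc. (fst abc, fst (snd abc)) \<noteq> (0, 0) \<and>
     l = {p. fst abc * fst p + fst (snd abc) * snd p = snd (snd abc)}"
  proof
    fix l assume "l \<in> L"
    then obtain a b c where "(a, b) \<noteq> (0, 0)" "l = {p. a * fst p + b * snd p = c}"
      using L unfolding int_lines_def by blast
    then show "\<exists>abc. (fst abc, fst (snd abc)) \<noteq> (0, 0) \<and>
       l = {p. fst abc * fst p + fst (snd abc) * snd p = snd (snd abc)}"
      by (intro exI[of _ "(a, b, c)"]) simp
  qed
  from bchoice[OF this] obtain h where h: "\<forall>l\<in>L. (fst (h l), fst (snd (h l))) \<noteq> (0, 0) \<and>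
     l = {p. fst (h l) * fst p + fst (snd (h l)) * snd p = snd (snd (h l))}" ..
  define A B C where "A l = fst (h l)" and "B l = fst (snd (h l))" and "C l = snd (snd (h l))" for l
  have nz: "(A l, B l) \<noteq> (0, 0)" and mem: "p \<in> l \<longleftrightarrow> A l * fst p + B l * snd p = C l"
    if "l \<in> L" for l p using h that by (auto simp: A_def B_def C_def)
  define bad where "bad = (\<Union>p\<in>P. \<Union>q\<in>P - {p}. {N :: nat. int N * (fst p - fst q) + (snd p - snd q) = 0})
     \<union> (\<Union>l\<in>L. {N :: nat. int N * (- B l) + A l = 0})"
  have "finite bad" unfolding bad_def using P L nz
    by (intro finite_UnI finite_UN_I finite_Diff finite_int_root) (auto simp: prod_eq_iff)
  then obtain N where N: "N \<notin> bad" using ex_new_if_finite infinite_UNIV_nat by blast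
  define x y where "x p = real_of_int (int N * fst p + snd p)" and "y p = real_of_int (fst p)" for p :: "int \<times> int"
  have inj: "inj_on x P"
  proof (rule inj_onI, rule ccontr)
    fix p q assume pq: "p \<in> P" "q \<in> P" "x p = x q" "p \<noteq> q"
    then have "int N * fst p + snd p = int N * fst q + snd q" unfolding x_def of_int_eq_iff by simp
    then have "int N * (fst p - fst q) + (snd p - snd q) = 0" by (simp add: algebra_simps)
    then show False using N pq by (auto simp: bad_def)
  qed
  \<comment> \<open>Slope and intercept in the new coordinates: substituting
    \<open>snd p = x - N * y\<close> turns A y + B \<open>snd p\<close> = C into (A - B N) y = C - B
    x.\<close>
  define g where "g l = (- real_of_int (B l) / real_of_int (A l - B l * int N),
       real_of_int (C l) / real_of_int (A l - B l * int N))" for l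
  have on: "p \<in> l \<longleftrightarrow> y p = fst (g l) * x p + snd (g l)" if "l \<in> L" for p l
  proof -
    have "A l - B l * int N \<noteq> 0" using N that by (auto simp: bad_def algebra_simps)
    then have D: "real_of_int (A l - B l * int N) \<noteq> 0" by (simp only: of_int_eq_0_iff not_False_eq_True)
    define d where "d = real_of_int (A l - B l * int N)"
    have "y p = fst (g l) * x p + snd (g l) \<longleftrightarrow> y p * d = - real_of_int (B l) * x p + real_of_int (C l)"
      using D unfolding g_def d_def[symmetric] by (simp add: field_simps)
    also have "\<dots> \<longleftrightarrow> real_of_int (A l * fst p + B l * snd p) = real_of_int (C l)"
      by (simp add: x_def y_def d_def algebra_simps)
    also have "\<dots> \<longleftrightarrow> p \<in> l" using mem[OF that] by (simp only: of_int_eq_iff)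
    finally show ?thesis by simp
  qed
  have ginj: "inj_on g L"
  proof (rule inj_onI, rule set_eqI)
    fix l l' p assume "l \<in> L" "l' \<in> L" "g l = g l'"
    then show "p \<in> l \<longleftrightarrow> p \<in> l'" by (simp add: on)
  qed
  have "incidences P L = card ((\<lambda>(p, l). (p, g l)) ` {(p, l) \<in> P \<times> L. p \<in> l})"
    unfolding incidences_def using ginj by (intro card_image[symmetric]) (auto simp: inj_on_def)
  also have "(\<lambda>(p, l). (p, g l)) ` {(p, l) \<in> P \<times> L. p \<in> l} =
      {(p, l) \<in> P \<times> g ` L. y p = fst l * x p + snd l}"
    using on by force
  finally show ?thesis
    using incidences_affine[OF P inj finite_imageI[OF L(1), of g] K, of y] card_image[OF ginj] by simp
qed

lemma powr_two_thirds_cube: "x \<ge> 0 \<Longrightarrow> (x powr (2/3)) ^ 3 = x ^ 2" for x :: real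
  by (cases "x = 0") (auto simp: powr_power)

text \<open>Optimises the sampling parameter: m^2 / K^2 and n K balance at K = (m^2 / n) powr (1/3).
  This is at least 1 only for m^2 > n; otherwise K = 1 already gives a bound linear in n and
  m.\<close>

theorem szemeredi_trotter:
  assumes P: "finite P" and L: "finite L" "L \<subseteq> int_lines"
  shows "real (incidences P L) \<le> 9 * (real (card P) * real (card L)) powr (2/3) + 5 * card P + card L"
proof -
  define n m where "n = real (card P)" and "m = real (card L)"
  have nm: "n \<ge> 0" "m \<ge> 0" by (auto simp: n_def m_def)
  have main: "real (incidences P L) * real K ^ 2 \<le> m * real K ^ 2 + m ^ 2 + 4 * n * real K ^ 3" if "K \<ge> 1" for K
    using of_nat_mono[OF incidences_bound_sampling[OF P L that], where 'a = real]
    unfolding n_def m_def by simp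
  consider "n = 0" | "n \<ge> 1" "m ^ 2 \<le> n" | "n \<ge> 1" "m ^ 2 > n"
    unfolding n_def by fastforce
  then show ?thesis
  proof cases
    case 1
    then have "P = {}" using P by (simp add: n_def)
    then show ?thesis by (simp add: incidences_def)
  next
    case 2
    have "real (incidences P L) \<le> m + m ^ 2 + 4 * n" using main[of 1] by simp
    moreover have "(n * m) powr (2/3) \<ge> 0" by simp
    ultimately show ?thesis using 2 unfolding n_def m_def by linarith
  next
    case 3
    \<comment> \<open>The balancing value of K. Rounding up to an integer at most doubles it, so the
      4 n K term becomes 8 n z; with n z from the other term this gives the constant 9.\<close>
    define z where "z = (m ^ 2 / n) powr (1/3)"
    have mpos: "m > 0" using 3 nm by (cases "m = 0") auto
    have q1: "m ^ 2 / n \<ge> 1" using 3 by simp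
    then have z1: "z \<ge> 1" by (simp add: z_def ge_one_powr_ge_zero)
    have "z ^ 3 = (m ^ 2 / n) powr 1" using q1 by (subst z_def, subst powr_power) auto
    then have z3: "z ^ 3 = m ^ 2 / n" using q1 nm by simp
    define K where "K = nat \<lceil>z\<rceil>"
    have K: "z \<le> real K" "real K \<le> z + 1" "K \<ge> 1" using z1 unfolding K_def by linarith+
    have nz: "n * z = (n * m) powr (2/3)"
    proof -
      have "(m ^ 2) powr (1/3) = (m powr 2) powr (1/3)" using mpos by simp
      also have "\<dots> = m powr (2/3)" by (simp only: powr_powr) simp
      finally have "n * z = n powr 1 * (m powr (2/3) / n powr (1/3))"
        using 3 by (simp add: z_def powr_divide)
      also have "\<dots> = n powr (2/3) * m powr (2/3)" using powr_diff[of n 1 "1/3"] by simp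
      finally show ?thesis using 3 mpos by (simp add: powr_mult)
    qed
    have "real (incidences P L) \<le> m + m ^ 2 / real K ^ 2 + 4 * n * real K"
      using main[OF K(3)] K(3) by (simp add: field_simps power2_eq_square power3_eq_cube)
    also have "\<dots> \<le> m + m ^ 2 / z ^ 2 + 4 * n * (2 * z)"
      using K z1 3 by (intro add_mono mult_mono divide_left_mono power_mono order_refl) auto
    also have "m ^ 2 / z ^ 2 = n * z"
      using z3 3 z1 by (simp add: field_simps power2_eq_square power3_eq_cube)
    also have "n * z = (n * m) powr (2/3)" by (rule nz)
    also have "4 * n * (2 * z) = 8 * (n * m) powr (2/3)" using nz by simp
    finally show ?thesis using nm by (simp add: n_def m_def)
  qed
qed

lemma incidences_eq_sum: "finite P \<Longrightarrow> finite L \<Longrightarrow> incidences P L = (\<Sum>l\<in>L. card (l \<inter> P))"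
proof -
  assume fin: "finite P" "finite L"
  have "incidences P L = card (prod.swap ` {(p, l) \<in> P \<times> L. p \<in> l})"
    unfolding incidences_def by (rule card_image[symmetric], rule inj_on_subset[OF inj_swap subset_UNIV])
  also have "prod.swap ` {(p, l) \<in> P \<times> L. p \<in> l} = (SIGMA l:L. l \<inter> P)" by force
  also have "card \<dots> = (\<Sum>l\<in>L. card (l \<inter> P))" using fin by (intro card_SigmaI) auto
  finally show ?thesis .
qed

lemma incidences_ge:
  assumes "finite P" "finite L" "\<And>l. l \<in> L \<Longrightarrow> k \<le> real (card (l \<inter> P))"
  shows "real (card L) * k \<le> real (incidences P L)"
  using sum_bounded_below[of L k "\<lambda>l. real (card (l \<inter> P))"] assms by (simp add: incidences_eq_sum)

text \<open>The m lines have at least m k incidences. As k is at least 2, the term m of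
  Szemeredi-Trotter is absorbed into m k, and one of the other two terms dominates. If it is the
  power term, cubing gives m k^3 at most 36^3 n^2, whence 46656.\<close>

lemma rich_lines_card:
  assumes P: "finite P" and L: "finite L" "L \<subseteq> int_lines"
    and k: "k \<ge> 2" "\<And>l. l \<in> L \<Longrightarrow> k \<le> real (card (l \<inter> P))"
  shows "real (card L) \<le> 46656 * (real (card P) ^ 2 / k ^ 3 + real (card P) / k)"
proof -
  define n m where "n = real (card P)" and "m = real (card L)"
  have nm: "n \<ge> 0" "m \<ge> 0" by (auto simp: n_def m_def)
  define q where "q = (n * m) powr (2/3)"
  have q: "q \<ge> 0" "q ^ 3 = (n * m) ^ 2" using nm by (auto simp: q_def powr_two_thirds_cube)
  have "m * k \<le> 9 * q + 5 * n + m"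
    using incidences_ge[OF P L(1) k(2)] szemeredi_trotter[OF P L] by (simp add: n_def m_def q_def)
  moreover have "m * 2 \<le> m * k" using k nm by (intro mult_left_mono) auto
  ultimately have mk: "m * k \<le> 18 * q + 10 * n" by linarith
  have pos: "0 \<le> n ^ 2 / k ^ 3" "0 \<le> n / k" using nm k by auto
  show ?thesis
  proof (cases "18 * q \<le> 10 * n")
    case True
    then have "m \<le> 20 * (n / k)" using mk k by (simp add: field_simps)
    then have "m \<le> 46656 * (n ^ 2 / k ^ 3) + 46656 * (n / k)" using pos by linarith
    then show ?thesis unfolding n_def m_def by (simp add: distrib_left)
  next
    case False
    then have "m * k \<le> 36 * q" using mk by linarith
    then have "(m * k) ^ 3 \<le> (36 * q) ^ 3" using nm k by (intro power_mono) auto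
    then have "m ^ 2 * (m * k ^ 3) \<le> m ^ 2 * (46656 * n ^ 2)"
      using q by (simp add: power_mult_distrib) (simp add: power2_eq_square power3_eq_cube algebra_simps)
    moreover have "m > 0" using False nm by (cases "m = 0") (auto simp: q_def)
    ultimately have "m * k ^ 3 \<le> 46656 * n ^ 2" by simp
    then have "m \<le> 46656 * (n ^ 2 / k ^ 3)" using k by (simp add: field_simps)
    then have "m \<le> 46656 * (n ^ 2 / k ^ 3) + 46656 * (n / k)" using pos by linarith
    then show ?thesis unfolding n_def m_def by (simp add: distrib_left)
  qed
qed

text \<open>Once k^2 is at least n the power term is no worse than the linear one: if it dominates,
  then I^3 is at most 24^3 (n m)^2, and m k \<le> I turns this into I k^2 \<le> 13824 n^2. So on
  average a point lies on O(1) such lines, which makes heavy flags summable.\<close>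

lemma very_rich_lines_incidences:
  assumes P: "finite P" and L: "finite L" "L \<subseteq> int_lines"
    and k: "k \<ge> 4" "real (card P) \<le> k ^ 2" "\<And>l. l \<in> L \<Longrightarrow> k \<le> real (card (l \<inter> P))"
  shows "real (incidences P L) \<le> 13824 * real (card P)"
proof -
  define n m I where "n = real (card P)" and "m = real (card L)" and "I = real (incidences P L)"
  have nm: "n \<ge> 0" "m \<ge> 0" "I \<ge> 0" by (auto simp: n_def m_def I_def)
  define q where "q = (n * m) powr (2/3)"
  have q: "q \<ge> 0" "q ^ 3 = (n * m) ^ 2" using nm by (auto simp: q_def powr_two_thirds_cube)
  have mk: "m * k \<le> I" using incidences_ge[OF P L(1) k(3)] by (simp add: m_def I_def)
  have "m * 4 \<le> m * k" using k nm by (intro mult_left_mono) auto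
  then have I: "3/4 * I \<le> 9 * q + 5 * n"
    using szemeredi_trotter[OF P L] mk by (simp add: n_def m_def q_def I_def)
  show ?thesis
  proof (cases "9 * q \<le> 5 * n")
    case True
    then show ?thesis using I nm unfolding n_def I_def by linarith
  next
    case False
    then have "I \<le> 24 * q" using I by linarith
    then have "I ^ 3 \<le> (24 * q) ^ 3" using nm by (intro power_mono) auto
    also have "\<dots> = 13824 * (n * m) ^ 2" using q by (simp add: power_mult_distrib)
    finally have "I ^ 3 * k ^ 2 \<le> 13824 * (n * m) ^ 2 * k ^ 2" by (intro mult_right_mono) auto
    also have "\<dots> = 13824 * n ^ 2 * (m * k) ^ 2" by (simp add: power_mult_distrib)
    also have "\<dots> \<le> 13824 * n ^ 2 * I ^ 2" using mk nm k by (intro mult_left_mono power_mono) auto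
    finally have "I ^ 2 * (I * k ^ 2) \<le> I ^ 2 * (13824 * n ^ 2)"
      by (simp add: power2_eq_square power3_eq_cube algebra_simps)
    moreover have ne: "n > 0" using False nm q by (cases "n = 0") (auto simp: q_def)
    ultimately have "I = 0 \<or> I * k ^ 2 \<le> 13824 * n ^ 2"
      by (cases "I = 0") (auto simp: mult_le_cancel_left)
    moreover have "I * n \<le> I * k ^ 2" using k nm unfolding n_def by (intro mult_left_mono) auto
    ultimately have "I = 0 \<or> I * n \<le> 13824 * n * n" by (auto simp: power2_eq_square)
    then show ?thesis using ne nm by (auto simp: n_def I_def)
  qed
qed

section \<open>Lines and flags in the integer lattice\<close>

definition idot :: "int \<times> int \<Rightarrow> int \<times> int \<Rightarrow> int" where
  "idot u v = fst u * fst v + snd u * snd v"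

definition icross :: "int \<times> int \<Rightarrow> int \<times> int \<Rightarrow> int" where
  "icross u v = fst u * snd v - snd u * fst v"

definition line_through :: "int \<times> int \<Rightarrow> int \<times> int \<Rightarrow> (int \<times> int) set" where
  "line_through p q = {r. icross (q - p) (r - p) = 0}"

lemma line_through_mem [simp]: "p \<in> line_through p q" "q \<in> line_through p q"
  by (simp_all add: line_through_def icross_def)

lemma line_through_int_lines: "p \<noteq> q \<Longrightarrow> line_through p q \<in> int_lines"
proof -
  assume "p \<noteq> q"
  then have "(- snd (q - p), fst (q - p)) \<noteq> (0, 0)" by (auto simp: prod_eq_iff)
  moreover have "line_through p q = {r. - snd (q - p) * fst r + fst (q - p) * snd r = icross (q - p) p}"
    by (auto simp: line_through_def icross_def algebra_simps)
  ultimately show ?thesis unfolding int_lines_def by blast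
qed

lemma line_through_unique:
  assumes l: "l \<in> int_lines" "p \<in> l" "q \<in> l" "p \<noteq> q"
  shows "l = line_through p q"
proof -
  obtain a b c where abc: "(a, b) \<noteq> (0, 0)" "l = {p. a * fst p + b * snd p = c}"
    using l(1) unfolding int_lines_def by blast
  define u1 u2 where "u1 = fst q - fst p" and "u2 = snd q - snd p"
  have u: "u1 \<noteq> 0 \<or> u2 \<noteq> 0" using l(4) by (auto simp: u1_def u2_def prod_eq_iff)
  have au: "a * u1 + b * u2 = 0" using l(2,3) abc(2) by (simp add: u1_def u2_def algebra_simps)
  have "r \<in> l \<longleftrightarrow> r \<in> line_through p q" for r
  proof -
    define w1 w2 where "w1 = fst r - fst p" and "w2 = snd r - snd p"
    have 1: "r \<in> l \<longleftrightarrow> a * w1 + b * w2 = 0" using l(2) abc(2) by (auto simp: w1_def w2_def algebra_simps)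
    have 2: "r \<in> line_through p q \<longleftrightarrow> u1 * w2 - u2 * w1 = 0"
      by (simp add: line_through_def icross_def u1_def u2_def w1_def w2_def)
    have "u1 * w2 - u2 * w1 = 0" if "a * w1 + b * w2 = 0"
    proof -
      have "a * (u1 * w2 - u2 * w1) = 0" "b * (u1 * w2 - u2 * w1) = 0" using au that by algebra+
      then show ?thesis using abc(1) by auto
    qed
    moreover have "a * w1 + b * w2 = 0" if "u1 * w2 - u2 * w1 = 0"
    proof -
      have "u1 * (a * w1 + b * w2) = 0" "u2 * (a * w1 + b * w2) = 0" using au that by algebra+
      then show ?thesis using u by auto
    qed
    ultimately show ?thesis using 1 2 by blast
  qed
  then show ?thesis by blast
qed

lemma perp_collinear:
  assumes "idot (q - p) (r - p) = 0" "idot (q - p) (r' - p) = 0" "q \<noteq> p"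
  shows "r' \<in> line_through p r"
proof -
  define u1 u2 where "u1 = fst (q - p)" and "u2 = snd (q - p)"
  have u: "u1 \<noteq> 0 \<or> u2 \<noteq> 0" using assms(3) by (auto simp: u1_def u2_def prod_eq_iff)
  have h: "u1 * fst (r - p) + u2 * snd (r - p) = 0" "u1 * fst (r' - p) + u2 * snd (r' - p) = 0"
    using assms by (simp_all add: idot_def u1_def u2_def)
  have "u1 * icross (r - p) (r' - p) = 0" "u2 * icross (r - p) (r' - p) = 0"
    unfolding icross_def using h by algebra+
  then show ?thesis using u by (auto simp: line_through_def)
qed

lemma perp_on_line:
  assumes "idot (q - p) (r - p) = 0" "q' \<in> line_through p q" "q \<noteq> p"
  shows "idot (q' - p) (r - p) = 0"
proof -
  define u1 u2 where "u1 = fst (q - p)" and "u2 = snd (q - p)"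
  have u: "u1 \<noteq> 0 \<or> u2 \<noteq> 0" using assms(3) by (auto simp: u1_def u2_def prod_eq_iff)
  have h: "u1 * fst (r - p) + u2 * snd (r - p) = 0" "u1 * snd (q' - p) - u2 * fst (q' - p) = 0"
    using assms by (simp_all add: idot_def line_through_def icross_def u1_def u2_def)
  have "u1 * idot (q' - p) (r - p) = 0" "u2 * idot (q' - p) (r - p) = 0"
    unfolding idot_def using h by algebra+
  then show ?thesis using u by auto
qed

lemma idot_commute: "idot u v = idot v u"
  by (simp add: idot_def mult.commute)

text \<open>The first argument of the minimum grows and the second one decays geometrically. Each
  half of the sum is controlled by its largest term, attained next to the crossover, where both
  arguments are about sqrt (\<alpha> * \<beta>).\<close>

lemma sum_min_geometric:
  fixes \<alpha> \<beta> q :: real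
  assumes q: "q > 1" and ab: "\<alpha> \<ge> 0" "\<beta> \<ge> 0"
  shows "(\<Sum>i<n. min (\<alpha> * q ^ i) (\<beta> / q ^ i)) \<le> 2 * q / (q - 1) * sqrt (\<alpha> * \<beta>)"
proof -
  have half: "(\<Sum>i<n. if \<alpha> * q ^ i \<le> \<beta> / q ^ i then \<alpha> * q ^ i else 0) \<le> q / (q - 1) * sqrt (\<alpha> * \<beta>)"
    if "\<alpha> \<ge> 0" "\<beta> \<ge> 0" for \<alpha> \<beta> :: real and n
  proof (induction n)
    case 0
    then show ?case using that q by simp
  next
    case (Suc n)
    show ?case
    proof (cases "\<alpha> * q ^ n \<le> \<beta> / q ^ n")
      case False
      then show ?thesis using Suc by simp
    next
      case True
      have "(\<Sum>i<Suc n. if \<alpha> * q ^ i \<le> \<beta> / q ^ i then \<alpha> * q ^ i else 0) \<le> (\<Sum>i<Suc n. \<alpha> * q ^ i)"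
        using that q by (intro sum_mono) auto
      also have "\<dots> = \<alpha> * ((q ^ Suc n - 1) / (q - 1))"
        using q by (simp add: sum_distrib_left[symmetric] geometric_sum del: sum.lessThan_Suc)
      also have "\<dots> \<le> \<alpha> * (q ^ Suc n / (q - 1))"
        using that q by (intro mult_left_mono divide_right_mono) auto
      also have "\<dots> = q / (q - 1) * (\<alpha> * q ^ n)" by simp
      also have "\<alpha> * q ^ n \<le> sqrt (\<alpha> * \<beta>)"
      proof (rule real_le_rsqrt)
        have "\<alpha> * (\<alpha> * q ^ n * q ^ n) \<le> \<alpha> * \<beta>"
          using True q that by (intro mult_left_mono) (auto simp: field_simps)
        then show "(\<alpha> * q ^ n)\<^sup>2 \<le> \<alpha> * \<beta>" by (simp add: power2_eq_square algebra_simps)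
      qed
      then have "q / (q - 1) * (\<alpha> * q ^ n) \<le> q / (q - 1) * sqrt (\<alpha> * \<beta>)"
        using q by (intro mult_left_mono) auto
      finally show ?thesis .
    qed
  qed
  have "(\<Sum>i<n. min (\<alpha> * q ^ i) (\<beta> / q ^ i)) \<le>
     (\<Sum>i<n. if \<alpha> * q ^ i \<le> \<beta> / q ^ i then \<alpha> * q ^ i else 0) +
     (\<Sum>i<n. if \<beta> / q ^ i \<le> \<alpha> * q ^ i then \<beta> / q ^ i else 0)"
    unfolding sum.distrib[symmetric] using ab q by (intro sum_mono) auto
  \<comment> \<open>Reversing the order of summation makes the decaying half a growing one. The two
    new coefficients have the same product \<alpha> * \<beta>, so \<open>half\<close> applies
    again.\<close>
  also have "(\<Sum>i<n. if \<beta> / q ^ i \<le> \<alpha> * q ^ i then \<beta> / q ^ i else 0) =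
     (\<Sum>i<n. if \<beta> / q ^ (n - Suc i) \<le> \<alpha> * q ^ (n - Suc i) then \<beta> / q ^ (n - Suc i) else 0)"
    by (rule sum.nat_diff_reindex[symmetric])
  also have "\<dots> = (\<Sum>i<n. if (\<beta> / q ^ (n - 1)) * q ^ i \<le> (\<alpha> * q ^ (n - 1)) / q ^ i
      then (\<beta> / q ^ (n - 1)) * q ^ i else 0)"
  proof (rule sum.cong[OF refl])
    fix i assume "i \<in> {..<n}"
    then have "q ^ (n - 1) = q ^ (n - Suc i) * q ^ i" by (simp add: power_add[symmetric])
    then have "\<beta> / q ^ (n - 1) * q ^ i = \<beta> / q ^ (n - Suc i)"
      "\<alpha> * q ^ (n - 1) / q ^ i = \<alpha> * q ^ (n - Suc i)" using q by auto
    then show "(if \<beta> / q ^ (n - Suc i) \<le> \<alpha> * q ^ (n - Suc i) then \<beta> / q ^ (n - Suc i) else 0) =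
      (if (\<beta> / q ^ (n - 1)) * q ^ i \<le> (\<alpha> * q ^ (n - 1)) / q ^ i then (\<beta> / q ^ (n - 1)) * q ^ i else 0)" by simp
  qed
  also have "\<dots> \<le> q / (q - 1) * sqrt ((\<beta> / q ^ (n - 1)) * (\<alpha> * q ^ (n - 1)))"
    using ab q by (intro half) auto
  also have "(\<beta> / q ^ (n - 1)) * (\<alpha> * q ^ (n - 1)) = \<alpha> * \<beta>" using q by simp
  finally have "(\<Sum>i<n. min (\<alpha> * q ^ i) (\<beta> / q ^ i)) \<le>
      q / (q - 1) * sqrt (\<alpha> * \<beta>) + q / (q - 1) * sqrt (\<alpha> * \<beta>)"
    using half[OF ab, of n] by linarith
  then show ?thesis by simp
qed

text \<open>Point-line flags at one dyadic richness of the line. The point p itself is left out of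
  the count since A and B may overlap, and the last condition cuts off the lines that are heavy for
  a level b set.\<close>

definition flags :: "(int \<times> int) set \<Rightarrow> (int \<times> int) set \<Rightarrow> nat \<Rightarrow> nat \<Rightarrow> ((int \<times> int) \<times> (int \<times> int) set) set" where
  "flags A B b i = {(p, l). p \<in> A \<and> l \<in> int_lines \<and> p \<in> l \<and> 2 ^ i \<le> card (l \<inter> B - {p}) \<and>
     card (l \<inter> B - {p}) < 2 ^ Suc i \<and> card (l \<inter> B) < 2 ^ (b + 2)}"

lemma flags_sub:
  "flags A B b i \<subseteq> (\<lambda>(p, q). (p, line_through p q)) ` (A \<times> B)"
proof
  fix f assume "f \<in> flags A B b i"
  then obtain p l where f: "f = (p, l)" "p \<in> A" "l \<in> int_lines" "p \<in> l" "2 ^ i \<le> card (l \<inter> B - {p})"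
    by (auto simp: flags_def)
  have "card (l \<inter> B - {p}) \<noteq> 0" using f(5) by (metis not_le zero_less_numeral zero_less_power)
  then have "l \<inter> B - {p} \<noteq> {}" by force
  then obtain q where q: "q \<in> l" "q \<in> B" "q \<noteq> p" by blast
  then have "l = line_through p q" using f by (intro line_through_unique) auto
  then show "f \<in> (\<lambda>(p, q). (p, line_through p q)) ` (A \<times> B)" using f q by auto
qed

lemma finite_flags: "finite A \<Longrightarrow> finite B \<Longrightarrow> finite (flags A B b i)"
  using finite_subset[OF flags_sub] by blast

text \<open>Two points determine their line, so each pair (p, q) belongs to at most one flag, and
  each flag owns at least 2 ^ i pairs. This is the trivial bound inside
  \<open>flag_rem\<close>.\<close>

lemma card_flags_pairs:
  assumes "finite A" "finite B"
  shows "card (flags A B b i) * 2 ^ i \<le> card A * card B"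
proof -
  let ?F = "flags A B b i"
  let ?S = "SIGMA f:?F. (snd f \<inter> B - {fst f})"
  have "card ?F * 2 ^ i \<le> (\<Sum>f\<in>?F. card (snd f \<inter> B - {fst f}))"
    using sum_bounded_below[of ?F "2 ^ i" "\<lambda>f. card (snd f \<inter> B - {fst f})"] by (auto simp: flags_def)
  also have "\<dots> = card ?S" using assms finite_flags[OF assms] by (intro card_SigmaI[symmetric]) auto
  also have "\<dots> \<le> card (A \<times> B)"
  proof (rule card_inj_on_le)
    show "inj_on (\<lambda>(f, q). (fst f, q)) ?S"
    proof (rule inj_onI)
      fix s t assume h: "s \<in> ?S" "t \<in> ?S" "(\<lambda>(f, q). (fst f, q)) s = (\<lambda>(f, q). (fst f, q)) t"
      obtain p l q where s: "s = ((p, l), q)" by (metis surj_pair)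
      obtain l' where t: "t = ((p, l'), q)" using h(3) s by (cases t) auto
      have g: "l \<in> int_lines" "p \<in> l" "l' \<in> int_lines" "p \<in> l'" "q \<in> l" "q \<in> l'" "p \<noteq> q"
        using h(1,2) by (auto simp add: s t flags_def)
      have "l = line_through p q" "l' = line_through p q"
        by (rule line_through_unique[OF g(1,2,5,7)], rule line_through_unique[OF g(3,4,6,7)])
      then show "s = t" using s t by simp
    qed
    show "(\<lambda>(f, q). (fst f, q)) ` ?S \<subseteq> A \<times> B" by (auto simp: flags_def)
  qed (use assms in auto)
  finally show ?thesis by (simp add: card_cartesian_product)
qed

text \<open>The part of the Szemeredi-Trotter bound for flags that sums geometrically over dyadic scales \<open>i\<close>;
  only the remaining term, which scales like \<open>4 ^ (- i)\<close>, produces a logarithm.\<close>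

definition flag_rem :: "nat \<Rightarrow> nat \<Rightarrow> nat \<Rightarrow> real" where
  "flag_rem a b i = (if i = 0 then 4 ^ (a + b) else 4 ^ a + min (16 ^ b / 8 ^ i) (4 ^ (a + b) / 2 ^ i))"

lemma card_flags_le:
  assumes A: "finite A" "card A \<le> 4 ^ (a + 1)" and B: "finite B" "card B \<le> 4 ^ (b + 1)"
  shows "real (card (flags A B b i)) \<le>
    10000000 * ((2 powr ((2 * real a + 4 * real b) / 3))\<^sup>2 / 4 ^ i + flag_rem a b i)"
proof -
  let ?F = "flags A B b i"
  let ?Y = "(2 powr ((2 * real a + 4 * real b) / 3))\<^sup>2 / (4 :: real) ^ i"
  have Y: "?Y \<ge> 0" by simp
  have triv: "real (card ?F) * 2 ^ i \<le> 16 * 4 ^ (a + b)"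
  proof -
    have "card ?F * 2 ^ i \<le> 4 ^ (a + 1) * 4 ^ (b + 1)"
      using card_flags_pairs[OF A(1) B(1), of b i] mult_le_mono[OF A(2) B(2)] by linarith
    also have "\<dots> = 16 * 4 ^ (a + b)" by (simp add: power_add)
    finally have "real (card ?F * 2 ^ i) \<le> real (16 * 4 ^ (a + b))" by (rule of_nat_mono)
    then show ?thesis by simp
  qed
  show ?thesis
  proof (cases "i = 0 \<or> ?F = {}")
    case True
    then show ?thesis
    proof
      assume i: "i = 0"
      have "real (card ?F) \<le> 10000000 * 4 ^ (a + b)" using triv i by simp
      then show ?thesis using i by (simp add: flag_rem_def add_increasing)
    qed (auto simp: flag_rem_def)
  next
    case False
    then have i: "i \<ge> 1" by simp
    obtain p0 l0 where "(p0, l0) \<in> ?F" using False by auto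
    then have l0: "2 ^ i \<le> card (l0 \<inter> B - {p0})" "card (l0 \<inter> B) < 2 ^ (b + 2)" by (auto simp: flags_def)
    have "card (l0 \<inter> B - {p0}) \<le> card (l0 \<inter> B)" using B by (intro card_mono) auto
    then have "(2 :: nat) ^ i < 2 ^ (b + 2)" using l0 by linarith
    \<comment> \<open>The cut-off in \<open>flags\<close> bounds the scale, which lets the linear
      term of \<open>rich_lines_card\<close> be absorbed into z.\<close>
    then have ib: "i \<le> b + 1" using power_less_imp_less_exp[of "2 :: nat" i "b + 2"] by simp
    define L where "L = snd ` ?F"
    have L: "finite L" "L \<subseteq> int_lines"
      using finite_flags[OF A(1) B(1)] by (auto simp: L_def flags_def)
    have Lk: "2 ^ i \<le> real (card (l \<inter> B))" if lL: "l \<in> L" for l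
    proof -
      obtain f where "f \<in> ?F" "l = snd f" using lL unfolding L_def by blast
      then obtain p where "2 ^ i \<le> card (l \<inter> B - {p})" by (cases f) (simp add: flags_def, blast)
      moreover have "card (l \<inter> B - {p}) \<le> card (l \<inter> B)" using B by (intro card_mono) auto
      ultimately have "2 ^ i \<le> card (l \<inter> B)" by linarith
      then have "real (2 ^ i) \<le> real (card (l \<inter> B))" by (rule of_nat_mono)
      then show ?thesis by simp
    qed
    have nB: "real (card B) \<le> 4 * 4 ^ b" using of_nat_mono[OF B(2), where 'a = real] by simp
    have nA: "real (card A) \<le> 4 * 4 ^ a" using of_nat_mono[OF A(2), where 'a = real] by simp
    define z :: real where "z = 16 ^ b / 8 ^ i"
    have z: "z \<ge> 0" by (simp add: z_def)
    have "(2 :: real) ^ 1 \<le> 2 ^ i" using i by (intro power_increasing) auto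
    then have "real (card L) \<le> 46656 * (real (card B) ^ 2 / (2 ^ i) ^ 3 + real (card B) / 2 ^ i)"
      using Lk by (intro rich_lines_card[OF B(1) L]) auto
    also have "\<dots> \<le> 46656 * ((4 * 4 ^ b) ^ 2 / (2 ^ i) ^ 3 + 4 * 4 ^ b / 2 ^ i)"
      using nB by (intro mult_left_mono add_mono divide_right_mono power_mono) auto
    also have "(4 * 4 ^ b) ^ 2 / (2 ^ i) ^ 3 = 16 * z"
    proof -
      have "((2 :: real) ^ i) ^ 3 = (2 ^ 3) ^ i" by (simp only: power_mult[symmetric] mult.commute)
      moreover have "((4 :: real) ^ b) ^ 2 = (4 ^ 2) ^ b" by (simp only: power_mult[symmetric] mult.commute)
      ultimately show ?thesis by (simp add: power_mult_distrib z_def)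
    qed
    also have "4 * 4 ^ b / 2 ^ i \<le> 16 * z"
    proof -
      have "(4 :: real) ^ i \<le> 4 ^ (b + 1)" using ib by (intro power_increasing) auto
      then have "4 * 4 ^ b * (4 :: real) ^ i \<le> 4 * 4 ^ b * 4 ^ (b + 1)" by (intro mult_left_mono) auto
      also have "4 * 4 ^ b * 4 ^ (b + 1) = 16 * (16 :: real) ^ b"
        by (simp add: power_mult_distrib[symmetric])
      finally have "4 * 4 ^ b * (4 :: real) ^ i / (2 ^ i * 4 ^ i) \<le> 16 * 16 ^ b / (2 ^ i * 4 ^ i)"
        by (intro divide_right_mono) auto
      moreover have "4 * 4 ^ b * (4 :: real) ^ i / (2 ^ i * 4 ^ i) = 4 * 4 ^ b / 2 ^ i" by simp
      moreover have "(2 :: real) ^ i * 4 ^ i = 8 ^ i" by (simp add: power_mult_distrib[symmetric])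
      ultimately show ?thesis unfolding z_def by (metis times_divide_eq_right)
    qed
    finally have cL: "real (card L) \<le> 1492992 * z" by simp
    have "real (card ?F) \<le> real (incidences A L)"
      unfolding incidences_def using A L finite_subset[of "{(p, l) \<in> A \<times> L. p \<in> l}" "A \<times> L"]
      by (intro of_nat_mono card_mono) (force simp: L_def flags_def)+
    also have "\<dots> \<le> 9 * (real (card A) * real (card L)) powr (2/3) + 5 * card A + card L"
      by (rule szemeredi_trotter[OF A(1) L])
    \<comment> \<open>Comparing cubes removes the fractional power; (4 * 1492992)^2 is below 64 *
      10^12, which is 40000^3.\<close>
    also have "(real (card A) * real (card L)) powr (2/3) \<le> 40000 * ?Y"
    proof (rule power_le_imp_le_base[of _ 2])
      have "((real (card A) * real (card L)) powr (2/3)) ^ 3 = (real (card A) * real (card L)) ^ 2"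
        by (simp add: powr_two_thirds_cube)
      also have "\<dots> \<le> ((4 * 4 ^ a) * (1492992 * z)) ^ 2"
        using nA cL by (intro power_mono mult_mono) auto
      also have "\<dots> \<le> (64 * 10 ^ 12) * (4 ^ a * z) ^ 2"
        by (simp add: power_mult_distrib mult_right_mono)
      also have "(4 ^ a * z) ^ 2 = ?Y ^ 3"
      proof -
        have e: "(4 :: real) ^ n = 2 powr (2 * n)" "(16 :: real) ^ n = 2 powr (4 * n)" "(8 :: real) ^ n = 2 powr (3 * n)" for n :: nat
          by (simp_all add: powr_mult_base powr_powr[symmetric] powr_realpow)
        show ?thesis unfolding z_def e
          by (simp add: powr_power powr_add[symmetric] powr_diff[symmetric] add_divide_distrib diff_divide_distrib) (simp add: algebra_simps)
      qed
      finally show "((real (card A) * real (card L)) powr (2/3)) ^ Suc 2 \<le> (40000 * ?Y) ^ Suc 2"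
        by (simp add: power_mult_distrib eval_nat_numeral)
    qed simp
    finally have st: "real (card ?F) \<le> 360000 * ?Y + 20 * 4 ^ a + 1492992 * z" using nA cL by linarith
    have tr: "real (card ?F) \<le> 16 * (4 ^ (a + b) / 2 ^ i)" using triv by (simp add: field_simps)
    \<comment> \<open>The number z of lines is too large for small i; there the trivial pair bound
      takes over.\<close>
    have "real (card ?F) \<le> 360000 * ?Y + 20 * 4 ^ a + 1492992 * min z (4 ^ (a + b) / 2 ^ i)"
    proof (cases "z \<le> 4 ^ (a + b) / 2 ^ i")
      case True
      then show ?thesis using st by (simp add: min_absorb1)
    next
      case False
      have "0 \<le> 4 ^ (a + b) / (2 :: real) ^ i" "0 \<le> (4 :: real) ^ a" by auto
      then show ?thesis using tr Y False unfolding min_def by (smt (verit))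
    qed
    moreover have "0 \<le> min z (4 ^ (a + b) / 2 ^ i)" "0 \<le> (4 :: real) ^ a" using z by auto
    moreover have "flag_rem a b i = 4 ^ a + min z (4 ^ (a + b) / 2 ^ i)"
      using i by (simp add: flag_rem_def z_def)
    ultimately show ?thesis using Y by (simp only: distrib_left)
  qed
qed

text \<open>This is the sum needed after Cauchy-Schwarz type splitting, where a flag at scale i
  carries about 2 ^ i points. The part with 4 ^ a is dominated by the last scale b + 1; the minimum
  is geometric with ratio sqrt 2 on both sides of its crossover, where it equals 2 powr ((3 * b + a)
  / 2).\<close>

lemma sum_sqrt_flag_rem:
  "(\<Sum>i<b + 2. 2 ^ i * sqrt (flag_rem a b i)) \<le> 12 * (2 powr (a + b) + 2 powr ((3 * b + a) / 2))"
proof -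
  have s2: "sqrt (4 ^ n) = 2 ^ n" for n :: nat by (simp add: real_sqrt_power)
  have "2 ^ i * sqrt (flag_rem a b i) \<le> (if i = 0 then 2 ^ (a + b) else 0) + 2 ^ a * 2 ^ i +
      min (2 ^ (a + b) * sqrt 2 ^ i) (4 ^ b / sqrt 2 ^ i)" for i
  proof (cases "i = 0")
    case True
    then show ?thesis by (simp add: flag_rem_def s2)
  next
    case False
    let ?m = "min (16 ^ b / 8 ^ i) (4 ^ (a + b) / (2 :: real) ^ i)"
    have "2 ^ i * sqrt (flag_rem a b i) \<le> 2 ^ i * (sqrt (4 ^ a) + sqrt ?m)"
      using False by (auto simp: flag_rem_def intro!: mult_left_mono sqrt_add_le_add_sqrt)
    also have "\<dots> = 2 ^ a * 2 ^ i + 2 ^ i * sqrt ?m" by (simp add: s2 algebra_simps)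
    also have "2 ^ i * sqrt ?m = min (2 ^ i * sqrt (16 ^ b / 8 ^ i)) (2 ^ i * sqrt (4 ^ (a + b) / 2 ^ i))"
      by (simp add: min_def)
    also have "2 ^ i * sqrt (16 ^ b / 8 ^ i) = 4 ^ b / sqrt 2 ^ i"
    proof -
      have "sqrt ((16 :: real) ^ b) = 4 ^ b" by (simp add: real_sqrt_power)
      moreover have "sqrt ((8 :: real) ^ i) = 2 ^ i * sqrt 2 ^ i"
      proof (rule real_sqrt_unique)
        have "(2 ^ i * sqrt 2 ^ i)\<^sup>2 = ((2 * sqrt 2)\<^sup>2) ^ i"
          by (simp only: power_mult_distrib[symmetric] power_mult[symmetric] mult.commute)
        also have "(2 * sqrt 2)\<^sup>2 = (8 :: real)" by (simp add: power_mult_distrib)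
        finally show "(2 ^ i * sqrt 2 ^ i)\<^sup>2 = (8 :: real) ^ i" .
      qed simp
      ultimately show ?thesis by (simp add: real_sqrt_divide)
    qed
    also have "2 ^ i * sqrt (4 ^ (a + b) / 2 ^ i) = 2 ^ (a + b) * sqrt 2 ^ i"
    proof -
      have "(2 :: real) ^ i = sqrt 2 ^ i * sqrt 2 ^ i" by (simp add: power_mult_distrib[symmetric])
      then show ?thesis by (simp add: real_sqrt_divide s2 real_sqrt_power)
    qed
    finally show ?thesis by (simp add: False min.commute)
  qed
  then have "(\<Sum>i<b + 2. 2 ^ i * sqrt (flag_rem a b i)) \<le>
     (\<Sum>i<b + 2. (if i = 0 then 2 ^ (a + b) else 0) + 2 ^ a * 2 ^ i + min (2 ^ (a + b) * sqrt 2 ^ i) (4 ^ b / sqrt 2 ^ i))"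
    by (rule sum_mono)
  also have "\<dots> = 2 ^ (a + b) + 2 ^ a * (\<Sum>i<b + 2. 2 ^ i) + (\<Sum>i<b + 2. min (2 ^ (a + b) * sqrt 2 ^ i) (4 ^ b / sqrt 2 ^ i))"
    by (simp add: sum.distrib sum_distrib_left del: sum.lessThan_Suc add_2_eq_Suc')
  also have "(\<Sum>i<b + 2. (2 :: real) ^ i) \<le> 4 * 2 ^ b"
    by (subst geometric_sum) auto
  also have "(\<Sum>i<b + 2. min (2 ^ (a + b) * sqrt 2 ^ i) (4 ^ b / sqrt 2 ^ i)) \<le>
      2 * sqrt 2 / (sqrt 2 - 1) * sqrt (2 ^ (a + b) * 4 ^ b)"
    by (rule sum_min_geometric) auto
  also have "\<dots> \<le> 12 * sqrt (2 ^ (a + b) * 4 ^ b)"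
  proof (rule mult_right_mono)
    have "12 / 10 \<le> sqrt 2" by (rule real_le_rsqrt) (simp add: power2_eq_square)
    then show "2 * sqrt 2 / (sqrt 2 - 1) \<le> 12" by (simp add: divide_le_eq)
  qed simp
  also have "sqrt (2 ^ (a + b) * 4 ^ b) = 2 powr ((3 * b + a) / 2)"
  proof (rule real_sqrt_unique)
    have "(2 powr ((3 * b + a) / 2))\<^sup>2 = 2 powr real (a + b + 2 * b)"
      by (subst powr_power) (auto simp: add_divide_distrib)
    also have "\<dots> = 2 ^ (a + b + 2 * b)" by (rule powr_realpow) simp
    also have "\<dots> = 2 ^ (a + b) * (4 :: real) ^ b" by (simp only: power_add power_mult) simp
    finally show "(2 powr ((3 * b + a) / 2))\<^sup>2 = 2 ^ (a + b) * (4 :: real) ^ b" .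
  qed simp
  finally have "(\<Sum>i<b + 2. 2 ^ i * sqrt (flag_rem a b i)) \<le>
     2 ^ (a + b) + 2 ^ a * (4 * 2 ^ b) + 12 * 2 powr ((3 * b + a) / 2)" by simp
  moreover have "2 ^ a * (4 * 2 ^ b) = 4 * (2 :: real) ^ (a + b)" by (simp add: power_add)
  moreover have "2 powr (a + b) = (2 :: real) ^ (a + b)" by (rule powr_realpow) simp
  moreover have "(2 :: real) ^ (a + b) \<ge> 0" by simp
  ultimately show ?thesis by (simp only: distrib_left of_nat_add of_nat_mult of_nat_numeral)
qed

section \<open>Counting right triangles\<close>

lemma sum_union_le:
  fixes f :: "'a \<Rightarrow> real"
  assumes "finite A" "finite B" "\<And>x. 0 \<le> f x"
  shows "sum f (A \<union> B) \<le> sum f A + sum f B"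
  using sum.union_inter[OF assms(1,2), of f] sum_nonneg[of "A \<inter> B" f] assms(3) by simp

lemma sum_by_fibers:
  fixes h :: "'a \<Rightarrow> real"
  assumes "finite T" "finite G" "g ` T \<subseteq> G"
    and "\<And>y. y \<in> G \<Longrightarrow> (\<Sum>x\<in>{x\<in>T. g x = y}. h x) \<le> M"
  shows "sum h T \<le> real (card G) * M"
proof -
  have "sum h T = (\<Sum>y\<in>G. \<Sum>x\<in>{x\<in>T. g x = y}. h x)"
    by (rule sum.group[symmetric]) (use assms in auto)
  also have "\<dots> \<le> of_nat (card G) * M" using assms(4) by (rule sum_bounded_above)
  finally show ?thesis by simp
qed

lemma min_le_sqrt_mult: "0 \<le> x \<Longrightarrow> 0 \<le> y \<Longrightarrow> min x y \<le> sqrt x * sqrt y" for x y :: real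
proof -
  assume xy: "0 \<le> x" "0 \<le> y"
  have "min x y * min x y \<le> x * y" using xy by (intro mult_mono) auto
  then show ?thesis unfolding real_sqrt_mult[symmetric] using xy
    by (intro real_le_rsqrt) (simp add: power2_eq_square)
qed

lemma sum_dyadic_min:
  fixes \<alpha> \<beta> :: real
  assumes "\<alpha> \<ge> 0" "\<beta> \<ge> 0"
  shows "(\<Sum>j<n. 2 ^ j * min \<alpha> (\<beta> / 4 ^ j)) \<le> 4 * sqrt (\<alpha> * \<beta>)"
proof -
  have "2 ^ j * min \<alpha> (\<beta> / 4 ^ j) = min (\<alpha> * 2 ^ j) (\<beta> / 2 ^ j)" for j
  proof -
    have "(4 :: real) ^ j = 2 ^ j * 2 ^ j" by (simp add: power_mult_distrib[symmetric])
    then have "2 ^ j * (\<beta> / 4 ^ j) = \<beta> / 2 ^ j" by simp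
    moreover have "2 ^ j * min \<alpha> (\<beta> / 4 ^ j) = min (2 ^ j * \<alpha>) (2 ^ j * (\<beta> / 4 ^ j))"
      by (simp add: min_mult_distrib_left)
    ultimately show ?thesis by (simp only: mult.commute)
  qed
  then show ?thesis using sum_min_geometric[of 2 \<alpha> \<beta> n] assms by simp
qed

text \<open>The minimum of two sums is at most the sum of the four pairwise minima. Those with a
  remainder \<open>R\<close> or \<open>R'\<close> sum up through S and S'. In the remaining one the
  sum over j gives P * P' / 2 ^ i, so the weights only enter through \<kappa>. Weights of size 2 ^ i
  make \<kappa> the number of scales, smaller ones keep it bounded.\<close>

lemma sum_two_scales:
  fixes F F' R R' \<omega> :: "nat \<Rightarrow> real"
  assumes F: "\<And>i. F i \<le> C * (P\<^sup>2 / 4 ^ i + R i)" and F': "\<And>j. F' j \<le> C * (P'\<^sup>2 / 4 ^ j + R' j)"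
    and nn: "\<And>i. R i \<ge> 0" "\<And>i. R' i \<ge> 0" "C \<ge> 0" "P \<ge> 0" "P' \<ge> 0" "\<And>i. 0 \<le> \<omega> i" "\<And>i. \<omega> i \<le> 10 * 2 ^ i"
    and sums: "(\<Sum>i<m. \<omega> i / 2 ^ i) \<le> \<kappa>" "(\<Sum>i<m. 2 ^ i * sqrt (R i)) \<le> S" "(\<Sum>j<n. 2 ^ j * sqrt (R' j)) \<le> S'"
  shows "(\<Sum>i<m. \<Sum>j<n. \<omega> i * 2 ^ j * min (F i) (F' j)) \<le> C * (4 * \<kappa> * P * P' + 40 * S * P' + 40 * P * S' + 10 * S * S')"
proof -
  let ?x = "\<lambda>i. P\<^sup>2 / 4 ^ i" and ?y = "\<lambda>j. P'\<^sup>2 / 4 ^ j"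
  have x: "?x i \<ge> 0" "?y i \<ge> 0" for i by auto
  have mn: "min (F i) (F' j) \<le> C * (min (?x i) (?y j) + min (?x i) (R' j) + min (R i) (?y j) + min (R i) (R' j))" for i j
  proof -
    have "min (F i) (F' j) \<le> min (C * (?x i + R i)) (C * (?y j + R' j))" using F F' by (intro min.mono) auto
    also have "\<dots> = C * min (?x i + R i) (?y j + R' j)" using nn(3) by (simp add: min_mult_distrib_left)
    also have "\<dots> \<le> C * (min (?x i) (?y j) + min (?x i) (R' j) + min (R i) (?y j) + min (R i) (R' j))"
    proof (rule mult_left_mono[OF _ nn(3)])
      have "min (u + v) (u' + v') \<le> min u u' + min u v' + min v u' + min v v'"
        if "0 \<le> u" "0 \<le> v" "0 \<le> u'" "0 \<le> v'" for u v u' v' :: real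
        using that unfolding min_def by (auto split: if_splits)
      then show "min (?x i + R i) (?y j + R' j) \<le> min (?x i) (?y j) + min (?x i) (R' j) + min (R i) (?y j) + min (R i) (R' j)"
        using nn(1)[of i] nn(2)[of j] x(1)[of i] x(2)[of j] by blast
    qed
    finally show ?thesis .
  qed
  have S0: "0 \<le> S" "0 \<le> S'" using sums nn sum_nonneg[of "{..<m}" "\<lambda>i. 2 ^ i * sqrt (R i)"]
      sum_nonneg[of "{..<n}" "\<lambda>i. 2 ^ i * sqrt (R' i)"] by (auto intro: order_trans[rotated])
  have e1: "(\<Sum>i<m. \<Sum>j<n. \<omega> i * 2 ^ j * min (?x i) (?y j)) \<le> 4 * \<kappa> * P * P'"
  proof -
    have "(\<Sum>i<m. \<Sum>j<n. \<omega> i * 2 ^ j * min (?x i) (?y j)) = (\<Sum>i<m. \<omega> i * (\<Sum>j<n. 2 ^ j * min (?x i) (?y j)))"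
      by (simp add: sum_distrib_left mult.assoc)
    also have "\<dots> \<le> (\<Sum>i<m. \<omega> i * (4 * sqrt (?x i * P'\<^sup>2)))"
      by (intro sum_mono mult_left_mono sum_dyadic_min nn) auto
    also have "\<dots> = (\<Sum>i<m. (4 * P * P') * (\<omega> i / 2 ^ i))"
    proof (rule sum.cong[OF refl])
      fix i
      have "sqrt ((4 :: real) ^ i) = 2 ^ i" by (simp add: real_sqrt_power)
      then have "sqrt (?x i * P'\<^sup>2) = P / 2 ^ i * P'" using nn by (simp add: real_sqrt_mult real_sqrt_divide)
      then show "\<omega> i * (4 * sqrt (?x i * P'\<^sup>2)) = (4 * P * P') * (\<omega> i / 2 ^ i)" by simp
    qed
    also have "\<dots> \<le> (4 * P * P') * \<kappa>"
      unfolding sum_distrib_left[symmetric] using nn sums by (intro mult_left_mono) auto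
    finally show ?thesis by (simp add: algebra_simps)
  qed
  have e2: "(\<Sum>i<m. \<Sum>j<n. \<omega> i * 2 ^ j * min (R i) (?y j)) \<le> 40 * S * P'"
  proof -
    have "(\<Sum>i<m. \<Sum>j<n. \<omega> i * 2 ^ j * min (R i) (?y j)) = (\<Sum>i<m. \<omega> i * (\<Sum>j<n. 2 ^ j * min (R i) (?y j)))"
      by (simp add: sum_distrib_left mult.assoc)
    also have "\<dots> \<le> (\<Sum>i<m. (10 * 2 ^ i) * (4 * sqrt (R i * P'\<^sup>2)))"
      by (intro sum_mono mult_mono sum_dyadic_min nn sum_nonneg mult_nonneg_nonneg) (use nn in auto)
    also have "\<dots> = 40 * P' * (\<Sum>i<m. 2 ^ i * sqrt (R i))"
      using nn by (simp add: real_sqrt_mult sum_distrib_left algebra_simps)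
    also have "\<dots> \<le> 40 * P' * S" using nn sums by (intro mult_left_mono) auto
    finally show ?thesis by (simp add: algebra_simps)
  qed
  have e3: "(\<Sum>i<m. \<Sum>j<n. \<omega> i * 2 ^ j * min (?x i) (R' j)) \<le> 40 * P * S'"
  proof -
    have "(\<Sum>i<m. \<Sum>j<n. \<omega> i * 2 ^ j * min (?x i) (R' j)) \<le> (\<Sum>i<m. \<Sum>j<n. (10 * 2 ^ i) * 2 ^ j * min (?x i) (R' j))"
      using nn by (intro sum_mono mult_right_mono) auto
    also have "\<dots> = (\<Sum>j<n. \<Sum>i<m. (10 * 2 ^ i) * 2 ^ j * min (?x i) (R' j))" by (rule sum.swap)
    also have "\<dots> = (\<Sum>j<n. 10 * 2 ^ j * (\<Sum>i<m. 2 ^ i * min (R' j) (?x i)))"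
      by (simp add: sum_distrib_left algebra_simps min.commute)
    also have "\<dots> \<le> (\<Sum>j<n. 10 * 2 ^ j * (4 * sqrt (R' j * P\<^sup>2)))"
      by (intro sum_mono mult_left_mono sum_dyadic_min nn) auto
    also have "\<dots> = 40 * P * (\<Sum>j<n. 2 ^ j * sqrt (R' j))"
      using nn by (simp add: real_sqrt_mult sum_distrib_left algebra_simps)
    also have "\<dots> \<le> 40 * P * S'" using nn sums by (intro mult_left_mono) auto
    finally show ?thesis .
  qed
  have e4: "(\<Sum>i<m. \<Sum>j<n. \<omega> i * 2 ^ j * min (R i) (R' j)) \<le> 10 * S * S'"
  proof -
    have "(\<Sum>i<m. \<Sum>j<n. \<omega> i * 2 ^ j * min (R i) (R' j)) \<le> (\<Sum>i<m. \<Sum>j<n. (10 * 2 ^ i) * 2 ^ j * (sqrt (R i) * sqrt (R' j)))"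
      using nn by (intro sum_mono mult_mono min_le_sqrt_mult) auto
    also have "\<dots> = 10 * ((\<Sum>i<m. 2 ^ i * sqrt (R i)) * (\<Sum>j<n. 2 ^ j * sqrt (R' j)))"
      unfolding sum_product by (simp add: sum_distrib_left algebra_simps)
    also have "\<dots> \<le> 10 * (S * S')" using S0 nn by (intro mult_left_mono mult_mono sums sum_nonneg) auto
    finally show ?thesis by simp
  qed
  have "(\<Sum>i<m. \<Sum>j<n. \<omega> i * 2 ^ j * min (F i) (F' j)) \<le>
    (\<Sum>i<m. \<Sum>j<n. \<omega> i * 2 ^ j * (C * (min (?x i) (?y j) + min (?x i) (R' j) + min (R i) (?y j) + min (R i) (R' j))))"
    using nn by (intro sum_mono mult_left_mono mn) auto
  also have "\<dots> = C * ((\<Sum>i<m. \<Sum>j<n. \<omega> i * 2 ^ j * min (?x i) (?y j)) + (\<Sum>i<m. \<Sum>j<n. \<omega> i * 2 ^ j * min (?x i) (R' j))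
     + (\<Sum>i<m. \<Sum>j<n. \<omega> i * 2 ^ j * min (R i) (?y j)) + (\<Sum>i<m. \<Sum>j<n. \<omega> i * 2 ^ j * min (R i) (R' j)))"
    by (simp add: sum.distrib sum_distrib_left distrib_left mult.left_commute)
  also have "\<dots> \<le> C * (4 * \<kappa> * P * P' + 40 * P * S' + 40 * S * P' + 10 * S * S')"
    by (intro mult_left_mono nn add_mono e1 e2 e3 e4)
  finally show ?thesis by (simp add: algebra_simps)
qed

definition right_triples :: "(int \<times> int) set \<Rightarrow> (int \<times> int) set \<Rightarrow> (int \<times> int) set \<Rightarrow>
    ((int \<times> int) \<times> (int \<times> int) \<times> (int \<times> int)) set" where
  "right_triples A B D = {(p, q, r). p \<in> A \<and> q \<in> B \<and> r \<in> D \<and> q \<noteq> p \<and> r \<noteq> p \<and> idot (q - p) (r - p) = 0}"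

lemma finite_right_triples: "finite A \<Longrightarrow> finite B \<Longrightarrow> finite D \<Longrightarrow> finite (right_triples A B D)"
  by (rule finite_subset[of _ "A \<times> B \<times> D"]) (auto simp: right_triples_def)

text \<open>In the plane the line of one leg determines the perpendicular through the corner p.
  Hence either flag of a right triangle at p determines the other one.\<close>

lemma right_triples_same_line:
  assumes t: "(p, q, r) \<in> right_triples A B D" "(p, q0, r0) \<in> right_triples A B D"
    and "line_through p q = line_through p q0 \<or> line_through p r = line_through p r0"
  shows "q \<in> line_through p q0 \<and> r \<in> line_through p r0"
proof -
  have h: "idot (q - p) (r - p) = 0" "idot (q0 - p) (r0 - p) = 0" "q \<noteq> p" "q0 \<noteq> p" "r \<noteq> p" "r0 \<noteq> p"
    using t by (auto simp: right_triples_def)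
  show ?thesis using assms(3)
  proof
    assume l: "line_through p q = line_through p q0"
    have "q0 \<in> line_through p q" "q \<in> line_through p q0" using l line_through_mem by blast+
    then show ?thesis using perp_collinear[OF h(2) perp_on_line[OF h(1) _ h(3)] h(4)] by blast
  next
    assume l: "line_through p r = line_through p r0"
    have m: "r0 \<in> line_through p r" "r \<in> line_through p r0" using l line_through_mem by blast+
    have "idot (r - p) (q - p) = 0" "idot (r0 - p) (q0 - p) = 0" using h by (simp_all add: idot_commute)
    then show ?thesis using perp_collinear[of r0 p q0 q] perp_on_line[of r p q r0] m h by blast
  qed
qed

lemma ex_dyadic: "n \<ge> 1 \<Longrightarrow> \<exists>i. 2 ^ i \<le> n \<and> n < 2 ^ Suc i" for n :: nat
proof (induction n rule: less_induct)
  case (less n)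
  show ?case
  proof (cases "n = 1")
    case True
    then show ?thesis by (intro exI[of _ 0]) auto
  next
    case False
    have "n div 2 < n" "1 \<le> n div 2" using less.prems False by auto
    then obtain i where "2 ^ i \<le> n div 2" "n div 2 < 2 ^ Suc i" using less.IH[of "n div 2"] by blast
    then show ?thesis by (intro exI[of _ "Suc i"]) auto
  qed
qed

text \<open>Triples are sorted by the richness i and j of their legs. A cross of two perpendicular
  lines at p is determined by either of its flags, so there are at most as many crosses as the
  smaller flag count, and each has total weight at most \<omega> i on one leg times 2 ^ (j + 1)
  points on the other.\<close>

lemma light_triples_sum:
  fixes w :: "int \<times> int \<Rightarrow> int \<times> int \<Rightarrow> real" and b d :: nat
  assumes fin: "finite A" "finite B" "finite D"
    and w: "\<And>p q. w p q \<ge> 0"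
    and W: "\<And>p l X i. l \<in> int_lines \<Longrightarrow> p \<in> l \<Longrightarrow> finite X \<Longrightarrow> X \<subseteq> l - {p} \<Longrightarrow> card X < 2 ^ Suc i \<Longrightarrow>
        (\<Sum>q\<in>X. w p q) \<le> \<omega> i"
    and \<omega>: "\<And>i. \<omega> i \<ge> 0"
  defines "LL \<equiv> {(p, q, r) \<in> right_triples A B D. card (line_through p q \<inter> B) < 2 ^ (b + 2) \<and>
      card (line_through p r \<inter> D) < 2 ^ (d + 2)}"
  shows "(\<Sum>(p, q, r)\<in>LL. w p q) \<le> 2 * (\<Sum>i<b + 2. \<Sum>j<d + 2. \<omega> i * 2 ^ j *
      min (real (card (flags A B b i))) (real (card (flags A D d j))))"
proof -
  define idx :: "nat \<Rightarrow> nat" where "idx n = (SOME i. 2 ^ i \<le> n \<and> n < 2 ^ Suc i)" for n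
  have idx: "2 ^ idx n \<le> n \<and> n < 2 ^ Suc (idx n)" if "n \<ge> 1" for n
    unfolding idx_def using someI_ex[OF ex_dyadic[OF that]] .
  define kB where "kB p q = card (line_through p q \<inter> B - {p})" for p q
  define kD where "kD p r = card (line_through p r \<inter> D - {p})" for p r
  have LLsub: "LL \<subseteq> right_triples A B D" by (auto simp: LL_def)
  then have finLL: "finite LL" using finite_right_triples[OF fin] finite_subset by blast
  have k1: "kB p q \<ge> 1" "kD p r \<ge> 1" "p \<in> A" "q \<in> B" "r \<in> D" "q \<noteq> p" "r \<noteq> p"
     if "(p, q, r) \<in> LL" for p q r
  proof -
    show m: "p \<in> A" "q \<in> B" "r \<in> D" "q \<noteq> p" "r \<noteq> p" using that LLsub by (auto simp: right_triples_def)
    have "q \<in> line_through p q \<inter> B - {p}" "r \<in> line_through p r \<inter> D - {p}" using m by auto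
    then have "line_through p q \<inter> B - {p} \<noteq> {}" "line_through p r \<inter> D - {p} \<noteq> {}" by blast+
    then show "kB p q \<ge> 1" "kD p r \<ge> 1" unfolding kB_def kD_def using fin
      by (simp_all add: Suc_le_eq card_gt_0_iff)
  qed
  have lt: "idx (kB p q) < b + 2" "idx (kD p r) < d + 2" if t: "(p, q, r) \<in> LL" for p q r
  proof -
    have "kB p q \<le> card (line_through p q \<inter> B)" "kD p r \<le> card (line_through p r \<inter> D)"
      unfolding kB_def kD_def using fin by (auto intro!: card_mono)
    moreover have "card (line_through p q \<inter> B) < 2 ^ (b + 2)" "card (line_through p r \<inter> D) < 2 ^ (d + 2)"
      using t by (simp_all add: LL_def)
    ultimately have "(2 :: nat) ^ idx (kB p q) < 2 ^ (b + 2)" "(2 :: nat) ^ idx (kD p r) < 2 ^ (d + 2)"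
      using idx[OF k1(1)[OF t]] idx[OF k1(2)[OF t]] by linarith+
    then show "idx (kB p q) < b + 2" "idx (kD p r) < d + 2"
      using power_less_imp_less_exp[of "2 :: nat"] one_less_numeral_iff semiring_norm(76) by blast+
  qed
  define g where "g = (\<lambda>(p, q, r). (idx (kB p q), idx (kD p r)))"
  have one: "(\<Sum>t\<in>{t\<in>LL. g t = (i, j)}. case t of (p, q, r) \<Rightarrow> w p q) \<le>
      2 * (\<omega> i * 2 ^ j * min (real (card (flags A B b i))) (real (card (flags A D d j))))" for i j
  proof -
    define T where "T = {t\<in>LL. g t = (i, j)}"
    have finT: "finite T" using finLL by (simp add: T_def)
    have Tsub: "(p, q, r) \<in> T \<Longrightarrow> (p, q, r) \<in> right_triples A B D" for p q r using LLsub by (auto simp: T_def)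
    \<comment> \<open>The contribution of one cross: its triples lie in the product of the points on
      the two legs, and the weight depends on the first leg only.\<close>
    have fib: "(\<Sum>(p, q, r)\<in>U. w p q) \<le> \<omega> i * 2 ^ Suc j"
      if U: "U \<subseteq> T" "(p, q0, r0) \<in> U"
       "\<And>t. t \<in> U \<Longrightarrow> fst t = p \<and> fst (snd t) \<in> line_through p q0 \<and> snd (snd t) \<in> line_through p r0" for U p q0 r0
    proof -
      let ?X = "line_through p q0 \<inter> B - {p}" and ?Y = "line_through p r0 \<inter> D - {p}"
      have t0: "(p, q0, r0) \<in> LL" "idx (kB p q0) = i" "idx (kD p r0) = j" using U by (auto simp: T_def g_def)
      have cX: "card ?X < 2 ^ Suc i" and cY: "card ?Y < 2 ^ Suc j"
        using idx[OF k1(1)[OF t0(1)]] idx[OF k1(2)[OF t0(1)]] t0 by (simp_all add: kB_def kD_def)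
      have "U \<subseteq> {p} \<times> ?X \<times> ?Y"
      proof
        fix t assume t: "t \<in> U"
        obtain p' q r where tt: "t = (p', q, r)" by (metis surj_pair)
        have "(p', q, r) \<in> LL" using t U(1) tt by (auto simp: T_def)
        from k1[OF this] U(3)[OF t] show "t \<in> {p} \<times> ?X \<times> ?Y" by (simp add: tt)
      qed
      then have "(\<Sum>(p, q, r)\<in>U. w p q) \<le> (\<Sum>(p, q, r)\<in>{p} \<times> ?X \<times> ?Y. w p q)"
        using fin w by (intro sum_mono2) auto
      also have "\<dots> = (\<Sum>q\<in>?X. w p q) * real (card ?Y)"
        by (simp add: sum.cartesian_product[symmetric] sum_distrib_left mult.commute)
      also have "\<dots> \<le> \<omega> i * 2 ^ Suc j"
      proof (rule mult_mono)
        show "(\<Sum>q\<in>?X. w p q) \<le> \<omega> i"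
        proof (rule W[OF line_through_int_lines])
          show "p \<noteq> q0" using k1[OF t0(1)] by simp
        qed (use cX fin in auto)
        have "real (card ?Y) \<le> real (2 ^ Suc j)" using cY by (intro of_nat_mono) simp
        then show "real (card ?Y) \<le> 2 ^ Suc j" by simp
      qed (use \<omega> in auto)
      finally show ?thesis .
    qed
    have M0: "0 \<le> \<omega> i * 2 ^ Suc j" using \<omega> by simp
    have 1: "(\<Sum>(p, q, r)\<in>T. w p q) \<le> real (card (flags A B b i)) * (\<omega> i * 2 ^ Suc j)"
    proof (rule sum_by_fibers[where g = "\<lambda>(p, q, r). (p, line_through p q)"])
      show "(\<lambda>(p, q, r). (p, line_through p q)) ` T \<subseteq> flags A B b i"
      proof (rule image_subsetI)
        fix t assume t: "t \<in> T"
        obtain p q r where tt: "t = (p, q, r)" by (metis surj_pair)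
        have t': "(p, q, r) \<in> LL" "idx (kB p q) = i" using t tt by (auto simp: T_def g_def)
        show "(case t of (p, q, r) \<Rightarrow> (p, line_through p q)) \<in> flags A B b i"
          using k1[OF t'(1)] idx[OF k1(1)[OF t'(1)]] t' line_through_int_lines[of p q]
          unfolding tt flags_def kB_def LL_def by simp
      qed
      fix y assume "y \<in> flags A B b i"
      let ?U = "{x \<in> T. (case x of (p, q, r) \<Rightarrow> (p, line_through p q)) = y}"
      show "(\<Sum>(p, q, r)\<in>?U. w p q) \<le> \<omega> i * 2 ^ Suc j"
      proof (cases "?U = {}")
        case True
        show ?thesis unfolding True using M0 by simp
      next
        case False
        then obtain p q0 r0 where t0: "(p, q0, r0) \<in> ?U" by auto
        show ?thesis
        proof (rule fib[OF _ t0])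
          fix t assume t: "t \<in> ?U"
          obtain p' q r where tt: "t = (p', q, r)" by (metis surj_pair)
          have e: "p' = p" "line_through p q = line_through p q0" "(p', q, r) \<in> T" "(p, q0, r0) \<in> T" using t t0 tt by auto
          show "fst t = p \<and> fst (snd t) \<in> line_through p q0 \<and> snd (snd t) \<in> line_through p r0"
            using right_triples_same_line[OF Tsub Tsub, of p q r q0 r0] e tt by auto
        qed auto
      qed
    qed (use finT finite_flags fin in auto)
    have 2: "(\<Sum>(p, q, r)\<in>T. w p q) \<le> real (card (flags A D d j)) * (\<omega> i * 2 ^ Suc j)"
    proof (rule sum_by_fibers[where g = "\<lambda>(p, q, r). (p, line_through p r)"])
      show "(\<lambda>(p, q, r). (p, line_through p r)) ` T \<subseteq> flags A D d j"
      proof (rule image_subsetI)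
        fix t assume t: "t \<in> T"
        obtain p q r where tt: "t = (p, q, r)" by (metis surj_pair)
        have t': "(p, q, r) \<in> LL" "idx (kD p r) = j" using t tt by (auto simp: T_def g_def)
        show "(case t of (p, q, r) \<Rightarrow> (p, line_through p r)) \<in> flags A D d j"
          using k1[OF t'(1)] idx[OF k1(2)[OF t'(1)]] t' line_through_int_lines[of p r]
          unfolding tt flags_def kD_def LL_def by simp
      qed
      fix y assume "y \<in> flags A D d j"
      let ?U = "{x \<in> T. (case x of (p, q, r) \<Rightarrow> (p, line_through p r)) = y}"
      show "(\<Sum>(p, q, r)\<in>?U. w p q) \<le> \<omega> i * 2 ^ Suc j"
      proof (cases "?U = {}")
        case True
        show ?thesis unfolding True using M0 by simp
      next
        case False
        then obtain p q0 r0 where t0: "(p, q0, r0) \<in> ?U" by auto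
        show ?thesis
        proof (rule fib[OF _ t0])
          fix t assume t: "t \<in> ?U"
          obtain p' q r where tt: "t = (p', q, r)" by (metis surj_pair)
          have e: "p' = p" "line_through p r = line_through p r0" "(p', q, r) \<in> T" "(p, q0, r0) \<in> T" using t t0 tt by auto
          show "fst t = p \<and> fst (snd t) \<in> line_through p q0 \<and> snd (snd t) \<in> line_through p r0"
            using right_triples_same_line[OF Tsub Tsub, of p q r q0 r0] e tt by auto
        qed auto
      qed
    qed (use finT finite_flags fin in auto)
    have "(\<Sum>(p, q, r)\<in>T. w p q) \<le> min (real (card (flags A B b i)) * (\<omega> i * 2 ^ Suc j)) (real (card (flags A D d j)) * (\<omega> i * 2 ^ Suc j))"
      using 1 2 by simp
    also have "\<dots> = min (real (card (flags A B b i))) (real (card (flags A D d j))) * (\<omega> i * 2 ^ Suc j)"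
      using M0 by (simp add: min_mult_distrib_right)
    finally show ?thesis unfolding T_def by (simp add: algebra_simps)
  qed
  have "(\<Sum>(p, q, r)\<in>LL. w p q) = (\<Sum>y\<in>{..<b + 2} \<times> {..<d + 2}. \<Sum>t\<in>{t\<in>LL. g t = y}. case t of (p, q, r) \<Rightarrow> w p q)"
    using finLL lt by (intro sum.group[symmetric]) (auto simp: g_def)
  also have "\<dots> \<le> (\<Sum>(i, j)\<in>{..<b + 2} \<times> {..<d + 2}. 2 * (\<omega> i * 2 ^ j * min (real (card (flags A B b i))) (real (card (flags A D d j)))))"
    using one by (intro sum_mono) auto
  also have "\<dots> = 2 * (\<Sum>i<b + 2. \<Sum>j<d + 2. \<omega> i * 2 ^ j * min (real (card (flags A B b i))) (real (card (flags A D d j))))"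
    by (simp only: sum.cartesian_product[symmetric] sum_distrib_left)
  finally show ?thesis .
qed

text \<open>By \<open>very_rich_lines_incidences\<close> the lines heavy for B have O(4 ^ b)
  incidences with B. Each carries fewer than 2 ^ (a + 2) corners p, and each pair (p, q) extends by
  at most 2 ^ (d + 2) points r on the perpendicular. The constant is 64 * 13824.\<close>

lemma heavy_triples_card:
  fixes a b d :: nat
  assumes fin: "finite A" "finite B" "finite D" and cB: "card B \<le> 4 ^ (b + 1)"
  defines "HL \<equiv> {(p, q, r) \<in> right_triples A B D. 2 ^ (b + 2) \<le> card (line_through p q \<inter> B) \<and>
      card (line_through p q \<inter> A) < 2 ^ (a + 2) \<and> card (line_through p r \<inter> D) < 2 ^ (d + 2)}"
  shows "real (card HL) \<le> 884736 * 2 powr (a + 2 * b + d)"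
proof -
  have HLsub: "HL \<subseteq> right_triples A B D" by (auto simp: HL_def)
  then have finHL: "finite HL" using finite_right_triples[OF fin] finite_subset by blast
  define G where "G = {(p, q) \<in> A \<times> B. q \<noteq> p \<and> 2 ^ (b + 2) \<le> card (line_through p q \<inter> B) \<and>
      card (line_through p q \<inter> A) < 2 ^ (a + 2)}"
  define H where "H = (\<lambda>(p, q). line_through p q) ` G"
  have finG: "finite G" using fin finite_subset[of G "A \<times> B"] by (auto simp: G_def)
  have H: "finite H" "H \<subseteq> int_lines" using finG by (auto simp: H_def G_def intro: line_through_int_lines)
  have "real (card HL) = (\<Sum>t\<in>HL. 1)" by simp
  also have "\<dots> \<le> real (card G) * 2 ^ (d + 2)"
  proof (rule sum_by_fibers[where g = "\<lambda>(p, q, r). (p, q)"])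
    show "(\<lambda>(p, q, r). (p, q)) ` HL \<subseteq> G"
      by (auto simp: HL_def G_def right_triples_def)
    fix y assume "y \<in> G"
    let ?U = "{x \<in> HL. (case x of (p, q, r) \<Rightarrow> (p, q)) = y}"
    show "(\<Sum>x\<in>?U. (1 :: real)) \<le> 2 ^ (d + 2)"
    proof (cases "?U = {}")
      case True
      show ?thesis unfolding True by simp
    next
      case False
      then obtain p q r0 where t0: "(p, q, r0) \<in> HL" "y = (p, q)" by auto
      have "?U \<subseteq> (\<lambda>r. (p, q, r)) ` (line_through p r0 \<inter> D)"
      proof
        fix t assume t: "t \<in> ?U"
        then obtain r where tt: "t = (p, q, r)" "(p, q, r) \<in> HL" using t0 by (cases t) auto
        have rt: "(p, q, r) \<in> right_triples A B D" "(p, q, r0) \<in> right_triples A B D"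
          using HLsub tt(2) t0(1) by auto
        have "r \<in> line_through p r0" using right_triples_same_line[OF rt] by simp
        moreover have "r \<in> D" using rt by (auto simp: right_triples_def)
        ultimately show "t \<in> (\<lambda>r. (p, q, r)) ` (line_through p r0 \<inter> D)" using tt by auto
      qed
      then have "card ?U \<le> card ((\<lambda>r. (p, q, r)) ` (line_through p r0 \<inter> D))" using fin by (intro card_mono) auto
      also have "\<dots> \<le> card (line_through p r0 \<inter> D)" using fin by (intro card_image_le) auto
      also have "\<dots> \<le> 2 ^ (d + 2)" using t0 by (simp add: HL_def)
      finally have "real (card ?U) \<le> real (2 ^ (d + 2))" by (rule of_nat_mono)
      then show ?thesis by simp
    qed
  qed (use finHL finG in auto)
  also have "real (card G) \<le> 2 ^ (a + 2) * (13824 * 4 ^ (b + 1))"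
  proof -
    let ?S = "SIGMA l:H. (l \<inter> A) \<times> (l \<inter> B)"
    have "card G \<le> card ?S"
      by (rule card_inj_on_le[where f = "\<lambda>(p, q). (line_through p q, p, q)"])
        (use fin H in \<open>auto simp: inj_on_def H_def G_def\<close>)
    also have "\<dots> = (\<Sum>l\<in>H. card (l \<inter> A) * card (l \<inter> B))"
      using H fin by (subst card_SigmaI) (auto simp: card_cartesian_product)
    also have "\<dots> \<le> (\<Sum>l\<in>H. 2 ^ (a + 2) * card (l \<inter> B))"
      by (intro sum_mono mult_right_mono) (auto simp: H_def G_def)
    also have "\<dots> = 2 ^ (a + 2) * incidences B H" using fin H by (simp add: incidences_eq_sum sum_distrib_left)
    finally have "real (card G) \<le> real (2 ^ (a + 2) * incidences B H)" by (rule of_nat_mono)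
    also have "\<dots> = 2 ^ (a + 2) * real (incidences B H)" by simp
    also have "\<dots> \<le> 2 ^ (a + 2) * (13824 * real (card B))"
    proof (intro mult_left_mono very_rich_lines_incidences[where k = "2 ^ (b + 2)"])
      have "real (card B) \<le> real (4 ^ (b + 1))" using cB by (rule of_nat_mono)
      also have "\<dots> \<le> (2 ^ (b + 2))\<^sup>2" by (simp add: power_mult_distrib power2_eq_square flip: power_mult_distrib)
      finally show "real (card B) \<le> (2 ^ (b + 2))\<^sup>2" .
      show "2 ^ (b + 2) \<le> real (card (l \<inter> B))" if "l \<in> H" for l
      proof -
        have "2 ^ (b + 2) \<le> card (l \<inter> B)" using that by (auto simp: H_def G_def)
        then have "real (2 ^ (b + 2)) \<le> real (card (l \<inter> B))" by (rule of_nat_mono)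
        then show ?thesis by simp
      qed
    qed (use fin H in auto)
    also have "\<dots> \<le> 2 ^ (a + 2) * (13824 * 4 ^ (b + 1))"
      using of_nat_mono[OF cB, where 'a = real] by (intro mult_left_mono) auto
    finally show ?thesis .
  qed
  then have "real (card G) * 2 ^ (d + 2) \<le> 2 ^ (a + 2) * (13824 * 4 ^ (b + 1)) * 2 ^ (d + 2)"
    by (rule mult_right_mono) simp
  also have "\<dots> = 884736 * 2 ^ (a + 2 * b + d)"
    by (simp add: power_add power_mult)
  also have "(2 :: real) ^ (a + 2 * b + d) = 2 powr (a + 2 * b + d)" by (rule powr_realpow[symmetric]) simp
  finally show ?thesis by simp
qed

text \<open>The excluded triples have two vertices on lines that are heavy for them; for those only
  the rank argument with the diagonals of the rectangle works.\<close>

definition good_triples :: "(int \<times> int) set \<Rightarrow> (int \<times> int) set \<Rightarrow> (int \<times> int) set \<Rightarrow> nat \<Rightarrow> nat \<Rightarrow> nat \<Rightarrow>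
    ((int \<times> int) \<times> (int \<times> int) \<times> (int \<times> int)) set" where
  "good_triples A B D a b d = {(p, q, r) \<in> right_triples A B D.
     \<not> (2 ^ (b + 2) \<le> card (line_through p q \<inter> B) \<and> 2 ^ (d + 2) \<le> card (line_through p r \<inter> D)) \<and>
     \<not> (2 ^ (a + 2) \<le> card (line_through p q \<inter> A) \<and> 2 ^ (b + 2) \<le> card (line_through p q \<inter> B)) \<and>
     \<not> (2 ^ (a + 2) \<le> card (line_through p r \<inter> A) \<and> 2 ^ (d + 2) \<le> card (line_through p r \<inter> D))}"

lemma flag_rem_nonneg: "flag_rem a b i \<ge> 0"
  by (simp add: flag_rem_def)

text \<open>The product of the two main terms of the flag bounds, times \<kappa>, is the first
  summand. The remainders and the triples with one heavy leg are all at most a constant times 2 powr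
  (a + b + d + max).\<close>

lemma good_triples_sum:
  fixes w :: "int \<times> int \<Rightarrow> int \<times> int \<Rightarrow> real" and a b d :: nat
  assumes fin: "finite A" "finite B" "finite D"
    and c: "card A \<le> 4 ^ (a + 1)" "card B \<le> 4 ^ (b + 1)" "card D \<le> 4 ^ (d + 1)"
    and w: "\<And>p q. w p q \<ge> 0" "\<And>p q. w p q \<le> 1"
    and W: "\<And>p l X i. l \<in> int_lines \<Longrightarrow> p \<in> l \<Longrightarrow> finite X \<Longrightarrow> X \<subseteq> l - {p} \<Longrightarrow> card X < 2 ^ Suc i \<Longrightarrow>
        (\<Sum>q\<in>X. w p q) \<le> \<omega> i"
    and \<omega>: "\<And>i. 0 \<le> \<omega> i" "\<And>i. \<omega> i \<le> 10 * 2 ^ i" "(\<Sum>i<b + 2. \<omega> i / 2 ^ i) \<le> \<kappa>"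
  shows "(\<Sum>(p, q, r)\<in>good_triples A B D a b d. w p q) \<le>
    2 * 10 ^ 11 * (2 powr (a + b + d) * (\<kappa> * 2 powr ((a + b + d) / 3) + 2 powr (max a (max b d))))"
proof -
  define M where "M = max (real a) (max (real b) (real d))"
  have M: "real a \<le> M" "real b \<le> M" "real d \<le> M" by (auto simp: M_def)
  have Mm: "real (max a (max b d)) = M" by (simp add: M_def of_nat_max)
  define T0 where "T0 = 2 powr (a + b + d + M)"
  define LL where "LL = {(p, q, r) \<in> right_triples A B D. card (line_through p q \<inter> B) < 2 ^ (b + 2) \<and>
      card (line_through p r \<inter> D) < 2 ^ (d + 2)}"
  define HL where "HL = {(p, q, r) \<in> right_triples A B D. 2 ^ (b + 2) \<le> card (line_through p q \<inter> B) \<and>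
      card (line_through p q \<inter> A) < 2 ^ (a + 2) \<and> card (line_through p r \<inter> D) < 2 ^ (d + 2)}"
  define HR where "HR = {(p, q, r) \<in> right_triples A D B. 2 ^ (d + 2) \<le> card (line_through p q \<inter> D) \<and>
      card (line_through p q \<inter> A) < 2 ^ (a + 2) \<and> card (line_through p r \<inter> B) < 2 ^ (b + 2)}"
  let ?sw = "\<lambda>(p, q, r). (p, r, q)"
  have subs: "LL \<subseteq> right_triples A B D" "HL \<subseteq> right_triples A B D" "HR \<subseteq> right_triples A D B"
    by (auto simp: LL_def HL_def HR_def)
  note finLL = finite_subset[OF subs(1) finite_right_triples[OF fin]]
    and finHL = finite_subset[OF subs(2) finite_right_triples[OF fin]]
    and finHR = finite_subset[OF subs(3) finite_right_triples[OF fin(1,3,2)]]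
  \<comment> \<open>If the leg towards q is heavy for q, the exclusions make it light for p and the
    other leg light for r, which is \<open>HL\<close>. \<open>HR\<close> is the mirror image, and
    without heavy legs the triple is in \<open>LL\<close>.\<close>
  have sub: "good_triples A B D a b d \<subseteq> LL \<union> (HL \<union> ?sw ` HR)"
  proof
    fix t assume t: "t \<in> good_triples A B D a b d"
    obtain p q r where tt: "t = (p, q, r)" by (metis surj_pair)
    have rt: "(p, q, r) \<in> right_triples A B D" using t tt by (auto simp: good_triples_def)
    then have rt': "(p, r, q) \<in> right_triples A D B" by (auto simp: right_triples_def idot_commute)
    show "t \<in> LL \<union> (HL \<union> ?sw ` HR)"
    proof (cases "t \<in> LL \<or> t \<in> HL")
      case False
      then have "(p, r, q) \<in> HR" using t rt rt' unfolding tt good_triples_def LL_def HL_def HR_def by auto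
      then have "t \<in> ?sw ` HR" unfolding tt by (force simp: image_iff)
      then show ?thesis by blast
    qed auto
  qed
  let ?w = "\<lambda>t. case t of (p, q, r) \<Rightarrow> w p q"
  have w0: "0 \<le> ?w t" "?w t \<le> 1" for t using w by (auto split: prod.splits)
  have HLb: "real (card HL) \<le> 884736 * T0"
  proof -
    have "real (card HL) \<le> 884736 * 2 powr (a + 2 * b + d)"
      unfolding HL_def by (rule heavy_triples_card) (use fin c in auto)
    also have "\<dots> \<le> 884736 * T0" unfolding T0_def using M by (intro mult_left_mono powr_mono) auto
    finally show ?thesis .
  qed
  have HRb: "real (card HR) \<le> 884736 * T0"
  proof -
    have "real (card HR) \<le> 884736 * 2 powr (a + 2 * d + b)"
      unfolding HR_def by (rule heavy_triples_card) (use fin c in auto)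
    also have "\<dots> \<le> 884736 * T0" unfolding T0_def using M by (intro mult_left_mono powr_mono) auto
    finally show ?thesis .
  qed
  define P P' where "P = 2 powr ((2 * real a + 4 * real b) / 3)" and "P' = 2 powr ((2 * real a + 4 * real d) / 3)"
  \<comment> \<open>Chosen so that E * E' is the target T0, while E dominates both P and the
    remainder sum of the first leg, and E' does so for the second leg.\<close>
  define E E' where "E = 2 powr (a / 2 + b + M / 2)" and "E' = 2 powr (a / 2 + d + M / 2)"
  have EE: "E * E' = T0" by (simp add: E_def E'_def T0_def powr_add[symmetric] algebra_simps)
  have PE: "P \<le> E" "P' \<le> E'" unfolding P_def P'_def E_def E'_def using M by (auto intro!: powr_mono)
  have PP: "P * P' = 2 powr (a + b + d) * 2 powr ((a + b + d) / 3)"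
    unfolding P_def P'_def powr_add[symmetric] by (rule arg_cong[where f = "\<lambda>x. 2 powr x"]) (simp add: field_simps)
  have nn: "0 \<le> P" "0 \<le> P'" "0 \<le> E" "0 \<le> E'" "0 \<le> T0" by (auto simp: P_def P'_def E_def E'_def T0_def)
  have SE: "(\<Sum>i<b + 2. 2 ^ i * sqrt (flag_rem a b i)) \<le> 24 * E" if "real b \<le> M" "E = 2 powr (a / 2 + b + M / 2)" for b :: nat and E
  proof -
    have "2 powr (real a + real b) \<le> E" "2 powr ((3 * real b + real a) / 2) \<le> E" using that M by (auto intro!: powr_mono)
    then have "12 * (2 powr (real a + real b) + 2 powr ((3 * real b + real a) / 2)) \<le> 24 * E" by simp
    then show ?thesis using order_trans[OF sum_sqrt_flag_rem[of a b]] by blast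
  qed
  have "(\<Sum>t\<in>LL. ?w t) \<le> 2 * (\<Sum>i<b + 2. \<Sum>j<d + 2. \<omega> i * 2 ^ j *
      min (real (card (flags A B b i))) (real (card (flags A D d j))))"
    unfolding LL_def by (rule light_triples_sum[OF fin w(1) W \<omega>(1)])
  also have "\<dots> \<le> 2 * (10000000 * (4 * \<kappa> * P * P' + 40 * (24 * E) * P' + 40 * P * (24 * E') + 10 * (24 * E) * (24 * E')))"
  proof (intro mult_left_mono sum_two_scales)
    show "real (card (flags A B b i)) \<le> 10000000 * (P\<^sup>2 / 4 ^ i + flag_rem a b i)" for i
      unfolding P_def by (rule card_flags_le) (use fin c in auto)
    show "real (card (flags A D d i)) \<le> 10000000 * (P'\<^sup>2 / 4 ^ i + flag_rem a d i)" for i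
      unfolding P'_def by (rule card_flags_le) (use fin c in auto)
    show "(\<Sum>i<b + 2. 2 ^ i * sqrt (flag_rem a b i)) \<le> 24 * E" by (rule SE) (use M E_def in auto)
    show "(\<Sum>i<d + 2. 2 ^ i * sqrt (flag_rem a d i)) \<le> 24 * E'" by (rule SE) (use M E'_def in auto)
  qed (use nn \<omega> flag_rem_nonneg in auto)
  also have "\<dots> = 80000000 * (\<kappa> * (P * P')) + 19200000000 * (E * P') + 19200000000 * (P * E') + 115200000000 * (E * E')"
    by (simp add: algebra_simps)
  also have "\<dots> \<le> 80000000 * (\<kappa> * (P * P')) + 19200000000 * T0 + 19200000000 * T0 + 115200000000 * T0"
    unfolding EE[symmetric] using PE nn by (intro add_mono mult_left_mono mult_mono order_refl) auto
  finally have LLb: "(\<Sum>t\<in>LL. ?w t) \<le> 80000000 * (\<kappa> * (P * P')) + 153600000000 * T0" by simp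
  have "(\<Sum>t\<in>good_triples A B D a b d. ?w t) \<le> (\<Sum>t\<in>LL \<union> (HL \<union> ?sw ` HR). ?w t)"
    using finLL finHL finHR w0 sub by (intro sum_mono2) auto
  also have "\<dots> \<le> (\<Sum>t\<in>LL. ?w t) + (\<Sum>t\<in>HL \<union> ?sw ` HR. ?w t)"
    using finLL finHL finHR w0 by (intro sum_union_le finite_UnI finite_imageI)
  also have "(\<Sum>t\<in>HL \<union> ?sw ` HR. ?w t) \<le> (\<Sum>t\<in>HL \<union> ?sw ` HR. 1)" using w0 by (intro sum_mono) auto
  also have "\<dots> = real (card (HL \<union> ?sw ` HR))" by simp
  also have "\<dots> \<le> real (card HL + card HR)"
    using card_Un_le[of HL "?sw ` HR"] card_image_le[OF finHR, of ?sw] by (intro of_nat_mono) linarith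
  also have "\<dots> \<le> 1769472 * T0" using HLb HRb by simp
  finally have "(\<Sum>t\<in>good_triples A B D a b d. ?w t) \<le> 80000000 * (\<kappa> * (P * P')) + 155000000000 * T0"
    using LLb nn by linarith
  also have "\<dots> \<le> 200000000000 * (\<kappa> * (P * P')) + 200000000000 * T0"
  proof (intro add_mono mult_right_mono)
    have "0 \<le> (\<Sum>i<b + 2. \<omega> i / 2 ^ i)" using \<omega> by (intro sum_nonneg) auto
    then show "0 \<le> \<kappa> * (P * P')" using \<omega>(3) nn by simp
  qed (use nn in auto)
  also have "\<dots> = 2 * 10 ^ 11 * (2 powr (a + b + d) * (\<kappa> * 2 powr ((a + b + d) / 3) + 2 powr (max a (max b d))))"
    unfolding PP Mm T0_def powr_add by (simp add: algebra_simps)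
  finally show ?thesis .
qed

section \<open>Rectangles with heavy vertices\<close>

text \<open>Two feet differ by a vector both parallel and orthogonal to u, hence by zero. Applied to
  rectangles, it recovers a vertex from its neighbour and the line of a side.\<close>

lemma foot_unique:
  assumes "q \<in> l" "q' \<in> l" "l = {x. icross u (x - z) = 0}" "u \<noteq> 0" "idot u (s - q) = 0" "idot u (s - q') = 0"
  shows "q = q'"
proof -
  have h: "fst u * snd (q' - q) - snd u * fst (q' - q) = 0" "fst u * fst (q' - q) + snd u * snd (q' - q) = 0"
    using assms by (auto simp: icross_def idot_def algebra_simps)
  have "(fst u * fst u + snd u * snd u) * fst (q' - q) = 0" "(fst u * fst u + snd u * snd u) * snd (q' - q) = 0"
    using h by algebra+
  moreover have "fst u * fst u + snd u * snd u \<noteq> 0" using assms(4) by (auto simp: prod_eq_iff sum_squares_eq_zero_iff)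
  ultimately show ?thesis by (auto simp: prod_eq_iff)
qed

lemma icross_parallel_idot: "icross u v = 0 \<Longrightarrow> u \<noteq> 0 \<Longrightarrow> idot u x = 0 \<Longrightarrow> idot v x = 0"
  using perp_on_line[of u 0 x v] by (simp add: line_through_def)

lemma icross_trans: "icross u v = 0 \<Longrightarrow> icross u v' = 0 \<Longrightarrow> u \<noteq> 0 \<Longrightarrow> icross v v' = 0"
proof -
  assume h: "icross u v = 0" "icross u v' = 0" "u \<noteq> 0"
  have "fst u * icross v v' = 0" "snd u * icross v v' = 0" using h(1,2) unfolding icross_def by algebra+
  then show ?thesis using h(3) by (auto simp: prod_eq_iff)
qed

lemma icross_commute: "icross u v = 0 \<longleftrightarrow> icross v u = 0"
  by (auto simp: icross_def algebra_simps)

section \<open>Functions constant on levels, and their heavy flags\<close>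

lemma two_power_sq: "(2 ^ j)\<^sup>2 = (4 :: real) ^ j"
  by (simp add: power2_eq_square power_mult_distrib[symmetric])

lemma sum_le_product:
  fixes g h :: "'a \<Rightarrow> real" and G :: "'b \<Rightarrow> real"
  assumes "finite X" "finite Y" "inj_on (\<lambda>t. (m1 t, m2 t)) T" "m1 ` T \<subseteq> X" "m2 ` T \<subseteq> Y"
    "\<And>t. t \<in> T \<Longrightarrow> k t = G (m1 t) * g (m2 t)" "\<And>x. G x \<ge> 0" "\<And>y. g y \<ge> 0"
  shows "(\<Sum>t\<in>T. k t) \<le> (\<Sum>x\<in>X. G x) * (\<Sum>y\<in>Y. g y)"
proof -
  have "(\<Sum>t\<in>T. k t) = (\<Sum>t\<in>T. (\<lambda>(x, y). G x * g y) (m1 t, m2 t))"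
    using assms(6) by (intro sum.cong) auto
  also have "\<dots> = (\<Sum>z\<in>(\<lambda>t. (m1 t, m2 t)) ` T. (\<lambda>(x, y). G x * g y) z)"
    using assms(3) by (simp add: sum.reindex)
  also have "\<dots> \<le> (\<Sum>z\<in>X \<times> Y. (\<lambda>(x, y). G x * g y) z)"
    using assms by (intro sum_mono2) auto
  also have "\<dots> = (\<Sum>x\<in>X. G x) * (\<Sum>y\<in>Y. g y)"
    by (simp add: sum_product sum.cartesian_product)
  finally show ?thesis .
qed

text \<open>The function to be treated takes the value lam j / 2 ^ j on level j. With this
  normalisation a level of about 4 ^ j points contributes about (lam j)^2 to the squared l2
  norm.\<close>

locale level_sets =
  fixes S :: "(int \<times> int) set" and lev :: "int \<times> int \<Rightarrow> nat" and lam :: "nat \<Rightarrow> real" and J :: nat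
  assumes finS: "finite S" and lev_le: "\<And>p. p \<in> S \<Longrightarrow> lev p \<le> J"
    and card_lev: "\<And>j. card {p \<in> S. lev p = j} \<le> 4 ^ (j + 1)" and lam_nonneg: "\<And>j. 0 \<le> lam j"
begin

definition "lset j = {p \<in> S. lev p = j}"
definition "F p = lam (lev p) / 2 ^ lev p"
definition "\<Lambda> = (\<Sum>j\<le>J. (lam j)\<^sup>2)"
text \<open>The square of the threshold is at least 4 ^ (j + 1), the maximal size of level j. This
  is exactly the regime of \<open>very_rich_lines_incidences\<close>.\<close>

definition "heavy p l \<longleftrightarrow> 2 ^ (lev p + 2) \<le> card (l \<inter> lset (lev p))"
definition "rects = {(p, q, s, r). p \<in> S \<and> q \<in> S \<and> s \<in> S \<and> r \<in> S \<and> q \<noteq> p \<and> r \<noteq> p \<and>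
   idot (q - p) (r - p) = 0 \<and> s = q + r - p}"
definition "rect_prod = (\<lambda>(p, q, s, r). F p * F q * F s * F r)"

lemma fin_lset: "finite (lset j)" using finS by (simp add: lset_def)

lemma F_nonneg: "F p \<ge> 0" using lam_nonneg by (simp add: F_def)

lemma Lam_nonneg: "\<Lambda> \<ge> 0" by (simp add: \<Lambda>_def sum_nonneg)

lemma rect_prod_nonneg: "rect_prod Q \<ge> 0"
  by (auto simp: rect_prod_def F_nonneg split: prod.splits)

lemma finite_rects: "finite rects"
  by (rule finite_subset[of _ "S \<times> S \<times> S \<times> S"]) (use finS in \<open>auto simp: rects_def\<close>)

lemma sum_by_level: "(\<Sum>p\<in>S. g p) = (\<Sum>j\<le>J. \<Sum>p\<in>lset j. g p)" for g :: "int \<times> int \<Rightarrow> real"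
  unfolding lset_def by (rule sum.group[symmetric]) (use finS lev_le in auto)

lemma sum_F_sq: "(\<Sum>p\<in>S. (F p)\<^sup>2) \<le> 4 * \<Lambda>"
proof -
  have "(\<Sum>p\<in>S. (F p)\<^sup>2) = (\<Sum>j\<le>J. real (card (lset j)) * ((lam j)\<^sup>2 / 4 ^ j))"
    unfolding sum_by_level
  proof (intro sum.cong refl)
    fix j
    have "(\<Sum>p\<in>lset j. (F p)\<^sup>2) = (\<Sum>p\<in>lset j. (lam j)\<^sup>2 / 4 ^ j)"
      by (intro sum.cong refl) (simp add: lset_def F_def power_divide two_power_sq)
    then show "(\<Sum>p\<in>lset j. (F p)\<^sup>2) = real (card (lset j)) * ((lam j)\<^sup>2 / 4 ^ j)" by simp
  qed
  also have "\<dots> \<le> (\<Sum>j\<le>J. 4 ^ (j + 1) * ((lam j)\<^sup>2 / 4 ^ j))"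
  proof (intro sum_mono mult_right_mono)
    fix j
    have "real (card (lset j)) \<le> real (4 ^ (j + 1))" unfolding lset_def using card_lev by (rule of_nat_mono)
    then show "real (card (lset j)) \<le> 4 ^ (j + 1)" by simp
  qed auto
  also have "\<dots> = 4 * \<Lambda>" by (simp add: \<Lambda>_def sum_distrib_left)
  finally show ?thesis .
qed

definition "heavy_flags = {(p, l). p \<in> S \<and> l \<in> int_lines \<and> p \<in> l \<and> heavy p l}"

text \<open>On level j there are at most 13824 * 4 ^ (j + 1) heavy flags, each of weight (lam j)^2 /
  4 ^ j. Finiteness holds because a heavy line contains at least two points of a level.\<close>

lemma heavy_flags_bound: "finite heavy_flags" "(\<Sum>(p, l)\<in>heavy_flags. (F p)\<^sup>2) \<le> 55296 * \<Lambda>"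
proof -
  define H where "H j = {l \<in> int_lines. 2 ^ (j + 2) \<le> card (l \<inter> lset j)}" for j
  have "H j \<subseteq> (\<lambda>(p, q). line_through p q) ` (lset j \<times> lset j)" for j
  proof
    fix l assume l: "l \<in> H j"
    then have "2 ^ (j + 2) \<le> card (l \<inter> lset j)" by (simp add: H_def)
    moreover have "(2 :: nat) \<le> 2 ^ (j + 2)" by simp
    ultimately have "\<not> card (l \<inter> lset j) \<le> Suc 0" by linarith
    then have "\<not> (\<forall>x\<in>l \<inter> lset j. \<forall>y\<in>l \<inter> lset j. x = y)"
      using card_le_Suc0_iff_eq[of "l \<inter> lset j"] fin_lset by auto
    then obtain p q where pq: "p \<in> l \<inter> lset j" "q \<in> l \<inter> lset j" "p \<noteq> q" by blast
    have "l \<in> int_lines" using l by (simp add: H_def)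
    then have "l = line_through p q" using pq by (intro line_through_unique) auto
    then show "l \<in> (\<lambda>(p, q). line_through p q) ` (lset j \<times> lset j)" using pq by blast
  qed
  then have finH: "finite (H j)" for j using fin_lset finite_subset by (metis (no_types) finite_cartesian_product finite_imageI)
  define HJ where "HJ j = {(p, l) \<in> lset j \<times> H j. p \<in> l}" for j
  have finHJ: "finite (HJ j)" for j
    by (rule finite_subset[of _ "lset j \<times> H j"]) (use finH fin_lset in \<open>auto simp: HJ_def\<close>)
  have eq: "heavy_flags = (\<Union>j\<le>J. HJ j)"
  proof (rule set_eqI)
    fix x :: "(int \<times> int) \<times> (int \<times> int) set"
    obtain p l where x: "x = (p, l)" by (metis surj_pair)
    have "x \<in> heavy_flags \<longleftrightarrow> p \<in> S \<and> l \<in> int_lines \<and> p \<in> l \<and> heavy p l" by (simp add: heavy_flags_def x)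
    also have "\<dots> \<longleftrightarrow> (\<exists>j\<le>J. p \<in> S \<and> lev p = j \<and> l \<in> H j \<and> p \<in> l)"
      using lev_le[of p] by (auto simp: H_def heavy_def)
    also have "\<dots> \<longleftrightarrow> x \<in> (\<Union>j\<le>J. HJ j)" by (auto simp: HJ_def lset_def x)
    finally show "x \<in> heavy_flags \<longleftrightarrow> x \<in> (\<Union>j\<le>J. HJ j)" .
  qed
  then show "finite heavy_flags" using finHJ by simp
  have "(\<Sum>(p, l)\<in>heavy_flags. (F p)\<^sup>2) = (\<Sum>j\<le>J. \<Sum>(p, l)\<in>HJ j. (F p)\<^sup>2)"
    unfolding eq by (rule sum.UNION_disjoint) (use finHJ in \<open>auto simp: HJ_def lset_def\<close>)
  also have "\<dots> \<le> (\<Sum>j\<le>J. 55296 * (lam j)\<^sup>2)"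
  proof (rule sum_mono)
    fix j
    have "(\<Sum>(p, l)\<in>HJ j. (F p)\<^sup>2) = (\<Sum>x\<in>HJ j. (lam j)\<^sup>2 / 4 ^ j)"
      by (intro sum.cong refl) (auto simp: HJ_def lset_def F_def power_divide two_power_sq)
    also have "\<dots> = real (incidences (lset j) (H j)) * ((lam j)\<^sup>2 / 4 ^ j)" by (simp add: HJ_def incidences_def)
    also have "real (incidences (lset j) (H j)) \<le> 13824 * real (card (lset j))"
    proof (rule very_rich_lines_incidences[where k = "2 ^ (j + 2)"])
      have "real (card (lset j)) \<le> real (4 ^ (j + 1))" unfolding lset_def using card_lev by (rule of_nat_mono)
      also have "\<dots> \<le> (2 ^ (j + 2))\<^sup>2" by (simp add: power_mult_distrib power2_eq_square flip: power_mult_distrib)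
      finally show "real (card (lset j)) \<le> (2 ^ (j + 2))\<^sup>2" .
      show "2 ^ (j + 2) \<le> real (card (l \<inter> lset j))" if "l \<in> H j" for l
      proof -
        have "2 ^ (j + 2) \<le> card (l \<inter> lset j)" using that by (auto simp: H_def)
        then have "real (2 ^ (j + 2)) \<le> real (card (l \<inter> lset j))" by (rule of_nat_mono)
        then show ?thesis by simp
      qed
    qed (use fin_lset finH in \<open>auto simp: H_def\<close>)
    also have "13824 * real (card (lset j)) \<le> 13824 * real (4 ^ (j + 1))"
      unfolding lset_def by (intro mult_left_mono of_nat_mono card_lev) auto
    also have "13824 * real (4 ^ (j + 1)) * ((lam j)\<^sup>2 / 4 ^ j) = 55296 * (lam j)\<^sup>2" by simp
    finally show "(\<Sum>(p, l)\<in>HJ j. (F p)\<^sup>2) \<le> 55296 * (lam j)\<^sup>2" by (simp add: mult_right_mono divide_right_mono)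
  qed
  also have "\<dots> = 55296 * \<Lambda>" by (simp add: \<Lambda>_def sum_distrib_left)
  finally show "(\<Sum>(p, l)\<in>heavy_flags. (F p)\<^sup>2) \<le> 55296 * \<Lambda>" .
qed

lemma rects_facts:
  assumes "(p, q, s, r) \<in> rects"
  shows "p \<in> S" "q \<in> S" "s \<in> S" "r \<in> S" "q \<noteq> p" "r \<noteq> p" "idot (q - p) (r - p) = 0" "s = q + r - p"
    "q - p \<noteq> 0" "idot (q - p) (s - q) = 0" "icross (q - p) (p - q) = 0"
proof -
  show h: "p \<in> S" "q \<in> S" "s \<in> S" "r \<in> S" "q \<noteq> p" "r \<noteq> p" "idot (q - p) (r - p) = 0" "s = q + r - p"
    using assms by (auto simp: rects_def)
  have "s - q = r - p" using h(8) by simp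
  then show "idot (q - p) (s - q) = 0" using h(7) by simp
  show "q - p \<noteq> 0" using h(5) by simp
  show "icross (q - p) (p - q) = 0" by (simp add: icross_def algebra_simps)
qed

lemma line_through_shift: "line_through p q = {x. icross (q - p) (x - q) = 0}"
  by (auto simp: line_through_def icross_def algebra_simps)

text \<open>The arithmetic-geometric mean inequality separates the diagonals p s and q r. The heavy
  flag of p and the opposite vertex s determine the rectangle, since q is the foot of s on the line;
  likewise the flag of q and the vertex r. Both sums are then at most heavy flags times the l2
  sum.\<close>

lemma adjacent_heavy_sum:
  "(\<Sum>Q\<in>{(p, q, s, r) \<in> rects. heavy p (line_through p q) \<and> heavy q (line_through p q)}. rect_prod Q) \<le> 221184 * \<Lambda>\<^sup>2"
proof -
  define T where "T = {(p, q, s, r) \<in> rects. heavy p (line_through p q) \<and> heavy q (line_through p q)}"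
  let ?G = "\<lambda>(p :: int \<times> int, l :: (int \<times> int) set). (F p)\<^sup>2" and ?g = "\<lambda>p. (F p)\<^sup>2"
  have inj1: "inj_on (\<lambda>Q. (((\<lambda>(p, q, s, r). (p, line_through p q)) Q, (\<lambda>(p, q, s, r). s) Q))) T"
  proof (rule inj_onI)
    fix Q Q' assume Q: "Q \<in> T" "Q' \<in> T" "(((\<lambda>(p, q, s, r). (p, line_through p q)) Q, (\<lambda>(p, q, s, r). s) Q)) =
      (((\<lambda>(p, q, s, r). (p, line_through p q)) Q', (\<lambda>(p, q, s, r). s) Q'))"
    obtain p q s r where 1: "Q = (p, q, s, r)" by (metis surj_pair)
    obtain q' r' where 2: "Q' = (p, q', s, r')" using Q(3) 1 by (cases Q') auto
    have l: "line_through p q = line_through p q'" using Q(3) 1 2 by simp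
    have R: "(p, q, s, r) \<in> rects" "(p, q', s, r') \<in> rects" using Q 1 2 by (auto simp: T_def)
    note f = rects_facts[OF R(1)] and f' = rects_facts[OF R(2)]
    have m: "q' \<in> line_through p q" unfolding l by simp
    then have "icross (q - p) (q' - p) = 0" by (simp add: line_through_def)
    then have "icross (q' - p) (q - p) = 0" using icross_commute by blast
    then have "idot (q - p) (s - q') = 0" using icross_parallel_idot[OF _ f'(9,10)] by blast
    then have "q = q'" using foot_unique[of q "line_through p q" q' "q - p" p s] f m by (simp add: line_through_def icross_def)
    then show "Q = Q'" using 1 2 f(8) f'(8) by simp
  qed
  have inj2: "inj_on (\<lambda>Q. (((\<lambda>(p, q, s, r). (q, line_through p q)) Q, (\<lambda>(p, q, s, r). r) Q))) T"
  proof (rule inj_onI)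
    fix Q Q' assume Q: "Q \<in> T" "Q' \<in> T" "(((\<lambda>(p, q, s, r). (q, line_through p q)) Q, (\<lambda>(p, q, s, r). r) Q)) =
      (((\<lambda>(p, q, s, r). (q, line_through p q)) Q', (\<lambda>(p, q, s, r). r) Q'))"
    obtain p q s r where 1: "Q = (p, q, s, r)" by (metis surj_pair)
    obtain p' s' where 2: "Q' = (p', q, s', r)" using Q(3) 1 by (cases Q') auto
    have l: "line_through p q = line_through p' q" using Q(3) 1 2 by simp
    have R: "(p, q, s, r) \<in> rects" "(p', q, s', r) \<in> rects" using Q 1 2 by (auto simp: T_def)
    note f = rects_facts[OF R(1)] and f' = rects_facts[OF R(2)]
    have m: "p' \<in> line_through p q" "p \<in> line_through p' q" unfolding l by (simp, simp add: l[symmetric])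
    have "icross (q - p') (p - p') = 0" using m(2) by (simp add: line_through_def)
    then have "icross (q - p') (q - p) = 0" by (simp add: icross_def algebra_simps)
    then have "idot (q - p) (r - p') = 0" using icross_parallel_idot[OF _ f'(9,7)] by blast
    then have "p = p'" using foot_unique[of p "line_through p q" p' "q - p" p r] f m by (simp add: line_through_def icross_def)
    then show "Q = Q'" using 1 2 f(8) f'(8) by simp
  qed
  have hf: "(\<lambda>(p, q, s, r). (p, line_through p q)) ` T \<subseteq> heavy_flags" "(\<lambda>(p, q, s, r). (q, line_through p q)) ` T \<subseteq> heavy_flags"
    by (auto simp: T_def heavy_flags_def rects_def intro: line_through_int_lines)
  have s1: "(\<Sum>Q\<in>T. (\<lambda>(p, q, s, r). (F p)\<^sup>2 * (F s)\<^sup>2) Q) \<le> (\<Sum>x\<in>heavy_flags. ?G x) * (\<Sum>s\<in>S. ?g s)"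
    by (rule sum_le_product[OF heavy_flags_bound(1) finS inj1 hf(1)]) (auto simp: T_def rects_def)
  have s2: "(\<Sum>Q\<in>T. (\<lambda>(p, q, s, r). (F q)\<^sup>2 * (F r)\<^sup>2) Q) \<le> (\<Sum>x\<in>heavy_flags. ?G x) * (\<Sum>s\<in>S. ?g s)"
    by (rule sum_le_product[OF heavy_flags_bound(1) finS inj2 hf(2)]) (auto simp: T_def rects_def)
  have b: "(\<Sum>x\<in>heavy_flags. ?G x) * (\<Sum>s\<in>S. ?g s) \<le> (55296 * \<Lambda>) * (4 * \<Lambda>)"
    using heavy_flags_bound(2) sum_F_sq Lam_nonneg by (intro mult_mono sum_nonneg) auto
  have "(\<Sum>Q\<in>T. rect_prod Q) \<le> (\<Sum>Q\<in>T. ((\<lambda>(p, q, s, r). (F p)\<^sup>2 * (F s)\<^sup>2) Q + (\<lambda>(p, q, s, r). (F q)\<^sup>2 * (F r)\<^sup>2) Q) / 2)"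
  proof (intro sum_mono)
    fix Q assume "Q \<in> T"
    obtain p q s r where 1: "Q = (p, q, s, r)" by (metis surj_pair)
    have "0 \<le> (F p * F s - F q * F r)\<^sup>2" by simp
    then show "rect_prod Q \<le> ((\<lambda>(p, q, s, r). (F p)\<^sup>2 * (F s)\<^sup>2) Q + (\<lambda>(p, q, s, r). (F q)\<^sup>2 * (F r)\<^sup>2) Q) / 2"
      unfolding 1 rect_prod_def by (simp add: power2_diff power_mult_distrib algebra_simps)
  qed
  also have "\<dots> \<le> 221184 * \<Lambda>\<^sup>2" using s1 s2 b
    by (simp add: sum_divide_distrib[symmetric] sum.distrib power2_eq_square)
  finally show ?thesis unfolding T_def .
qed

end

lemma sum_inj_le:
  fixes g :: "'b \<Rightarrow> real"
  assumes "inj_on h X" "h ` X \<subseteq> Y" "finite Y" "\<And>x. x \<in> X \<Longrightarrow> f x = g (h x)" "\<And>y. y \<in> Y \<Longrightarrow> 0 \<le> g y"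
  shows "(\<Sum>x\<in>X. f x) \<le> (\<Sum>y\<in>Y. g y)"
proof -
  have "(\<Sum>x\<in>X. f x) = (\<Sum>x\<in>X. g (h x))" using assms(4) by (rule sum.cong[OF refl])
  also have "\<dots> = (\<Sum>y\<in>h ` X. g y)" using assms(1) by (simp add: sum.reindex)
  also have "\<dots> \<le> (\<Sum>y\<in>Y. g y)" using assms by (intro sum_mono2) auto
  finally show ?thesis .
qed

text \<open>All vectors parallel to u serve as a name for the direction, so that no primitive
  representative has to be chosen.\<close>

definition direction :: "int \<times> int \<Rightarrow> (int \<times> int) set" where
  "direction u = {v. icross u v = 0}"

lemma direction_self: "u \<in> direction u"
  by (simp add: direction_def icross_def)

lemma direction_eqI: "icross u u' = 0 \<Longrightarrow> u \<noteq> 0 \<Longrightarrow> u' \<noteq> 0 \<Longrightarrow> direction u = direction u'"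
  unfolding direction_def using icross_trans[of u u'] icross_trans[of u' u] icross_commute by blast

context level_sets begin

text \<open>Here q and r are heavy on different lines and a diagonal alone does not determine the
  rectangle; with the direction \<theta> of a side it does. For fixed \<theta>, Cauchy-Schwarz pairs
  a full l2 factor from p and s with the masses \<mu> and \<mu>' of the admissible q and r. Summed
  over \<theta>, these masses are bounded by heavy flags.\<close>

lemma opposite_heavy_sum:
  "(\<Sum>Q\<in>{(p, q, s, r) \<in> rects. heavy q (line_through p q) \<and> heavy r (line_through p r)}. rect_prod Q) \<le> 221184 * \<Lambda>\<^sup>2"
proof -
  define T where "T = {(p, q, s, r) \<in> rects. heavy q (line_through p q) \<and> heavy r (line_through p r)}"
  have finT: "finite T" using finite_rects finite_subset[of T rects] by (auto simp: T_def)
  define dQ :: "(int \<times> int) \<times> (int \<times> int) \<times> (int \<times> int) \<times> (int \<times> int) \<Rightarrow> (int \<times> int) set"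
    where "dQ = (\<lambda>(p, q, s, r). direction (q - p))"
  define \<Theta> where "\<Theta> = dQ ` T"
  define TT where "TT \<theta> = {Q \<in> T. dQ Q = \<theta>}" for \<theta>
  define N where "N \<theta> = (\<lambda>(p, q, s, r). q) ` TT \<theta>" for \<theta>
  define N' where "N' \<theta> = (\<lambda>(p, q, s, r). r) ` TT \<theta>" for \<theta>
  have fin: "finite \<Theta>" "finite (TT \<theta>)" "finite (N \<theta>)" "finite (N' \<theta>)" for \<theta>
    using finT by (auto simp: \<Theta>_def TT_def N_def N'_def)
  have mem: "(p, q, s, r) \<in> rects" "heavy q (line_through p q)" "heavy r (line_through p r)" "direction (q - p) = \<theta>"
    if "(p, q, s, r) \<in> TT \<theta>" for p q s r \<theta> using that by (auto simp: TT_def T_def dQ_def)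
  define \<mu> where "\<mu> \<theta> = (\<Sum>q\<in>N \<theta>. (F q)\<^sup>2)" for \<theta>
  define \<mu>' where "\<mu>' \<theta> = (\<Sum>q\<in>N' \<theta>. (F q)\<^sup>2)" for \<theta>
  have mu0: "\<mu> \<theta> \<ge> 0" "\<mu>' \<theta> \<ge> 0" for \<theta> by (auto simp: \<mu>_def \<mu>'_def sum_nonneg)
  have one: "(\<Sum>Q\<in>TT \<theta>. rect_prod Q) \<le> 2 * \<Lambda> * (\<mu> \<theta> + \<mu>' \<theta>)" for \<theta>
  proof -
    have X: "(\<Sum>Q\<in>TT \<theta>. ((\<lambda>(p, q, s, r). F p * F s) Q)\<^sup>2) \<le> (\<Sum>p\<in>S. (F p)\<^sup>2) * (\<Sum>p\<in>S. (F p)\<^sup>2)"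
    proof (rule sum_le_product[where ?m1.0 = "\<lambda>(p, q, s, r). p" and ?m2.0 = "\<lambda>(p, q, s, r). s", OF finS finS])
      show "inj_on (\<lambda>t. (case t of (p, q, s, r) \<Rightarrow> p, case t of (p, q, s, r) \<Rightarrow> s)) (TT \<theta>)"
      proof (rule inj_onI)
        fix Q Q' assume Q: "Q \<in> TT \<theta>" "Q' \<in> TT \<theta>" "(case Q of (p, q, s, r) \<Rightarrow> p, case Q of (p, q, s, r) \<Rightarrow> s) =
          (case Q' of (p, q, s, r) \<Rightarrow> p, case Q' of (p, q, s, r) \<Rightarrow> s)"
        obtain p q s r where 1: "Q = (p, q, s, r)" by (metis surj_pair)
        obtain q' r' where 2: "Q' = (p, q', s, r')" using Q(3) 1 by (cases Q') auto
        note m = mem[OF Q(1)[unfolded 1]] and m' = mem[OF Q(2)[unfolded 2]]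
        note f = rects_facts[OF m(1)] and f' = rects_facts[OF m'(1)]
        have "q' - p \<in> direction (q - p)" unfolding m(4) m'(4)[symmetric] by (rule direction_self)
        then have c: "icross (q - p) (q' - p) = 0" by (simp add: direction_def)
        then have "icross (q' - p) (q - p) = 0" using icross_commute by blast
        then have "idot (q - p) (s - q') = 0" using icross_parallel_idot[OF _ f'(9,10)] by blast
        then have "q = q'" using foot_unique[of q "line_through p q" q' "q - p" p s] f c by (simp add: line_through_def icross_def)
        then show "Q = Q'" using 1 2 f(8) f'(8) by simp
      qed
    qed (auto simp: power_mult_distrib dest: mem(1) rects_facts)
    have "(\<Sum>p\<in>S. (F p)\<^sup>2) * (\<Sum>p\<in>S. (F p)\<^sup>2) \<le> (4 * \<Lambda>) * (4 * \<Lambda>)"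
      using sum_F_sq Lam_nonneg by (intro mult_mono sum_nonneg) auto
    with X have X': "(\<Sum>Q\<in>TT \<theta>. ((\<lambda>(p, q, s, r). F p * F s) Q)\<^sup>2) \<le> 16 * \<Lambda>\<^sup>2" by (simp add: power2_eq_square)
    have Y: "(\<Sum>Q\<in>TT \<theta>. ((\<lambda>(p, q, s, r). F q * F r) Q)\<^sup>2) \<le> \<mu> \<theta> * \<mu>' \<theta>"
      unfolding \<mu>_def \<mu>'_def
    proof (rule sum_le_product[where ?m1.0 = "\<lambda>(p, q, s, r). q" and ?m2.0 = "\<lambda>(p, q, s, r). r", OF fin(3,4)])
      show "inj_on (\<lambda>t. (case t of (p, q, s, r) \<Rightarrow> q, case t of (p, q, s, r) \<Rightarrow> r)) (TT \<theta>)"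
      proof (rule inj_onI)
        fix Q Q' assume Q: "Q \<in> TT \<theta>" "Q' \<in> TT \<theta>" "(case Q of (p, q, s, r) \<Rightarrow> q, case Q of (p, q, s, r) \<Rightarrow> r) =
          (case Q' of (p, q, s, r) \<Rightarrow> q, case Q' of (p, q, s, r) \<Rightarrow> r)"
        obtain p q s r where 1: "Q = (p, q, s, r)" by (metis surj_pair)
        obtain p' s' where 2: "Q' = (p', q, s', r)" using Q(3) 1 by (cases Q') auto
        note m = mem[OF Q(1)[unfolded 1]] and m' = mem[OF Q(2)[unfolded 2]]
        note f = rects_facts[OF m(1)] and f' = rects_facts[OF m'(1)]
        have "q - p' \<in> direction (q - p)" unfolding m(4) m'(4)[symmetric] by (rule direction_self)
        then have c: "icross (q - p) (q - p') = 0" by (simp add: direction_def)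
        then have "icross (q - p') (q - p) = 0" using icross_commute by blast
        then have i: "idot (q - p) (r - p') = 0" using icross_parallel_idot[OF _ f'(9,7)] by blast
        have "icross (q - p) (p' - q) = 0" using c by (simp add: icross_def algebra_simps)
        then have "p = p'" using foot_unique[of p "{x. icross (q - p) (x - q) = 0}" p' "q - p" q r] f i by simp
        then show "Q = Q'" using 1 2 f(8) f'(8) by simp
      qed
      show "(\<lambda>(p, q, s, r). q) ` TT \<theta> \<subseteq> N \<theta>" "(\<lambda>(p, q, s, r). r) ` TT \<theta> \<subseteq> N' \<theta>"
        by (simp_all add: N_def N'_def)
    qed (auto simp: power_mult_distrib)
    have "(\<Sum>Q\<in>TT \<theta>. rect_prod Q)\<^sup>2 = (\<Sum>Q\<in>TT \<theta>. (\<lambda>(p, q, s, r). F p * F s) Q * (\<lambda>(p, q, s, r). F q * F r) Q)\<^sup>2"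
      by (intro arg_cong[where f = "\<lambda>x. x\<^sup>2"] sum.cong refl) (auto simp: rect_prod_def)
    also have "\<dots> \<le> (\<Sum>Q\<in>TT \<theta>. ((\<lambda>(p, q, s, r). F p * F s) Q)\<^sup>2) * (\<Sum>Q\<in>TT \<theta>. ((\<lambda>(p, q, s, r). F q * F r) Q)\<^sup>2)"
      by (rule Cauchy_Schwarz_ineq_sum)
    also have "\<dots> \<le> (16 * \<Lambda>\<^sup>2) * (\<mu> \<theta> * \<mu>' \<theta>)"
      by (rule mult_mono[OF X' Y]) (auto intro: sum_nonneg)
    \<comment> \<open>The geometric mean of the two masses is replaced by their arithmetic mean,
      because only \<mu> and \<mu>' separately can be summed over directions.\<close>
    also have "\<dots> \<le> (2 * \<Lambda> * (\<mu> \<theta> + \<mu>' \<theta>))\<^sup>2"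
    proof -
      have "0 \<le> 4 * \<Lambda>\<^sup>2 * (\<mu> \<theta> - \<mu>' \<theta>)\<^sup>2" by simp
      then show ?thesis by (simp add: power2_eq_square algebra_simps)
    qed
    finally show ?thesis by (rule power2_le_imp_le) (use Lam_nonneg mu0 in auto)
  qed
  have hf: "{x. x - q \<in> direction (q - p)} = line_through p q" "{x. \<forall>v\<in>direction (q - p). idot v (x - r) = 0} = line_through p r"
    if R: "(p, q, s, r) \<in> rects" for p q s r
  proof -
    note f = rects_facts[OF R]
    show "{x. x - q \<in> direction (q - p)} = line_through p q" by (simp add: line_through_shift direction_def)
    have shift: "idot (q - p) (x - r) = idot (q - p) (x - p)" for x
      using f(7) by (simp add: idot_def algebra_simps)
    have "(\<forall>v\<in>direction (q - p). idot v (x - r) = 0) \<longleftrightarrow> x \<in> line_through p r" for x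
    proof
      assume "\<forall>v\<in>direction (q - p). idot v (x - r) = 0"
      then have "idot (q - p) (x - r) = 0" using direction_self[of "q - p"] by blast
      then have "idot (q - p) (x - p) = 0" using shift by simp
      then show "x \<in> line_through p r" by (rule perp_collinear[OF f(7) _ f(5)])
    next
      assume x: "x \<in> line_through p r"
      have "idot (x - p) (q - p) = 0" using perp_on_line[OF _ x f(6)] f(7) by (simp add: idot_commute)
      then have "idot (q - p) (x - r) = 0" unfolding shift by (simp add: idot_commute)
      then show "\<forall>v\<in>direction (q - p). idot v (x - r) = 0"
        using icross_parallel_idot[OF _ f(9)] by (simp add: direction_def)
    qed
    then show "{x. \<forall>v\<in>direction (q - p). idot v (x - r) = 0} = line_through p r" by blast
  qed
  let ?G = "\<lambda>(p :: int \<times> int, l :: (int \<times> int) set). (F p)\<^sup>2"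
  have "(\<Sum>\<theta>\<in>\<Theta>. \<mu> \<theta>) = (\<Sum>z\<in>(SIGMA \<theta>:\<Theta>. N \<theta>). (F (snd z))\<^sup>2)"
    unfolding \<mu>_def using fin by (subst sum.Sigma) (auto simp: case_prod_beta)
  also have "\<dots> \<le> (\<Sum>x\<in>heavy_flags. ?G x)"
  \<comment> \<open>A vertex q and a direction give the line through q in this direction, which is
    heavy for q; different pairs charge different heavy flags.\<close>
  proof (rule sum_inj_le[where h = "\<lambda>z. (snd z, {x. x - snd z \<in> fst z})"])
    show "inj_on (\<lambda>z. (snd z, {x. x - snd z \<in> fst z})) (SIGMA \<theta>:\<Theta>. N \<theta>)"
    proof (rule inj_onI)
      fix z z' :: "(int \<times> int) set \<times> int \<times> int" assume "(snd z, {x. x - snd z \<in> fst z}) = (snd z', {x. x - snd z' \<in> fst z'})"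
      then have zc: "snd z = snd z' \<and> {x. x - snd z \<in> fst z} = {x. x - snd z' \<in> fst z'}" unfolding prod.inject .
      have e: "snd z = snd z'" "{x. x - snd z \<in> fst z} = {x. x - snd z \<in> fst z'}"
        by (rule conjunct1[OF zc], use conjunct2[OF zc] in \<open>simp only: conjunct1[OF zc]\<close>)
      have "v \<in> fst z \<longleftrightarrow> v \<in> fst z'" for v
      proof -
        have "v + snd z \<in> {x. x - snd z \<in> fst z} \<longleftrightarrow> v + snd z \<in> {x. x - snd z \<in> fst z'}" using e(2) by blast
        then show ?thesis by simp
      qed
      then have "fst z = fst z'" by blast
      then show "z = z'" using e(1) by (rule prod_eqI)
    qed
    show "(\<lambda>z. (snd z, {x. x - snd z \<in> fst z})) ` (SIGMA \<theta>:\<Theta>. N \<theta>) \<subseteq> heavy_flags"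
    proof (rule image_subsetI)
      fix z assume "z \<in> (SIGMA \<theta>:\<Theta>. N \<theta>)"
      then obtain p q s r where z: "(p, q, s, r) \<in> TT (fst z)" "snd z = q" by (auto simp: N_def)
      note m = mem[OF z(1)]
      have "{x. x - snd z \<in> fst z} = line_through p q" unfolding m(4)[symmetric] z(2) by (rule hf(1)[OF m(1)])
      then show "(snd z, {x. x - snd z \<in> fst z}) \<in> heavy_flags"
        using m rects_facts[OF m(1)] z(2) line_through_int_lines[of p q] by (simp add: heavy_flags_def)
    qed
  qed (use heavy_flags_bound(1) in auto)
  also have "\<dots> \<le> 55296 * \<Lambda>" using heavy_flags_bound(2) .
  finally have s1: "(\<Sum>\<theta>\<in>\<Theta>. \<mu> \<theta>) \<le> 55296 * \<Lambda>" .
  have "(\<Sum>\<theta>\<in>\<Theta>. \<mu>' \<theta>) = (\<Sum>z\<in>(SIGMA \<theta>:\<Theta>. N' \<theta>). (F (snd z))\<^sup>2)"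
    unfolding \<mu>'_def using fin by (subst sum.Sigma) (auto simp: case_prod_beta)
  also have "\<dots> \<le> (\<Sum>x\<in>heavy_flags. ?G x)"
  proof (rule sum_inj_le[where h = "\<lambda>z. (snd z, {x. \<forall>v\<in>fst z. idot v (x - snd z) = 0})"])
    show "inj_on (\<lambda>z. (snd z, {x. \<forall>v\<in>fst z. idot v (x - snd z) = 0})) (SIGMA \<theta>:\<Theta>. N' \<theta>)"
    proof (rule inj_onI)
      fix z z' :: "(int \<times> int) set \<times> int \<times> int" assume zz: "z \<in> (SIGMA \<theta>:\<Theta>. N' \<theta>)" "z' \<in> (SIGMA \<theta>:\<Theta>. N' \<theta>)"
        "(snd z, {x. \<forall>v\<in>fst z. idot v (x - snd z) = 0}) = (snd z', {x. \<forall>v\<in>fst z'. idot v (x - snd z') = 0})"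
      have zc: "snd z = snd z' \<and> {x. \<forall>v\<in>fst z. idot v (x - snd z) = 0} = {x. \<forall>v\<in>fst z'. idot v (x - snd z') = 0}"
        using zz(3) unfolding prod.inject .
      have e: "snd z = snd z'" "{x. \<forall>v\<in>fst z. idot v (x - snd z) = 0} = {x. \<forall>v\<in>fst z'. idot v (x - snd z) = 0}"
        by (rule conjunct1[OF zc], use conjunct2[OF zc] in \<open>simp only: conjunct1[OF zc]\<close>)
      obtain p q s r where z: "(p, q, s, r) \<in> TT (fst z)" using zz(1) by (auto simp: N'_def)
      obtain p' q' s' r' where z': "(p', q', s', r') \<in> TT (fst z')" using zz(2) by (auto simp: N'_def)
      define u u' where "u = q - p" and "u' = q' - p'"
      have u: "fst z = direction u" "u \<noteq> 0" "fst z' = direction u'" "u' \<noteq> 0"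
        using mem[OF z] mem[OF z'] rects_facts[OF mem(1)[OF z]] rects_facts[OF mem(1)[OF z']] by (auto simp: u_def u'_def)
      \<comment> \<open>For r the heavy line is the perpendicular one. Testing with u turned by a
        right angle shows that it still determines the direction.\<close>
      have "\<forall>v\<in>fst z. idot v ((snd z + (- snd u, fst u)) - snd z) = 0"
        unfolding u by (auto simp: direction_def icross_def idot_def algebra_simps)
      then have "\<forall>v\<in>fst z'. idot v ((snd z + (- snd u, fst u)) - snd z) = 0" using e(2) by blast
      then have "idot u' (- snd u, fst u) = 0" using u(3) direction_self by auto
      then have "icross u u' = 0" by (simp add: idot_def icross_def algebra_simps)
      then have "fst z = fst z'" using direction_eqI u by simp
      then show "z = z'" using e(1) by (rule prod_eqI)
    qed
    show "(\<lambda>z. (snd z, {x. \<forall>v\<in>fst z. idot v (x - snd z) = 0})) ` (SIGMA \<theta>:\<Theta>. N' \<theta>) \<subseteq> heavy_flags"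
    proof (rule image_subsetI)
      fix z assume "z \<in> (SIGMA \<theta>:\<Theta>. N' \<theta>)"
      then obtain p q s r where z: "(p, q, s, r) \<in> TT (fst z)" "snd z = r" by (auto simp: N'_def)
      note m = mem[OF z(1)]
      have "{x. \<forall>v\<in>fst z. idot v (x - snd z) = 0} = line_through p r" unfolding m(4)[symmetric] z(2) by (rule hf(2)[OF m(1)])
      then show "(snd z, {x. \<forall>v\<in>fst z. idot v (x - snd z) = 0}) \<in> heavy_flags"
        using m rects_facts[OF m(1)] z(2) line_through_int_lines[of p r] by (simp add: heavy_flags_def)
    qed
  qed (use heavy_flags_bound(1) in auto)
  also have "\<dots> \<le> 55296 * \<Lambda>" using heavy_flags_bound(2) .
  finally have s2: "(\<Sum>\<theta>\<in>\<Theta>. \<mu>' \<theta>) \<le> 55296 * \<Lambda>" .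
  have "(\<Sum>Q\<in>T. rect_prod Q) = (\<Sum>\<theta>\<in>\<Theta>. \<Sum>Q\<in>TT \<theta>. rect_prod Q)"
    unfolding TT_def by (rule sum.group[symmetric]) (use finT fin in \<open>auto simp: \<Theta>_def\<close>)
  also have "\<dots> \<le> (\<Sum>\<theta>\<in>\<Theta>. 2 * \<Lambda> * (\<mu> \<theta> + \<mu>' \<theta>))" by (intro sum_mono one)
  also have "\<dots> = 2 * \<Lambda> * ((\<Sum>\<theta>\<in>\<Theta>. \<mu> \<theta>) + (\<Sum>\<theta>\<in>\<Theta>. \<mu>' \<theta>))" by (simp only: sum_distrib_left[symmetric] sum.distrib)
  also have "\<dots> \<le> 2 * \<Lambda> * (55296 * \<Lambda> + 55296 * \<Lambda>)"
    using s1 s2 Lam_nonneg by (intro mult_left_mono add_mono) auto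
  finally show ?thesis unfolding T_def by (simp add: power2_eq_square)
qed

text \<open>The three ways in which two of p, q, r are heavy along the sides at p: q and r, p and q,
  p and r. Their negations are the three conditions of \<open>good_triples\<close>.\<close>

definition "rank_type = (\<lambda>(p, q, s, r). (heavy q (line_through p q) \<and> heavy r (line_through p r)) \<or>
   (heavy p (line_through p q) \<and> heavy q (line_through p q)) \<or> (heavy p (line_through p r) \<and> heavy r (line_through p r)))"

lemma rank_type_sum: "(\<Sum>Q\<in>{Q \<in> rects. rank_type Q}. rect_prod Q) \<le> 663552 * \<Lambda>\<^sup>2"
proof -
  let ?R1 = "{(p, q, s, r) \<in> rects. heavy q (line_through p q) \<and> heavy r (line_through p r)}"
  let ?R2 = "{(p, q, s, r) \<in> rects. heavy p (line_through p q) \<and> heavy q (line_through p q)}"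
  let ?R3 = "{(p, q, s, r) \<in> rects. heavy p (line_through p r) \<and> heavy r (line_through p r)}"
  have fin: "finite ?R1" "finite ?R2" "finite ?R3"
    by (rule finite_subset[OF _ finite_rects], blast)+
  have "(\<Sum>Q\<in>{Q \<in> rects. rank_type Q}. rect_prod Q) \<le> (\<Sum>Q\<in>?R1 \<union> (?R2 \<union> ?R3). rect_prod Q)"
    by (rule sum_mono2) (use fin rect_prod_nonneg in \<open>auto simp: rank_type_def\<close>)
  also have "\<dots> \<le> (\<Sum>Q\<in>?R1. rect_prod Q) + (\<Sum>Q\<in>?R2 \<union> ?R3. rect_prod Q)"
    using fin rect_prod_nonneg by (intro sum_union_le finite_UnI)
  also have "(\<Sum>Q\<in>?R2 \<union> ?R3. rect_prod Q) \<le> (\<Sum>Q\<in>?R2. rect_prod Q) + (\<Sum>Q\<in>?R3. rect_prod Q)"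
    using fin rect_prod_nonneg by (intro sum_union_le)
  also have "(\<Sum>Q\<in>?R3. rect_prod Q) \<le> (\<Sum>Q\<in>?R2. rect_prod Q)"
  proof (rule sum_inj_le[where h = "\<lambda>(p, q, s, r). (p, r, s, q)"])
    show "inj_on (\<lambda>(p, q, s, r). (p, r, s, q)) ?R3" by (auto simp: inj_on_def)
    show "(\<lambda>(p, q, s, r). (p, r, s, q)) ` ?R3 \<subseteq> ?R2"
      by (auto simp: rects_def idot_commute algebra_simps)
  qed (use fin rect_prod_nonneg in \<open>auto simp: rect_prod_def\<close>)
  finally show ?thesis using opposite_heavy_sum adjacent_heavy_sum by linarith
qed

end

section \<open>Lattice length along a line\<close>

definition gcd_dist :: "int \<times> int \<Rightarrow> int \<times> int \<Rightarrow> nat" where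
  "gcd_dist p q = nat (gcd (fst (q - p)) (snd (q - p)))"

lemma gcd_dist_pos: "p \<noteq> q \<Longrightarrow> gcd_dist p q \<ge> 1"
  by (auto simp: gcd_dist_def prod_eq_iff Suc_le_eq) 

lemma gcd_dist_commute: "gcd_dist p q = gcd_dist q p"
  unfolding gcd_dist_def by (metis gcd_neg1_int gcd_neg2_int fst_diff snd_diff minus_diff_eq)

text \<open>Both vectors are multiples of one primitive vector, and the gcd is the absolute value of
  the multiplier. Multiplying the gcd by a coordinate and using the vanishing cross product avoids
  naming that primitive vector.\<close>

lemma collinear_same_gcd:
  fixes u v :: "int \<times> int"
  assumes "icross u v = 0" "u \<noteq> 0" "gcd (fst u) (snd u) = gcd (fst v) (snd v)"
  shows "v = u \<or> v = - u"
proof -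
  define g where "g = gcd (fst u) (snd u)"
  have g: "g > 0" using assms(2) by (auto simp: g_def prod_eq_iff)
  have c: "fst u * snd v = snd u * fst v" using assms(1) by (simp add: icross_def)
  have "\<bar>fst u\<bar> * g = gcd (fst u * fst v) (fst u * snd v)"
    unfolding g_def assms(3) by (simp add: gcd_mult_distrib_int)
  also have "\<dots> = gcd (fst v * fst u) (fst v * snd u)" using c by (simp add: mult.commute)
  also have "\<dots> = \<bar>fst v\<bar> * g" unfolding g_def by (simp add: gcd_mult_distrib_int)
  finally have 1: "\<bar>fst u\<bar> = \<bar>fst v\<bar>" using g by simp
  have "\<bar>snd u\<bar> * g = gcd (snd u * fst v) (snd u * snd v)"
    unfolding g_def assms(3) by (simp add: gcd_mult_distrib_int)
  also have "\<dots> = gcd (snd v * fst u) (snd v * snd u)" using c by (simp add: mult.commute)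
  also have "\<dots> = \<bar>snd v\<bar> * g" unfolding g_def by (simp add: gcd_mult_distrib_int)
  finally have 2: "\<bar>snd u\<bar> = \<bar>snd v\<bar>" using g by simp
  from 1 2 c show ?thesis by (auto simp: abs_eq_iff prod_eq_iff)
qed

text \<open>Each lattice length occurs at most twice on a line through p, once on either side. Sums
  over points become sums over distinct integers.\<close>

lemma sum_gcd_dist_line:
  fixes \<phi> :: "nat \<Rightarrow> real"
  assumes l: "l \<in> int_lines" "p \<in> l" and X: "finite X" "X \<subseteq> l - {p}" and phi: "\<And>n. \<phi> n \<ge> 0"
  shows "(\<Sum>q\<in>X. \<phi> (gcd_dist p q)) \<le> 2 * (\<Sum>n\<in>gcd_dist p ` X. \<phi> n)"
proof -
  have c2: "card {q \<in> X. gcd_dist p q = n} \<le> 2" for n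
  proof (cases "{q \<in> X. gcd_dist p q = n} = {}")
    case False
    then obtain q0 where q0: "q0 \<in> X" "gcd_dist p q0 = n" by blast
    have "{q \<in> X. gcd_dist p q = n} \<subseteq> {q0, p - (q0 - p)}"
    proof
      fix q assume q: "q \<in> {q \<in> X. gcd_dist p q = n}"
      have "l = line_through p q0" using l X q0 by (intro line_through_unique) auto
      moreover have "q \<in> l" using q X by auto
      ultimately have "icross (q0 - p) (q - p) = 0" by (simp add: line_through_def)
      moreover have "q0 - p \<noteq> 0" using q0 X by auto
      moreover have "gcd (fst (q0 - p)) (snd (q0 - p)) = gcd (fst (q - p)) (snd (q - p))"
      proof -
        have "nat (gcd (fst (q0 - p)) (snd (q0 - p))) = nat (gcd (fst (q - p)) (snd (q - p)))"
          using q q0 by (simp add: gcd_dist_def)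
        then show ?thesis by (simp only: eq_nat_nat_iff gcd_ge_0_int)
      qed
      ultimately have "q - p = q0 - p \<or> q - p = - (q0 - p)" by (rule collinear_same_gcd)
      then show "q \<in> {q0, p - (q0 - p)}" by (auto simp: algebra_simps)
    qed
    then have "card {q \<in> X. gcd_dist p q = n} \<le> card {q0, p - (q0 - p)}" by (intro card_mono) auto
    also have "\<dots> \<le> 2" by (simp add: card_insert_if)
    finally show ?thesis .
  qed (metis card.empty zero_le)
  have "(\<Sum>q\<in>X. \<phi> (gcd_dist p q)) = (\<Sum>n\<in>gcd_dist p ` X. \<Sum>q\<in>{q \<in> X. gcd_dist p q = n}. \<phi> (gcd_dist p q))"
    using X(1) by (rule sum.image_gen)
  also have "\<dots> = (\<Sum>n\<in>gcd_dist p ` X. real (card {q \<in> X. gcd_dist p q = n}) * \<phi> n)"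
    by (intro sum.cong refl) simp
  also have "\<dots> \<le> (\<Sum>n\<in>gcd_dist p ` X. 2 * \<phi> n)"
    using c2 phi by (intro sum_mono mult_right_mono) auto
  finally show ?thesis by (simp add: sum_distrib_left)
qed

text \<open>The maximum of N is at least \<open>card N\<close>, so removing it costs at most 1 /
  sqrt (m + 1), which is bounded by the telescoping difference 2 sqrt (m + 1) - 2 sqrt m.\<close>

lemma sum_inv_sqrt_le:
  "finite N \<Longrightarrow> 0 \<notin> N \<Longrightarrow> (\<Sum>n\<in>N. real n powr (- 1 / 2)) \<le> 2 * sqrt (card N)"
proof (induction "card N" arbitrary: N)
  case 0
  then show ?case by simp
next
  case (Suc m)
  define x where "x = Max N"
  have ne: "N \<noteq> {}" using Suc by auto
  have x: "x \<in> N" "\<And>y. y \<in> N \<Longrightarrow> y \<le> x" using Suc.prems ne by (auto simp: x_def)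
  have "N \<subseteq> {1..x}" using x Suc.prems by (auto simp: Suc_le_eq intro: gr0I)
  then have "card N \<le> x" using card_mono[of "{1..x}" N] by simp
  then have xm: "real (Suc m) \<le> real x" using Suc.hyps(2) by simp
  have "(\<Sum>n\<in>N - {x}. real n powr (- 1 / 2)) \<le> 2 * sqrt (card (N - {x}))"
    using Suc.prems Suc.hyps x by (intro Suc.hyps(1)) auto
  also have "card (N - {x}) = m" using Suc x by simp
  finally have IH: "(\<Sum>n\<in>N - {x}. real n powr (- 1 / 2)) \<le> 2 * sqrt m" .
  have "real x powr (- 1 / 2) \<le> real (Suc m) powr (- 1 / 2)" using xm by (intro powr_mono2') auto
  also have "\<dots> = 1 / sqrt (Suc m)" using powr_half_sqrt[of "real (Suc m)"] powr_minus_divide[of "real (Suc m)" "1/2"] by simp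
  also have "\<dots> \<le> 2 * sqrt (Suc m) - 2 * sqrt m"
  proof -
    define s t where "s = sqrt (Suc m)" and "t = sqrt m"
    have st: "s > 0" "t \<ge> 0" "t \<le> s" "s * s = t * t + 1" by (auto simp: s_def t_def)
    have "2 * t * s \<le> t * t + s * s" using sum_squares_bound[of t s] by (simp add: power2_eq_square)
    then have "1 \<le> (2 * s - 2 * t) * s" using st by (simp add: algebra_simps)
    then show ?thesis using st(1) unfolding s_def[symmetric] t_def[symmetric] by (simp add: divide_le_eq)
  qed
  finally have "real x powr (- 1 / 2) \<le> 2 * sqrt (Suc m) - 2 * sqrt m" .
  moreover have "(\<Sum>n\<in>N. real n powr (- 1 / 2)) = real x powr (- 1 / 2) + (\<Sum>n\<in>N - {x}. real n powr (- 1 / 2))"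
    using Suc.prems x by (intro sum.remove) auto
  ultimately show ?case using IH Suc.hyps(2) by simp
qed

section \<open>Summation over levels\<close>

definition decay :: "nat \<Rightarrow> nat \<Rightarrow> real" where
  "decay a c = 2 powr (- \<bar>real a - real c\<bar> / 4)"

text \<open>All gains from unequal levels are converted into this common form.\<close>

lemma decay_row: "(\<Sum>c\<le>J. decay a c) \<le> 16"
proof -
  \<comment> \<open>Below and above the diagonal the row is dominated by a geometric series of ratio
    r, at most 7 / 8, hence by 8.\<close>
  define r :: real where "r = 2 powr (- 1 / 4)"
  have r4: "r ^ 4 = 1 / 2" unfolding r_def by (subst powr_power) (auto simp: powr_minus_divide)
  have r: "0 < r" "r \<le> 7 / 8"
  proof -
    show "0 < r" by (simp add: r_def)
    show "r \<le> 7 / 8"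
    proof (rule ccontr)
      assume "\<not> r \<le> 7 / 8"
      then have "(7 / 8) ^ 4 \<le> r ^ 4" by (intro power_mono) auto
      then show False using r4 by (simp add: power_divide)
    qed
  qed
  have geo: "(\<Sum>k\<le>n. r ^ k) \<le> 8" for n
  proof -
    have "(\<Sum>k\<le>n. r ^ k) = (\<Sum>k<Suc n. r ^ k)" by (simp add: lessThan_Suc_atMost)
    also have "\<dots> = (1 - r ^ Suc n) / (1 - r)"
      using r by (subst sum_gp_strict) auto
    also have "\<dots> \<le> 1 / (1 / 8)" using r by (intro frac_le) auto
    finally show ?thesis by simp
  qed
  have d: "decay a c = r ^ nat \<bar>int a - int c\<bar>" for c
    unfolding r_def decay_def by (subst powr_power) (auto simp: algebra_simps)
  have "(\<Sum>c\<le>J. decay a c) = (\<Sum>c\<in>{..J} \<inter> {..a} \<union> {..J} \<inter> {a<..}. decay a c)"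
    by (intro sum.cong) auto
  also have "\<dots> \<le> (\<Sum>c\<in>{..J} \<inter> {..a}. decay a c) + (\<Sum>c\<in>{..J} \<inter> {a<..}. decay a c)"
    by (intro sum_union_le) (auto simp: decay_def)
  also have "(\<Sum>c\<in>{..J} \<inter> {..a}. decay a c) \<le> (\<Sum>k\<le>a. r ^ k)"
    by (rule sum_inj_le[where h = "\<lambda>c. a - c"]) (use r in \<open>auto simp: inj_on_def d of_nat_diff intro!: arg_cong[where f = "\<lambda>n. r ^ n"]\<close>)
  also have "(\<Sum>c\<in>{..J} \<inter> {a<..}. decay a c) \<le> (\<Sum>k\<le>J. r ^ k)"
    by (rule sum_inj_le[where h = "\<lambda>c. c - a"]) (use r in \<open>auto simp: inj_on_def d of_nat_diff intro!: arg_cong[where f = "\<lambda>n. r ^ n"]\<close>)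
  finally show ?thesis using geo[of a] geo[of J] by linarith
qed

lemma decay_sym: "decay a c = decay c a"
  by (simp add: decay_def abs_minus_commute)

text \<open>The Schur test: a symmetric nonnegative kernel with row sums at most 16 is bounded on l2
  with this norm.\<close>

lemma decay_sum:
  fixes lam :: "nat \<Rightarrow> real"
  shows "(\<Sum>a\<le>J. \<Sum>c\<le>J. lam a * lam c * decay a c) \<le> 16 * (\<Sum>j\<le>J. (lam j)\<^sup>2)"
proof -
  have "(\<Sum>a\<le>J. \<Sum>c\<le>J. lam a * lam c * decay a c) \<le>
      (\<Sum>a\<le>J. \<Sum>c\<le>J. ((lam a)\<^sup>2 * decay a c + (lam c)\<^sup>2 * decay a c) / 2)"
  proof (intro sum_mono)
    fix a c
    have "lam a * lam c \<le> ((lam a)\<^sup>2 + (lam c)\<^sup>2) / 2" using sum_squares_bound[of "lam a" "lam c"] by simp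
    then have "lam a * lam c * decay a c \<le> ((lam a)\<^sup>2 + (lam c)\<^sup>2) / 2 * decay a c"
      by (rule mult_right_mono) (simp add: decay_def)
    then show "lam a * lam c * decay a c \<le> ((lam a)\<^sup>2 * decay a c + (lam c)\<^sup>2 * decay a c) / 2"
      by (simp add: algebra_simps)
  qed
  also have "\<dots> = ((\<Sum>a\<le>J. \<Sum>c\<le>J. (lam a)\<^sup>2 * decay a c) + (\<Sum>a\<le>J. \<Sum>c\<le>J. (lam c)\<^sup>2 * decay a c)) / 2"
    by (simp only: sum.distrib sum_divide_distrib[symmetric])
  also have "(\<Sum>a\<le>J. \<Sum>c\<le>J. (lam c)\<^sup>2 * decay a c) = (\<Sum>a\<le>J. \<Sum>c\<le>J. (lam a)\<^sup>2 * decay a c)"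
    by (subst sum.swap) (simp add: decay_sym)
  also have "((\<Sum>a\<le>J. \<Sum>c\<le>J. (lam a)\<^sup>2 * decay a c) + (\<Sum>a\<le>J. \<Sum>c\<le>J. (lam a)\<^sup>2 * decay a c)) / 2 =
      (\<Sum>a\<le>J. (lam a)\<^sup>2 * (\<Sum>c\<le>J. decay a c))"
  proof -
    have "(x + x) / 2 = x" for x :: real by simp
    then show ?thesis by (simp only: sum_distrib_left)
  qed
  also have "\<dots> \<le> (\<Sum>a\<le>J. (lam a)\<^sup>2 * 16)" by (intro sum_mono mult_left_mono decay_row) auto
  finally show ?thesis by (simp add: sum_distrib_left mult.commute)
qed

lemma quad_sum_pairs:
  fixes K L :: "'a \<Rightarrow> 'a \<Rightarrow> real"
  shows "(\<Sum>a\<in>I. \<Sum>b\<in>I. \<Sum>d\<in>I. \<Sum>c\<in>I. K a c * L b d) = (\<Sum>a\<in>I. \<Sum>c\<in>I. K a c) * (\<Sum>a\<in>I. \<Sum>c\<in>I. L a c)"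
    and "(\<Sum>a\<in>I. \<Sum>b\<in>I. \<Sum>d\<in>I. \<Sum>c\<in>I. K b c * L a d) = (\<Sum>a\<in>I. \<Sum>c\<in>I. K a c) * (\<Sum>a\<in>I. \<Sum>c\<in>I. L a c)"
    and "(\<Sum>a\<in>I. \<Sum>b\<in>I. \<Sum>d\<in>I. \<Sum>c\<in>I. K d c * L a b) = (\<Sum>a\<in>I. \<Sum>c\<in>I. K a c) * (\<Sum>a\<in>I. \<Sum>c\<in>I. L a c)"
proof -
  have in1: "(\<Sum>d\<in>I. \<Sum>c\<in>I. K a c * L b d) = (\<Sum>c\<in>I. K a c) * (\<Sum>d\<in>I. L b d)" for a b
    by (subst sum.swap) (simp only: sum_product)
  show 1: "(\<Sum>a\<in>I. \<Sum>b\<in>I. \<Sum>d\<in>I. \<Sum>c\<in>I. K a c * L b d) = (\<Sum>a\<in>I. \<Sum>c\<in>I. K a c) * (\<Sum>a\<in>I. \<Sum>c\<in>I. L a c)"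
    unfolding in1 by (simp only: sum_product[symmetric])
  show "(\<Sum>a\<in>I. \<Sum>b\<in>I. \<Sum>d\<in>I. \<Sum>c\<in>I. K b c * L a d) = (\<Sum>a\<in>I. \<Sum>c\<in>I. K a c) * (\<Sum>a\<in>I. \<Sum>c\<in>I. L a c)"
    by (subst sum.swap) (rule 1)
  show "(\<Sum>a\<in>I. \<Sum>b\<in>I. \<Sum>d\<in>I. \<Sum>c\<in>I. K d c * L a b) = (\<Sum>a\<in>I. \<Sum>c\<in>I. K a c) * (\<Sum>a\<in>I. \<Sum>c\<in>I. L a c)"
    by (simp only: sum_distrib_left[symmetric] sum_distrib_right[symmetric] mult.commute)
qed

context level_sets begin

definition "max_opposite = (\<lambda>(p, q, s, r). lev p \<le> lev s \<and> lev q \<le> lev s \<and> lev r \<le> lev s)"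
definition "light_rects = {Q \<in> rects. max_opposite Q \<and> \<not> rank_type Q}"
definition "light_rects_at a b d c = {(p, q, s, r) \<in> light_rects. lev p = a \<and> lev q = b \<and> lev r = d \<and> lev s = c}"

lemma finite_light_rects: "finite light_rects" "finite (light_rects_at a b d c)"
  by (rule finite_subset[OF _ finite_rects], auto simp: light_rects_def light_rects_at_def)+

lemma light_rects_at_empty: "\<not> (a \<le> c \<and> b \<le> c \<and> d \<le> c) \<Longrightarrow> light_rects_at a b d c = {}"
  by (auto simp: light_rects_at_def light_rects_def max_opposite_def)

lemma level_decomposition:
  "(\<Sum>Q\<in>light_rects. v Q * rect_prod Q) = (\<Sum>a\<le>J. \<Sum>b\<le>J. \<Sum>d\<le>J. \<Sum>c\<le>J.
     lam a * lam b * lam d * lam c / 2 ^ (a + b + d + c) * (\<Sum>Q\<in>light_rects_at a b d c. v Q))"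
proof -
  define g where "g = (\<lambda>(p, q, s, r). (lev p, lev q, lev r, lev s))"
  have "(\<Sum>Q\<in>light_rects. v Q * rect_prod Q) = (\<Sum>y\<in>{..J} \<times> {..J} \<times> {..J} \<times> {..J}. \<Sum>Q\<in>{Q \<in> light_rects. g Q = y}. v Q * rect_prod Q)"
    by (rule sum.group[symmetric]) (use finite_light_rects lev_le in \<open>auto simp: g_def light_rects_def rects_def\<close>)
  also have "\<dots> = (\<Sum>(a, b, d, c)\<in>{..J} \<times> {..J} \<times> {..J} \<times> {..J}.
     lam a * lam b * lam d * lam c / 2 ^ (a + b + d + c) * (\<Sum>Q\<in>light_rects_at a b d c. v Q))"
  proof (intro sum.cong refl)
    fix y :: "nat \<times> nat \<times> nat \<times> nat"
    obtain a b d c where y: "y = (a, b, d, c)" by (metis surj_pair)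
    have e: "{Q \<in> light_rects. g Q = y} = light_rects_at a b d c" by (auto simp: g_def y light_rects_at_def)
    have "(\<Sum>Q\<in>light_rects_at a b d c. v Q * rect_prod Q) =
       (\<Sum>Q\<in>light_rects_at a b d c. lam a * lam b * lam d * lam c / 2 ^ (a + b + d + c) * v Q)"
      by (intro sum.cong refl) (auto simp: light_rects_at_def rect_prod_def F_def power_add mult.commute mult.left_commute)
    then show "(\<Sum>Q\<in>{Q \<in> light_rects. g Q = y}. v Q * rect_prod Q) = (case y of (a, b, d, c) \<Rightarrow>
      lam a * lam b * lam d * lam c / 2 ^ (a + b + d + c) * (\<Sum>Q\<in>light_rects_at a b d c. v Q))"
      unfolding e by (simp add: y sum_distrib_left)
  qed
  finally show ?thesis by (simp only: sum.cartesian_product[symmetric])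
qed

text \<open>The vertex s of the largest level is dropped: it is determined by the other three, and
  excluding \<open>rank_type\<close> makes their triple good.\<close>

lemma light_rects_at_weight_sum:
  fixes w :: "int \<times> int \<Rightarrow> int \<times> int \<Rightarrow> real" and a b d c :: nat
  assumes w: "\<And>p q. w p q \<ge> 0" "\<And>p q. w p q \<le> 1"
    and W: "\<And>p l X i. l \<in> int_lines \<Longrightarrow> p \<in> l \<Longrightarrow> finite X \<Longrightarrow> X \<subseteq> l - {p} \<Longrightarrow> card X < 2 ^ Suc i \<Longrightarrow>
        (\<Sum>q\<in>X. w p q) \<le> \<omega> i"
    and \<omega>: "\<And>i. 0 \<le> \<omega> i" "\<And>i. \<omega> i \<le> 10 * 2 ^ i" "(\<Sum>i<b + 2. \<omega> i / 2 ^ i) \<le> \<kappa>"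
  shows "(\<Sum>(p, q, s, r)\<in>light_rects_at a b d c. w p q) \<le>
    2 * 10 ^ 11 * (2 powr (a + b + d) * (\<kappa> * 2 powr ((a + b + d) / 3) + 2 powr (max a (max b d))))"
proof -
  have "(\<Sum>(p, q, s, r)\<in>light_rects_at a b d c. w p q) \<le> (\<Sum>(p, q, r)\<in>good_triples (lset a) (lset b) (lset d) a b d. w p q)"
  proof (rule sum_inj_le[where h = "\<lambda>(p, q, s, r). (p, q, r)"])
    show "inj_on (\<lambda>(p, q, s, r). (p, q, r)) (light_rects_at a b d c)"
      by (auto simp: inj_on_def light_rects_at_def light_rects_def rects_def)
    show "(\<lambda>(p, q, s, r). (p, q, r)) ` light_rects_at a b d c \<subseteq> good_triples (lset a) (lset b) (lset d) a b d"
    proof (rule image_subsetI)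
      fix Q assume Q: "Q \<in> light_rects_at a b d c"
      obtain p q s r where 1: "Q = (p, q, s, r)" by (metis surj_pair)
      have h: "(p, q, s, r) \<in> rects" "\<not> rank_type (p, q, s, r)" "lev p = a" "lev q = b" "lev r = d"
        using Q 1 by (auto simp: light_rects_at_def light_rects_def)
      note f = rects_facts[OF h(1)]
      have "(p, q, r) \<in> good_triples (lset a) (lset b) (lset d) a b d"
        using h(2) f h(3-5) unfolding good_triples_def right_triples_def rank_type_def heavy_def
        by (simp add: lset_def)
      then show "(case Q of (p, q, s, r) \<Rightarrow> (p, q, r)) \<in> good_triples (lset a) (lset b) (lset d) a b d"
        by (simp add: 1)
    qed
    show "finite (good_triples (lset a) (lset b) (lset d) a b d)"
      using finite_right_triples[OF fin_lset fin_lset fin_lset, of a b d]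
      by (rule finite_subset[rotated]) (auto simp: good_triples_def)
  qed (use w in auto)
  also have "\<dots> \<le> 2 * 10 ^ 11 * (2 powr (a + b + d) * (\<kappa> * 2 powr ((a + b + d) / 3) + 2 powr (max a (max b d))))"
    by (rule good_triples_sum[OF fin_lset fin_lset fin_lset _ _ _ w W \<omega>]) (use card_lev in \<open>auto simp: lset_def\<close>)
  finally show ?thesis .
qed

text \<open>Cauchy-Schwarz over the J + 1 levels. A pair of levels without decay costs this factor,
  so a bound linear in J permits only one such pair.\<close>

lemma sum_lam_sq: "(\<Sum>a\<le>J. \<Sum>c\<le>J. lam a * lam c) \<le> real (J + 1) * \<Lambda>"
proof -
  have "(\<Sum>a\<le>J. \<Sum>c\<le>J. lam a * lam c) = (\<Sum>a\<le>J. lam a)\<^sup>2" by (simp add: sum_product power2_eq_square)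
  also have "\<dots> \<le> (\<Sum>a\<le>J. (lam a)\<^sup>2) * (\<Sum>a\<le>J. 1)"
    using Cauchy_Schwarz_ineq_sum[of lam "\<lambda>_. 1" "{..J}"] by simp
  finally show ?thesis by (simp add: \<Lambda>_def mult.commute)
qed

text \<open>As c is the largest level, (a + b + d) / 3 - c is at most - (c - a) / 3 - |b - d| / 3, a
  gain in both pairs of levels. The second expression gains only in the pair of c with the level
  attaining the maximum.\<close>

lemma powr_level_split:
  assumes "a \<le> c" "b \<le> c" "d \<le> c"
  shows "2 powr ((real a + real b + real d) / 3 - real c) \<le> decay a c * decay b d"
    and "2 powr (real (max a (max b d)) - real c) \<le> decay a c + decay b c + decay d c"
proof -
  show "2 powr ((real a + real b + real d) / 3 - real c) \<le> decay a c * decay b d"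
    unfolding decay_def powr_add[symmetric]
  proof (rule powr_mono)
    have "real a \<le> real c" "real b \<le> real c" "real d \<le> real c" using assms by auto
    then show "(real a + real b + real d) / 3 - real c \<le> - \<bar>real a - real c\<bar> / 4 + - \<bar>real b - real d\<bar> / 4"
    proof -
      have "(x + y + w) / 3 - z \<le> - \<bar>x - z\<bar> / 4 + - \<bar>y - w\<bar> / 4" if "x \<le> z" "y \<le> z" "w \<le> z" for x y w z :: real
      proof (cases "y \<le> w")
        case True
        then have "\<bar>x - z\<bar> = z - x" "\<bar>y - w\<bar> = w - y" using that by auto
        then show ?thesis using that by (simp only:) (simp add: field_simps)
      next
        case False
        then have "\<bar>x - z\<bar> = z - x" "\<bar>y - w\<bar> = y - w" using that by auto
        then show ?thesis using that by (simp only:) (simp add: field_simps)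
      qed
      then show "real a \<le> real c \<Longrightarrow> real b \<le> real c \<Longrightarrow> real d \<le> real c \<Longrightarrow> ?thesis" by blast
    qed
  qed simp
  have x: "2 powr (real x - real c) \<le> decay x c" if "x \<le> c" for x
    unfolding decay_def using that by (intro powr_mono) auto
  have nn: "0 \<le> decay x c" for x by (simp add: decay_def)
  show "2 powr (real (max a (max b d)) - real c) \<le> decay a c + decay b c + decay d c"
    using x[OF assms(1)] x[OF assms(2)] x[OF assms(3)] nn[of a] nn[of b] nn[of d]
    by (auto simp: max_def)
qed

text \<open>Exactly one logarithm is lost in each term. The first has decay in both pairs of levels
  but carries \<kappa>, the number of dyadic scales; the others have no \<kappa> but one pair of
  levels without decay.\<close>

lemma light_rects_sum: "(\<Sum>Q\<in>light_rects. rect_prod Q) \<le> 3 * 10 ^ 14 * (real (J + 1) * \<Lambda>\<^sup>2)"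
proof -
  define \<kappa> where "\<kappa> = 2 * real (J + 2)"
  let ?K = "\<lambda>a c. lam a * lam c * decay a c" and ?L = "\<lambda>a c. lam a * lam c"
  have one: "lam a * lam b * lam d * lam c / 2 ^ (a + b + d + c) * (\<Sum>Q\<in>light_rects_at a b d c. 1) \<le>
     2 * 10 ^ 11 * (\<kappa> * (?K a c * ?K b d) + ?K a c * ?L b d + ?K b c * ?L a d + ?K d c * ?L a b)"
    if "b \<le> J" for a b d c
  proof (cases "a \<le> c \<and> b \<le> c \<and> d \<le> c")
    case False
    have "0 \<le> \<kappa> * (?K a c * ?K b d) + ?K a c * ?L b d + ?K b c * ?L a d + ?K d c * ?L a b"
      using lam_nonneg by (intro add_nonneg_nonneg mult_nonneg_nonneg) (auto simp: \<kappa>_def decay_def)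
    then show ?thesis using light_rects_at_empty[OF False] by simp
  next
    case True
    have "(\<Sum>(p, q, s, r)\<in>light_rects_at a b d c. (\<lambda>_ _. 1 :: real) p q) \<le>
      2 * 10 ^ 11 * (2 powr (a + b + d) * (\<kappa> * 2 powr ((a + b + d) / 3) + 2 powr (max a (max b d))))"
    proof (rule light_rects_at_weight_sum[where \<omega> = "\<lambda>i. 2 * 2 ^ i"])
      show "(\<Sum>q\<in>X. 1 :: real) \<le> 2 * 2 ^ i" if "card X < 2 ^ Suc i" for i and X :: "(int \<times> int) set"
      proof -
        have "real (card X) \<le> real (2 ^ Suc i)" using that by (intro of_nat_mono) simp
        then show ?thesis by simp
      qed
      show "(\<Sum>i<b + 2. 2 * 2 ^ i / 2 ^ i) \<le> \<kappa>" using that by (simp add: \<kappa>_def)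
    qed auto
    then have c: "real (card (light_rects_at a b d c)) \<le>
      2 * 10 ^ 11 * (2 powr (a + b + d) * (\<kappa> * 2 powr ((a + b + d) / 3) + 2 powr (max a (max b d))))"
      by (simp add: case_prod_beta)
    have p: "(2 :: real) ^ (a + b + d + c) = 2 powr (a + b + d) * 2 powr c"
      by (simp only: powr_add[symmetric] powr_realpow[symmetric] zero_less_numeral of_nat_add)
    define l where "l = lam a * lam b * lam d * lam c"
    have l: "l \<ge> 0" using lam_nonneg by (simp add: l_def)
    have "l / 2 ^ (a + b + d + c) * (\<Sum>Q\<in>light_rects_at a b d c. 1) \<le> l / 2 ^ (a + b + d + c) *
       (2 * 10 ^ 11 * (2 powr (a + b + d) * (\<kappa> * 2 powr ((a + b + d) / 3) + 2 powr (max a (max b d)))))"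
      using c l by (intro mult_left_mono) auto
    also have "\<dots> = 2 * 10 ^ 11 * (l * (\<kappa> * 2 powr ((real a + real b + real d) / 3 - real c) + 2 powr (real (max a (max b d)) - real c)))"
      unfolding p powr_diff by (simp add: field_simps)
    also have "\<dots> \<le> 2 * 10 ^ 11 * (l * (\<kappa> * (decay a c * decay b d) + (decay a c + decay b c + decay d c)))"
      using True l by (intro mult_left_mono add_mono powr_level_split) (auto simp: \<kappa>_def)
    finally show ?thesis unfolding l_def by (simp add: algebra_simps)
  qed
  have "(\<Sum>Q\<in>light_rects. rect_prod Q) = (\<Sum>Q\<in>light_rects. 1 * rect_prod Q)" by simp
  also have "\<dots> = (\<Sum>a\<le>J. \<Sum>b\<le>J. \<Sum>d\<le>J. \<Sum>c\<le>J. lam a * lam b * lam d * lam c / 2 ^ (a + b + d + c) * (\<Sum>Q\<in>light_rects_at a b d c. 1))"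
    by (rule level_decomposition)
  also have "\<dots> \<le> (\<Sum>a\<le>J. \<Sum>b\<le>J. \<Sum>d\<le>J. \<Sum>c\<le>J. 2 * 10 ^ 11 * (\<kappa> * (?K a c * ?K b d) + ?K a c * ?L b d + ?K b c * ?L a d + ?K d c * ?L a b))"
    by (intro sum_mono one) auto
  also have "\<dots> = 2 * 10 ^ 11 * (\<kappa> * (\<Sum>a\<le>J. \<Sum>b\<le>J. \<Sum>d\<le>J. \<Sum>c\<le>J. ?K a c * ?K b d) +
     (\<Sum>a\<le>J. \<Sum>b\<le>J. \<Sum>d\<le>J. \<Sum>c\<le>J. ?K a c * ?L b d) + (\<Sum>a\<le>J. \<Sum>b\<le>J. \<Sum>d\<le>J. \<Sum>c\<le>J. ?K b c * ?L a d)
     + (\<Sum>a\<le>J. \<Sum>b\<le>J. \<Sum>d\<le>J. \<Sum>c\<le>J. ?K d c * ?L a b))"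
    by (simp only: sum_distrib_left[symmetric] sum.distrib)
  also have "\<dots> = 2 * 10 ^ 11 * (\<kappa> * ((\<Sum>a\<le>J. \<Sum>c\<le>J. ?K a c) * (\<Sum>a\<le>J. \<Sum>c\<le>J. ?K a c)) +
     (\<Sum>a\<le>J. \<Sum>c\<le>J. ?K a c) * (\<Sum>a\<le>J. \<Sum>c\<le>J. ?L a c) + (\<Sum>a\<le>J. \<Sum>c\<le>J. ?K a c) * (\<Sum>a\<le>J. \<Sum>c\<le>J. ?L a c)
     + (\<Sum>a\<le>J. \<Sum>c\<le>J. ?K a c) * (\<Sum>a\<le>J. \<Sum>c\<le>J. ?L a c))"
    unfolding quad_sum_pairs(1)[of ?K ?K] quad_sum_pairs(1)[of ?K ?L] quad_sum_pairs(2)[of ?K ?L] quad_sum_pairs(3)[of ?K ?L] ..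
  also have "\<dots> \<le> 2 * 10 ^ 11 * (\<kappa> * ((16 * \<Lambda>) * (16 * \<Lambda>)) + (16 * \<Lambda>) * (real (J + 1) * \<Lambda>) +
     (16 * \<Lambda>) * (real (J + 1) * \<Lambda>) + (16 * \<Lambda>) * (real (J + 1) * \<Lambda>))"
    using decay_sum[of lam J] sum_lam_sq lam_nonneg Lam_nonneg unfolding \<Lambda>_def[symmetric]
    by (intro mult_left_mono add_mono mult_mono sum_nonneg mult_nonneg_nonneg) (auto simp: \<kappa>_def decay_def)
  also have "\<dots> = 2 * 10 ^ 11 * ((256 * \<kappa> + 48 * real (J + 1)) * \<Lambda>\<^sup>2)"
    by (simp add: algebra_simps power2_eq_square)
  also have "\<dots> \<le> 2 * 10 ^ 11 * ((1500 * real (J + 1)) * \<Lambda>\<^sup>2)"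
    by (intro mult_left_mono mult_right_mono) (auto simp: \<kappa>_def)
  also have "\<dots> = 3 * 10 ^ 14 * (real (J + 1) * \<Lambda>\<^sup>2)" by (simp add: algebra_simps)
  finally show ?thesis .
qed

end

section \<open>Rectangles weighted by the inverse lattice length\<close>

definition zeta32 :: real where
  "zeta32 = (\<Sum>n. real n powr (- 3 / 2))"

lemma sum_zeta32_le: "finite N \<Longrightarrow> (\<Sum>n\<in>N. real n powr (- 3 / 2)) \<le> zeta32"
  unfolding zeta32_def by (intro sum_le_suminf) (auto simp: summable_real_powr_iff)

lemma zeta32_nonneg: "zeta32 \<ge> 0"
  using sum_zeta32_le[of "{}"] by simp

text \<open>The exponent 3/2 makes the sum converge uniformly in the number of points. Since
  \<open>0 powr (- 3 / 2)\<close> is 0, \<open>zeta32\<close> is the Riemann zeta function at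
  3/2.\<close>

lemma sum_gcd_dist_three_halves:
  assumes "l \<in> int_lines" "p \<in> l" "finite X" "X \<subseteq> l - {p}"
  shows "(\<Sum>q\<in>X. real (gcd_dist p q) powr (- 3 / 2)) \<le> 2 * zeta32"
  using sum_gcd_dist_line[OF assms, of "\<lambda>n. real n powr (- 3 / 2)"] sum_zeta32_le[of "gcd_dist p ` X"] assms(3) by simp

lemma sum_gcd_dist_half:
  assumes "l \<in> int_lines" "p \<in> l" "finite X" "X \<subseteq> l - {p}" "card X < 2 ^ Suc i"
  shows "(\<Sum>q\<in>X. real (gcd_dist p q) powr (- 1 / 2)) \<le> 4 * sqrt (2 ^ Suc i)"
proof -
  have "0 \<notin> gcd_dist p ` X" using gcd_dist_pos[of p] assms(4) by force
  then have "(\<Sum>n\<in>gcd_dist p ` X. real n powr (- 1 / 2)) \<le> 2 * sqrt (card (gcd_dist p ` X))"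
    using assms(3) by (intro sum_inv_sqrt_le) auto
  also have "\<dots> \<le> 2 * sqrt (2 ^ Suc i)"
  proof -
    have "card (gcd_dist p ` X) \<le> 2 ^ Suc i" using card_image_le[OF assms(3), of "gcd_dist p"] assms(5) by linarith
    then have "real (card (gcd_dist p ` X)) \<le> real (2 ^ Suc i)" by (rule of_nat_mono)
    then show ?thesis by simp
  qed
  finally show ?thesis using sum_gcd_dist_line[OF assms(1-4), of "\<lambda>n. real n powr (- 1 / 2)"] by simp
qed

text \<open>Checks the conditions of \<open>good_triples_sum\<close> for these weights. Relative to
  plain counting they gain 2 powr (- i / 2) at scale i, so \<kappa> becomes the absolute constant
  24.\<close>

lemma half_weights:
  "4 * sqrt (2 ^ Suc i) \<le> 10 * 2 ^ i"
  "(\<Sum>i<n. 4 * sqrt (2 ^ Suc i) / 2 ^ i) \<le> 24"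
proof -
  have "2 * y \<le> (2 * y)\<^sup>2" if "1 \<le> y" for y :: real using that by (simp add: power2_eq_square)
  from this[of "2 ^ i"] have "(2 :: real) ^ Suc i \<le> (2 * 2 ^ i)\<^sup>2" by simp
  then have "sqrt (2 ^ Suc i) \<le> 2 * 2 ^ i" by (rule real_le_lsqrt[rotated]) simp
  moreover have "(0 :: real) \<le> 2 ^ i" by simp
  ultimately show "4 * sqrt (2 ^ Suc i) \<le> 10 * 2 ^ i" by linarith
  define r :: real where "r = 1 / sqrt 2"
  have s2: "4 / 3 \<le> sqrt 2" "sqrt 2 \<le> 3 / 2"
    by (rule real_le_rsqrt, simp add: power2_eq_square) (rule real_le_lsqrt, auto simp: power2_eq_square)
  have r: "0 < r" "r \<le> 3 / 4" using s2 by (auto simp: r_def field_simps)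
  have e: "4 * sqrt (2 ^ Suc i) / 2 ^ i = 4 * sqrt 2 * r ^ i" for i
  proof -
    have "(2 :: real) ^ i = sqrt 2 ^ i * sqrt 2 ^ i" by (simp add: power_mult_distrib[symmetric])
    then show ?thesis by (simp add: real_sqrt_mult real_sqrt_power r_def power_divide)
  qed
  have "(\<Sum>i<n. 4 * sqrt (2 ^ Suc i) / 2 ^ i) = 4 * sqrt 2 * (\<Sum>i<n. r ^ i)"
    unfolding e by (simp only: sum_distrib_left)
  also have "(\<Sum>i<n. r ^ i) = (1 - r ^ n) / (1 - r)" using r by (subst sum_gp_strict) auto
  also have "\<dots> \<le> 1 / (1 / 4)" using r by (intro frac_le) auto
  finally have "(\<Sum>i<n. 4 * sqrt (2 ^ Suc i) / 2 ^ i) \<le> 4 * sqrt 2 * 4" by simp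
  then show "(\<Sum>i<n. 4 * sqrt (2 ^ Suc i) / 2 ^ i) \<le> 24" using s2 by simp
qed

text \<open>The absolute value t measures the imbalance between the sides p r and q s. The level
  attaining the maximum is paired with c; the difference of the two remaining levels is at most t
  plus the distance of this pair, so half of the exponent pays for each pair.\<close>

lemma powr_level_split_opposite:
  assumes "a \<le> c" "b \<le> c" "d \<le> c"
  shows "2 powr ((real (max a (max b d)) - real c - \<bar>real a + real d - real b - real c\<bar>) / 2) \<le>
    decay a c * decay b d + decay b c * decay a d + decay d c * decay a b"
proof -
  have r: "real a \<le> real c" "real b \<le> real c" "real d \<le> real c" using assms by auto
  have nn: "0 \<le> decay x y * decay z w" for x y z w by (simp add: decay_def)
  have abs_bound: "(x - z - t) / 2 \<le> - \<bar>x - z\<bar> / 4 + - \<bar>y - w\<bar> / 4"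
    if "x \<le> z" "\<bar>y - w\<bar> \<le> t + (z - x)" "0 \<le> t" for x y z w t :: real
    using that by (simp add: abs_of_nonpos field_simps)
  let ?t = "\<bar>real a + real d - real b - real c\<bar>"
  consider "max a (max b d) = a" | "max a (max b d) = b" | "max a (max b d) = d" by linarith
  then show ?thesis
  proof cases
    case 1
    have "2 powr ((real a - real c - ?t) / 2) \<le> decay a c * decay b d"
      unfolding decay_def powr_add[symmetric] using r by (intro powr_mono abs_bound) auto
    then show ?thesis unfolding 1 using nn[of b c a d] nn[of d c a b] by linarith
  next
    case 2
    have "2 powr ((real b - real c - ?t) / 2) \<le> decay b c * decay a d"
      unfolding decay_def powr_add[symmetric] using r by (intro powr_mono abs_bound) auto
    then show ?thesis unfolding 2 using nn[of a c b d] nn[of d c a b] by linarith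
  next
    case 3
    have "2 powr ((real d - real c - ?t) / 2) \<le> decay d c * decay a b"
      unfolding decay_def powr_add[symmetric] using r by (intro powr_mono abs_bound) auto
    then show ?thesis unfolding 3 using nn[of a c b d] nn[of b c a d] by linarith
  qed
qed

definition gcd_side :: "(int \<times> int) \<times> (int \<times> int) \<times> (int \<times> int) \<times> (int \<times> int) \<Rightarrow> real" where
  "gcd_side = (\<lambda>(p, q, s, r). real (gcd_dist p q))"

context level_sets begin

lemma card_lset: "real (card (lset j)) \<le> 4 * 4 ^ j"
  using of_nat_mono[OF card_lev[of j], where 'a = real] by (simp add: lset_def)

text \<open>With the side p r fixed, q runs over the perpendicular through p and the weights sum to
  at most 2 * \<open>zeta32\<close>. The same holds for the opposite side q s, with p running; hence
  two bounds, one in the levels of either side.\<close>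

lemma light_rects_at_gcd_three_halves:
  "(\<Sum>(p, q, s, r)\<in>light_rects_at a b d c. real (gcd_dist p q) powr (- 3 / 2)) \<le> 32 * zeta32 * 4 ^ (a + d)"
  "(\<Sum>(p, q, s, r)\<in>light_rects_at a b d c. real (gcd_dist p q) powr (- 3 / 2)) \<le> 32 * zeta32 * 4 ^ (b + c)"
proof -
  have mem: "(p, q, s, r) \<in> rects" "lev p = a" "lev q = b" "lev r = d" "lev s = c"
    if "(p, q, s, r) \<in> light_rects_at a b d c" for p q s r using that by (auto simp: light_rects_at_def light_rects_def)
  let ?v = "\<lambda>(p, q, s, r). real (gcd_dist p q) powr (- 3 / 2)"
  have card2: "real (card (lset i \<times> lset j)) * (2 * zeta32) \<le> 32 * zeta32 * 4 ^ (i + j)" for i j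
  proof -
    have "real (card (lset i)) * real (card (lset j)) \<le> (4 * 4 ^ i) * (4 * 4 ^ j)"
      by (intro mult_mono card_lset) auto
    then have "real (card (lset i)) * real (card (lset j)) * (2 * zeta32) \<le> (4 * 4 ^ i) * (4 * 4 ^ j) * (2 * zeta32)"
      using zeta32_nonneg by (intro mult_right_mono) auto
    then show ?thesis by (simp add: card_cartesian_product power_add algebra_simps)
  qed
  have "(\<Sum>Q\<in>light_rects_at a b d c. ?v Q) \<le> real (card (lset a \<times> lset d)) * (2 * zeta32)"
  proof (rule sum_by_fibers[where g = "\<lambda>(p, q, s, r). (p, r)"])
    show "(\<lambda>(p, q, s, r). (p, r)) ` light_rects_at a b d c \<subseteq> lset a \<times> lset d"
    proof (rule image_subsetI)
      fix Q assume Q: "Q \<in> light_rects_at a b d c"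
      obtain p q s r where 1: "Q = (p, q, s, r)" by (metis surj_pair)
      note m = mem[OF Q[unfolded 1]]
      show "(case Q of (p, q, s, r) \<Rightarrow> (p, r)) \<in> lset a \<times> lset d"
        using rects_facts[OF m(1)] m unfolding 1 by (simp add: lset_def)
    qed
    fix y assume "y \<in> lset a \<times> lset d"
    let ?U = "{Q \<in> light_rects_at a b d c. (\<lambda>(p, q, s, r). (p, r)) Q = y}"
    show "(\<Sum>Q\<in>?U. ?v Q) \<le> 2 * zeta32"
    proof (cases "?U = {}")
      case True
      show ?thesis unfolding True using zeta32_nonneg by simp
    next
      case False
      then obtain p q0 s0 r where t0: "(p, q0, s0, r) \<in> light_rects_at a b d c" "y = (p, r)" by auto
      note f0 = rects_facts[OF mem(1)[OF t0(1)]]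
      let ?h = "\<lambda>(p :: int \<times> int, q :: int \<times> int, s :: int \<times> int, r :: int \<times> int). q"
      have U: "\<exists>q s. Q = (p, q, s, r) \<and> (p, q, s, r) \<in> rects" if QU: "Q \<in> ?U" for Q
      proof -
        obtain p' q s r' where 1: "Q = (p', q, s, r')" by (metis surj_pair)
        have "(p', q, s, r') \<in> light_rects_at a b d c" "p' = p" "r' = r" using QU t0(2) 1 by auto
        then show ?thesis using mem(1)[of p' q s r'] 1 by blast
      qed
      have "(\<Sum>Q\<in>?U. ?v Q) \<le> (\<Sum>q\<in>?h ` ?U. real (gcd_dist p q) powr (- 3 / 2))"
      proof (rule sum_inj_le[where h = ?h])
        show "inj_on ?h ?U"
        proof (rule inj_onI)
          fix Q Q' assume Q: "Q \<in> ?U" "Q' \<in> ?U" "?h Q = ?h Q'"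
          obtain q s where 1: "Q = (p, q, s, r)" "(p, q, s, r) \<in> rects" using U[OF Q(1)] by blast
          obtain q' s' where 2: "Q' = (p, q', s', r)" "(p, q', s', r) \<in> rects" using U[OF Q(2)] by blast
          show "Q = Q'" using 1 2 Q(3) rects_facts(8)[OF 1(2)] rects_facts(8)[OF 2(2)] by simp
        qed
        fix Q assume "Q \<in> ?U"
        from U[OF this] show "?v Q = real (gcd_dist p (?h Q)) powr (- 3 / 2)" by auto
      qed (use finite_light_rects in auto)
      also have "\<dots> \<le> 2 * zeta32"
      proof (rule sum_gcd_dist_three_halves)
        show "line_through p q0 \<in> int_lines" using f0 by (intro line_through_int_lines) auto
        show "?h ` ?U \<subseteq> line_through p q0 - {p}"
        proof (rule image_subsetI)
          fix Q assume "Q \<in> ?U"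
          then obtain q s where 1: "Q = (p, q, s, r)" "(p, q, s, r) \<in> rects" using U by blast
          note f = rects_facts[OF 1(2)]
          have "q \<in> line_through p q0" using perp_collinear[of r p q0 q] f f0 by (simp add: idot_commute)
          then show "?h Q \<in> line_through p q0 - {p}" using f 1 by simp
        qed
      qed (use finite_light_rects in auto)
      finally show ?thesis .
    qed
  qed (use finite_light_rects fin_lset in auto)
  then show "(\<Sum>Q\<in>light_rects_at a b d c. ?v Q) \<le> 32 * zeta32 * 4 ^ (a + d)" using card2[of a d] by linarith
  have "(\<Sum>Q\<in>light_rects_at a b d c. ?v Q) \<le> real (card (lset b \<times> lset c)) * (2 * zeta32)"
  proof (rule sum_by_fibers[where g = "\<lambda>(p, q, s, r). (q, s)"])
    show "(\<lambda>(p, q, s, r). (q, s)) ` light_rects_at a b d c \<subseteq> lset b \<times> lset c"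
    proof (rule image_subsetI)
      fix Q assume Q: "Q \<in> light_rects_at a b d c"
      obtain p q s r where 1: "Q = (p, q, s, r)" by (metis surj_pair)
      note m = mem[OF Q[unfolded 1]]
      show "(case Q of (p, q, s, r) \<Rightarrow> (q, s)) \<in> lset b \<times> lset c"
        using rects_facts[OF m(1)] m unfolding 1 by (simp add: lset_def)
    qed
    fix y assume "y \<in> lset b \<times> lset c"
    let ?U = "{Q \<in> light_rects_at a b d c. (\<lambda>(p, q, s, r). (q, s)) Q = y}"
    show "(\<Sum>Q\<in>?U. ?v Q) \<le> 2 * zeta32"
    proof (cases "?U = {}")
      case True
      show ?thesis unfolding True using zeta32_nonneg by simp
    next
      case False
      then obtain p0 q s r0 where t0: "(p0, q, s, r0) \<in> light_rects_at a b d c" "y = (q, s)" by auto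
      note f0 = rects_facts[OF mem(1)[OF t0(1)]]
      let ?h = "\<lambda>(p :: int \<times> int, q :: int \<times> int, s :: int \<times> int, r :: int \<times> int). p"
      have U: "\<exists>p r. Q = (p, q, s, r) \<and> (p, q, s, r) \<in> rects" if QU: "Q \<in> ?U" for Q
      proof -
        obtain p q' s' r where 1: "Q = (p, q', s', r)" by (metis surj_pair)
        have "(p, q', s', r) \<in> light_rects_at a b d c" "q' = q" "s' = s" using QU t0(2) 1 by auto
        then show ?thesis using mem(1)[of p q' s' r] 1 by blast
      qed
      have "(\<Sum>Q\<in>?U. ?v Q) \<le> (\<Sum>p\<in>?h ` ?U. real (gcd_dist q p) powr (- 3 / 2))"
      proof (rule sum_inj_le[where h = ?h])
        show "inj_on ?h ?U"
        proof (rule inj_onI)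
          fix Q Q' assume Q: "Q \<in> ?U" "Q' \<in> ?U" "?h Q = ?h Q'"
          obtain p r where 1: "Q = (p, q, s, r)" "(p, q, s, r) \<in> rects" using U[OF Q(1)] by blast
          obtain p' r' where 2: "Q' = (p', q, s, r')" "(p', q, s, r') \<in> rects" using U[OF Q(2)] by blast
          show "Q = Q'" using 1 2 Q(3) rects_facts(8)[OF 1(2)] rects_facts(8)[OF 2(2)] by simp
        qed
        fix Q assume "Q \<in> ?U"
        from U[OF this] show "?v Q = real (gcd_dist q (?h Q)) powr (- 3 / 2)" by (auto simp: gcd_dist_commute)
      qed (use finite_light_rects in auto)
      also have "\<dots> \<le> 2 * zeta32"
      proof (rule sum_gcd_dist_three_halves)
        show "line_through q p0 \<in> int_lines" using f0 by (intro line_through_int_lines) auto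
        show "?h ` ?U \<subseteq> line_through q p0 - {q}"
        proof (rule image_subsetI)
          fix Q assume "Q \<in> ?U"
          then obtain p r where 1: "Q = (p, q, s, r)" "(p, q, s, r) \<in> rects" using U by blast
          note f = rects_facts[OF 1(2)]
          have neg: "idot (s - q) (x - q) = - idot (q - x) (s - q)" for x by (simp add: idot_def algebra_simps)
          have "p \<in> line_through q p0"
            by (rule perp_collinear[of s]) (use f f0 neg in auto)
          then show "?h Q \<in> line_through q p0 - {q}" using f 1 by auto
        qed
      qed (use finite_light_rects in auto)
      finally show ?thesis .
    qed
  qed (use finite_light_rects fin_lset in auto)
  then show "(\<Sum>Q\<in>light_rects_at a b d c. ?v Q) \<le> 32 * zeta32 * 4 ^ (b + c)" using card2[of b c] by linarith
qed

text \<open>Writing \<open>1 / g = g powr (- 1 / 4) * g powr (- 3 / 4)\<close> and using Cauchy-Schwarz removes the logarithm: the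
  first factor gains over the dyadic scales, the second one forces the levels on opposite sides to match.\<close>

lemma light_rects_at_inverse_gcd:
  assumes "a \<le> c" "b \<le> c" "d \<le> c"
  shows "(\<Sum>Q\<in>light_rects_at a b d c. 1 / gcd_side Q) / 2 ^ (a + b + d + c) \<le>
    sqrt (16 * 10 ^ 13 * zeta32) * (decay a c * decay b d + decay b c * decay a d + decay d c * decay a b)"
proof -
  let ?R = "light_rects_at a b d c" and ?m = "real (max a (max b d))" and ?\<Delta> = "\<bar>real a + real d - real b - real c\<bar>"
  have g1: "gcd_side Q \<ge> 1" if "Q \<in> ?R" for Q
  proof -
    obtain p q s r where 1: "Q = (p, q, s, r)" by (metis surj_pair)
    then have "(p, q, s, r) \<in> rects" using that by (auto simp: light_rects_at_def light_rects_def)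
    from rects_facts(5)[OF this] have "gcd_dist p q \<ge> 1" by (intro gcd_dist_pos) auto
    then show ?thesis by (simp add: gcd_side_def 1)
  qed
  have sq: "(x powr (- 1 / 4))\<^sup>2 = x powr (- 1 / 2)" "(x powr (- 3 / 4))\<^sup>2 = x powr (- 3 / 2)" for x :: real
    by (simp_all add: power2_eq_square powr_add[symmetric])
  have "(\<Sum>(p, q, s, r)\<in>?R. real (gcd_dist p q) powr (- 1 / 2)) \<le>
    2 * 10 ^ 11 * (2 powr (a + b + d) * (24 * 2 powr ((a + b + d) / 3) + 2 powr (max a (max b d))))"
  proof (rule light_rects_at_weight_sum[where \<omega> = "\<lambda>i. 4 * sqrt (2 ^ Suc i)"])
    show "real (gcd_dist p q) powr (- 1 / 2) \<le> 1" for p q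
    proof (cases "gcd_dist p q = 0")
      case False
      then have "real (gcd_dist p q) powr (- 1 / 2) \<le> real (gcd_dist p q) powr 0" by (intro powr_mono) auto
      then show ?thesis using False by simp
    qed simp
    show "(\<Sum>i<b + 2. 4 * sqrt (2 ^ Suc i) / 2 ^ i) \<le> 24" by (rule half_weights)
    show "(\<Sum>q\<in>X. real (gcd_dist p q) powr (- 1 / 2)) \<le> 4 * sqrt (2 ^ Suc i)"
      if "l \<in> int_lines" "p \<in> l" "finite X" "X \<subseteq> l - {p}" "card X < 2 ^ Suc i" for p l X i
      using that by (rule sum_gcd_dist_half)
    show "4 * sqrt (2 ^ Suc i) \<le> 10 * 2 ^ i" for i by (rule half_weights)
  qed auto
  \<comment> \<open>The mean (a + b + d) / 3 is at most the maximum, and with bounded \<kappa> both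
    terms merge. The decay given up here is regained from the other Cauchy-Schwarz factor.\<close>
  also have "\<dots> \<le> 2 * 10 ^ 11 * (2 powr (a + b + d) * (24 * 2 powr ?m + 2 powr ?m))"
    by (intro mult_left_mono add_mono powr_mono) auto
  also have "\<dots> = 5 * 10 ^ 12 * 2 powr (real a + real b + real d + ?m)" by (simp add: powr_add)
  also have "(\<Sum>(p, q, s, r)\<in>?R. real (gcd_dist p q) powr (- 1 / 2)) = (\<Sum>Q\<in>?R. (gcd_side Q powr (- 1 / 4))\<^sup>2)"
    by (intro sum.cong refl) (simp only: sq(1), simp add: gcd_side_def case_prod_beta)
  finally have X: "(\<Sum>Q\<in>?R. (gcd_side Q powr (- 1 / 4))\<^sup>2) \<le> 5 * 10 ^ 12 * 2 powr (real a + real b + real d + ?m)" .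
  \<comment> \<open>The smaller of the exponents 2 (a + d) and 2 (b + c) is a + b + c + d minus the
    imbalance \<open>?\<Delta>\<close>.\<close>
  have "(\<Sum>(p, q, s, r)\<in>?R. real (gcd_dist p q) powr (- 3 / 2)) \<le> 32 * zeta32 * 2 powr (real a + real b + real c + real d - ?\<Delta>)"
  proof -
    have e: "(4 :: real) ^ n = 2 powr (2 * real n)" for n by (simp add: powr_powr[symmetric] powr_realpow)
    show ?thesis
    proof (cases "real a + real d \<le> real b + real c")
      case True
      then have "real a + real b + real c + real d - ?\<Delta> = 2 * real (a + d)" by simp
      then show ?thesis using light_rects_at_gcd_three_halves(1)[of a b d c] by (simp add: e)
    next
      case False
      then have "real a + real b + real c + real d - ?\<Delta> = 2 * real (b + c)" by simp
      then show ?thesis using light_rects_at_gcd_three_halves(2)[of a b d c] by (simp add: e)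
    qed
  qed
  also have "(\<Sum>(p, q, s, r)\<in>?R. real (gcd_dist p q) powr (- 3 / 2)) = (\<Sum>Q\<in>?R. (gcd_side Q powr (- 3 / 4))\<^sup>2)"
    by (intro sum.cong refl) (simp only: sq(2), simp add: gcd_side_def case_prod_beta)
  finally have Y: "(\<Sum>Q\<in>?R. (gcd_side Q powr (- 3 / 4))\<^sup>2) \<le> 32 * zeta32 * 2 powr (real a + real b + real c + real d - ?\<Delta>)" .
  have "(\<Sum>Q\<in>?R. 1 / gcd_side Q)\<^sup>2 = (\<Sum>Q\<in>?R. gcd_side Q powr (- 1 / 4) * gcd_side Q powr (- 3 / 4))\<^sup>2"
  proof (intro arg_cong[where f = "\<lambda>x. x\<^sup>2"] sum.cong refl)
    fix Q assume "Q \<in> ?R"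
    then have "gcd_side Q > 0" using g1 by fastforce
    then show "1 / gcd_side Q = gcd_side Q powr (- 1 / 4) * gcd_side Q powr (- 3 / 4)"
      by (simp add: powr_add[symmetric] powr_minus_divide)
  qed
  also have "\<dots> \<le> (\<Sum>Q\<in>?R. (gcd_side Q powr (- 1 / 4))\<^sup>2) * (\<Sum>Q\<in>?R. (gcd_side Q powr (- 3 / 4))\<^sup>2)"
    by (rule Cauchy_Schwarz_ineq_sum)
  also have "\<dots> \<le> (5 * 10 ^ 12 * 2 powr (real a + real b + real d + ?m)) * (32 * zeta32 * 2 powr (real a + real b + real c + real d - ?\<Delta>))"
    by (rule mult_mono[OF X Y]) (auto intro: sum_nonneg)
  also have "\<dots> = 16 * 10 ^ 13 * zeta32 * (2 powr (real a + real b + real d + ?m) * 2 powr (real a + real b + real c + real d - ?\<Delta>))"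
    by simp
  also have "2 powr (real a + real b + real d + ?m) * 2 powr (real a + real b + real c + real d - ?\<Delta>) =
     (2 powr (real a + real b + real c + real d) * 2 powr ((?m - real c - ?\<Delta>) / 2))\<^sup>2"
    unfolding power2_eq_square powr_add[symmetric] by (rule arg_cong[where f = "\<lambda>x. 2 powr x"]) (simp add: field_simps)
  finally have "(\<Sum>Q\<in>?R. 1 / gcd_side Q)\<^sup>2 \<le> (sqrt (16 * 10 ^ 13 * zeta32) * (2 powr (real a + real b + real c + real d) * 2 powr ((?m - real c - ?\<Delta>) / 2)))\<^sup>2"
    using zeta32_nonneg by (simp add: power_mult_distrib)
  then have N: "(\<Sum>Q\<in>?R. 1 / gcd_side Q) \<le> sqrt (16 * 10 ^ 13 * zeta32) * (2 powr (real a + real b + real c + real d) * 2 powr ((?m - real c - ?\<Delta>) / 2))"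
    by (rule power2_le_imp_le) (use zeta32_nonneg in auto)
  have p: "(2 :: real) ^ (a + b + d + c) = 2 powr (real a + real b + real c + real d)"
    by (simp add: powr_realpow[symmetric] algebra_simps)
  have "(\<Sum>Q\<in>?R. 1 / gcd_side Q) / 2 ^ (a + b + d + c) \<le> sqrt (16 * 10 ^ 13 * zeta32) * 2 powr ((?m - real c - ?\<Delta>) / 2)"
    using N unfolding p by (simp add: divide_le_eq algebra_simps)
  also have "\<dots> \<le> sqrt (16 * 10 ^ 13 * zeta32) * (decay a c * decay b d + decay b c * decay a d + decay d c * decay a b)"
    using zeta32_nonneg by (intro mult_left_mono powr_level_split_opposite assms) auto
  finally show ?thesis .
qed

lemma light_rects_sum_inverse_gcd: "(\<Sum>Q\<in>light_rects. 1 / gcd_side Q * rect_prod Q) \<le> 768 * sqrt (16 * 10 ^ 13 * zeta32) * \<Lambda>\<^sup>2"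
proof -
  let ?B = "sqrt (16 * 10 ^ 13 * zeta32)"
  let ?K = "\<lambda>a c. lam a * lam c * decay a c"
  have B: "?B \<ge> 0" using zeta32_nonneg by simp
  have one: "lam a * lam b * lam d * lam c / 2 ^ (a + b + d + c) * (\<Sum>Q\<in>light_rects_at a b d c. 1 / gcd_side Q) \<le>
     ?B * (?K a c * ?K b d + ?K b c * ?K a d + ?K d c * ?K a b)" for a b d c
  proof (cases "a \<le> c \<and> b \<le> c \<and> d \<le> c")
    case False
    have "0 \<le> ?B * (?K a c * ?K b d + ?K b c * ?K a d + ?K d c * ?K a b)"
      using lam_nonneg B by (intro add_nonneg_nonneg mult_nonneg_nonneg) (auto simp: decay_def)
    then show ?thesis using light_rects_at_empty[OF False] by simp
  next
    case True
    define l where "l = lam a * lam b * lam d * lam c"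
    have l: "l \<ge> 0" using lam_nonneg by (simp add: l_def)
    have "l * ((\<Sum>Q\<in>light_rects_at a b d c. 1 / gcd_side Q) / 2 ^ (a + b + d + c)) \<le>
      l * (?B * (decay a c * decay b d + decay b c * decay a d + decay d c * decay a b))"
      using True l by (intro mult_left_mono light_rects_at_inverse_gcd) auto
    then show ?thesis unfolding l_def by (simp add: algebra_simps)
  qed
  have "(\<Sum>Q\<in>light_rects. 1 / gcd_side Q * rect_prod Q) = (\<Sum>a\<le>J. \<Sum>b\<le>J. \<Sum>d\<le>J. \<Sum>c\<le>J. lam a * lam b * lam d * lam c / 2 ^ (a + b + d + c) * (\<Sum>Q\<in>light_rects_at a b d c. 1 / gcd_side Q))"
    by (rule level_decomposition)
  also have "\<dots> \<le> (\<Sum>a\<le>J. \<Sum>b\<le>J. \<Sum>d\<le>J. \<Sum>c\<le>J. ?B * (?K a c * ?K b d + ?K b c * ?K a d + ?K d c * ?K a b))"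
    by (intro sum_mono one)
  also have "\<dots> = ?B * ((\<Sum>a\<le>J. \<Sum>b\<le>J. \<Sum>d\<le>J. \<Sum>c\<le>J. ?K a c * ?K b d) +
     (\<Sum>a\<le>J. \<Sum>b\<le>J. \<Sum>d\<le>J. \<Sum>c\<le>J. ?K b c * ?K a d) + (\<Sum>a\<le>J. \<Sum>b\<le>J. \<Sum>d\<le>J. \<Sum>c\<le>J. ?K d c * ?K a b))"
    by (simp only: sum_distrib_left[symmetric] sum.distrib)
  also have "\<dots> = ?B * (3 * ((\<Sum>a\<le>J. \<Sum>c\<le>J. ?K a c) * (\<Sum>a\<le>J. \<Sum>c\<le>J. ?K a c)))"
    unfolding quad_sum_pairs(1)[of ?K ?K] quad_sum_pairs(2)[of ?K ?K] quad_sum_pairs(3)[of ?K ?K] by simp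
  also have "\<dots> \<le> ?B * (3 * ((16 * \<Lambda>) * (16 * \<Lambda>)))"
    using decay_sum[of lam J] lam_nonneg Lam_nonneg B unfolding \<Lambda>_def[symmetric]
    by (intro mult_left_mono mult_mono sum_nonneg mult_nonneg_nonneg) (auto simp: decay_def)
  finally show ?thesis by (simp add: power2_eq_square algebra_simps)
qed

text \<open>Some cyclic relabelling moves a vertex of largest level to the position s, whence the
  factor 4. An odd rotation exchanges the side p q in the weight with p r; the reflection that swaps
  q and r brings the original weight back.\<close>

lemma rects_rotation:
  fixes h :: "nat \<Rightarrow> real"
  assumes h: "\<And>n. h n \<ge> 0"
  shows "(\<Sum>(p, q, s, r)\<in>rects. h (gcd_dist p q) * rect_prod (p, q, s, r)) \<le>
     4 * (\<Sum>(p, q, s, r)\<in>{Q \<in> rects. max_opposite Q}. h (gcd_dist p q) * rect_prod (p, q, s, r))"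
proof -
  define rot where "rot = (\<lambda>(p :: int \<times> int, q :: int \<times> int, s :: int \<times> int, r :: int \<times> int). (q, s, r, p))"
  define wt where "wt = (\<lambda>(p, q, s, r). h (gcd_dist p q) * rect_prod (p, q, s, r))"
  define wt' where "wt' = (\<lambda>(p, q, s, r). h (gcd_dist p r) * rect_prod (p, q, s, r))"
  let ?X = "{Q \<in> rects. max_opposite Q}"
  have rot: "rot Q \<in> rects" "wt Q = wt' (rot Q)" "wt' Q = wt (rot Q)" if "Q \<in> rects" for Q
  proof -
    obtain p q s r where 1: "Q = (p, q, s, r)" by (metis surj_pair)
    note f = rects_facts[OF that[unfolded 1]]
    have i: "idot (s - q) (p - q) = 0" using f(10) by (simp add: idot_def algebra_simps)
    show "rot Q \<in> rects" using f i by (auto simp: rects_def rot_def 1)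
    have "gcd_dist q s = gcd_dist p r" using f(8) by (simp add: gcd_dist_def)
    then show "wt Q = wt' (rot Q)" "wt' Q = wt (rot Q)"
      by (simp_all add: wt_def wt'_def rot_def 1 rect_prod_def gcd_dist_commute[of p q])
  qed
  have inj: "inj rot" by (auto simp: inj_def rot_def)
  have nn: "0 \<le> wt Q" "0 \<le> wt' Q" for Q using h rect_prod_nonneg by (auto simp: wt_def wt'_def split: prod.splits)
  have finX: "finite ?X" using finite_rects by simp
  have rr: "(rot ^^ k) Q \<in> rects" if "Q \<in> rects" for k Q
    using that by (induction k) (auto intro: rot(1))
  have cover: "max_opposite Q \<or> max_opposite (rot Q) \<or> max_opposite ((rot ^^ 2) Q) \<or> max_opposite ((rot ^^ 3) Q)" for Q
  proof -
    obtain p q s r where 1: "Q = (p, q, s, r)" by (metis surj_pair)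
    show ?thesis unfolding 1 max_opposite_def rot_def by (simp add: eval_nat_numeral) linarith
  qed
  have part: "(\<Sum>Q\<in>{Q \<in> rects. max_opposite ((rot ^^ k) Q)}. g ((rot ^^ k) Q)) \<le> (\<Sum>Q\<in>?X. g Q)"
    if "\<And>Q. 0 \<le> g Q" for g :: "_ \<Rightarrow> real" and k
    by (rule sum_inj_le[where h = "rot ^^ k"]) (use finX rr that inj_fn[OF inj, of k] in \<open>auto intro: inj_on_subset\<close>)
  have sw: "(\<Sum>Q\<in>?X. wt' Q) \<le> (\<Sum>Q\<in>?X. wt Q)"
  proof (rule sum_inj_le[where h = "\<lambda>(p, q, s, r). (p, r, s, q)"])
    show "(\<lambda>(p, q, s, r). (p, r, s, q)) ` ?X \<subseteq> ?X"
      by (auto simp: rects_def max_opposite_def idot_commute algebra_simps)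
    show "wt' Q = wt (case Q of (p, q, s, r) \<Rightarrow> (p, r, s, q))" for Q
      by (cases Q) (simp add: wt_def wt'_def rect_prod_def)
  qed (use finX nn(1) in \<open>auto simp: inj_on_def\<close>)
  have fin: "finite {Q \<in> rects. max_opposite ((rot ^^ k) Q)}" for k using finite_rects by simp
  have "(\<Sum>Q\<in>rects. wt Q) \<le> (\<Sum>Q\<in>{Q \<in> rects. max_opposite ((rot ^^ 0) Q)} \<union> ({Q \<in> rects. max_opposite ((rot ^^ 1) Q)} \<union>
     ({Q \<in> rects. max_opposite ((rot ^^ 2) Q)} \<union> {Q \<in> rects. max_opposite ((rot ^^ 3) Q)})). wt Q)"
  proof (rule sum_mono2)
    show "rects \<subseteq> {Q \<in> rects. max_opposite ((rot ^^ 0) Q)} \<union> ({Q \<in> rects. max_opposite ((rot ^^ 1) Q)} \<union>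
     ({Q \<in> rects. max_opposite ((rot ^^ 2) Q)} \<union> {Q \<in> rects. max_opposite ((rot ^^ 3) Q)}))"
    proof
      fix Q assume "Q \<in> rects"
      then show "Q \<in> {Q \<in> rects. max_opposite ((rot ^^ 0) Q)} \<union> ({Q \<in> rects. max_opposite ((rot ^^ 1) Q)} \<union>
        ({Q \<in> rects. max_opposite ((rot ^^ 2) Q)} \<union> {Q \<in> rects. max_opposite ((rot ^^ 3) Q)}))"
        using cover[of Q] by simp
    qed
  qed (use finite_rects in \<open>simp_all add: nn\<close>)
  also have "\<dots> \<le> (\<Sum>Q\<in>{Q \<in> rects. max_opposite ((rot ^^ 0) Q)}. wt Q) + ((\<Sum>Q\<in>{Q \<in> rects. max_opposite ((rot ^^ 1) Q)}. wt Q) +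
     ((\<Sum>Q\<in>{Q \<in> rects. max_opposite ((rot ^^ 2) Q)}. wt Q) + (\<Sum>Q\<in>{Q \<in> rects. max_opposite ((rot ^^ 3) Q)}. wt Q)))"
    using fin nn by (intro order_trans[OF sum_union_le] add_mono order_refl finite_UnI)
  also have "(\<Sum>Q\<in>{Q \<in> rects. max_opposite ((rot ^^ 0) Q)}. wt Q) \<le> (\<Sum>Q\<in>?X. wt Q)" by simp
  also have "(\<Sum>Q\<in>{Q \<in> rects. max_opposite ((rot ^^ 1) Q)}. wt Q) = (\<Sum>Q\<in>{Q \<in> rects. max_opposite ((rot ^^ 1) Q)}. wt' ((rot ^^ 1) Q))"
    by (intro sum.cong refl) (simp add: rot(2))
  also have "\<dots> \<le> (\<Sum>Q\<in>?X. wt' Q)" by (rule part) (rule nn)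
  also note sw
  also have "(\<Sum>Q\<in>{Q \<in> rects. max_opposite ((rot ^^ 2) Q)}. wt Q) = (\<Sum>Q\<in>{Q \<in> rects. max_opposite ((rot ^^ 2) Q)}. wt ((rot ^^ 2) Q))"
    by (intro sum.cong refl) (simp add: rot eval_nat_numeral)
  also have "\<dots> \<le> (\<Sum>Q\<in>?X. wt Q)" by (rule part) (rule nn)
  also have "(\<Sum>Q\<in>{Q \<in> rects. max_opposite ((rot ^^ 3) Q)}. wt Q) = (\<Sum>Q\<in>{Q \<in> rects. max_opposite ((rot ^^ 3) Q)}. wt' ((rot ^^ 3) Q))"
    by (intro sum.cong refl) (simp add: rot eval_nat_numeral)
  also have "\<dots> \<le> (\<Sum>Q\<in>?X. wt' Q)" by (rule part) (rule nn)
  also note sw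
  finally show ?thesis by (simp add: wt_def case_prod_beta)
qed

lemma rects_weighted_sum:
  fixes h :: "nat \<Rightarrow> real"
  assumes h: "\<And>n. h n \<ge> 0" "\<And>n. h n \<le> 1"
    and light_rects: "(\<Sum>(p, q, s, r)\<in>light_rects. h (gcd_dist p q) * rect_prod (p, q, s, r)) \<le> B"
  shows "(\<Sum>(p, q, s, r)\<in>rects. h (gcd_dist p q) * rect_prod (p, q, s, r)) \<le> 4 * (663552 * \<Lambda>\<^sup>2 + B)"
proof -
  let ?g = "\<lambda>(p, q, s, r). h (gcd_dist p q) * rect_prod (p, q, s, r)"
  have g: "0 \<le> ?g Q" "?g Q \<le> rect_prod Q" for Q
  proof -
    obtain p q s r where 1: "Q = (p, q, s, r)" by (metis surj_pair)
    show "0 \<le> ?g Q" "?g Q \<le> rect_prod Q" unfolding 1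
      using h rect_prod_nonneg[of "(p, q, s, r)"] by (auto intro: mult_left_le_one_le)
  qed
  have "(\<Sum>Q\<in>{Q \<in> rects. max_opposite Q}. ?g Q) \<le> (\<Sum>Q\<in>{Q \<in> rects. rank_type Q} \<union> light_rects. ?g Q)"
    by (rule sum_mono2) (use finite_rects finite_light_rects g in \<open>auto simp: light_rects_def\<close>)
  also have "\<dots> \<le> (\<Sum>Q\<in>{Q \<in> rects. rank_type Q}. ?g Q) + (\<Sum>Q\<in>light_rects. ?g Q)"
    using finite_rects finite_light_rects g by (intro sum_union_le) auto
  also have "(\<Sum>Q\<in>{Q \<in> rects. rank_type Q}. ?g Q) \<le> (\<Sum>Q\<in>{Q \<in> rects. rank_type Q}. rect_prod Q)" by (intro sum_mono g)
  also note rank_type_sum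
  also note light_rects
  finally show ?thesis using rects_rotation[of h, OF h(1)] by simp
qed

lemma rects_sum: "(\<Sum>Q\<in>rects. rect_prod Q) \<le> 2 * 10 ^ 15 * (real (J + 1) * \<Lambda>\<^sup>2)"
proof -
  have "(\<Sum>(p, q, s, r)\<in>rects. (\<lambda>_. 1) (gcd_dist p q) * rect_prod (p, q, s, r)) \<le> 4 * (663552 * \<Lambda>\<^sup>2 + 3 * 10 ^ 14 * (real (J + 1) * \<Lambda>\<^sup>2))"
    using light_rects_sum by (intro rects_weighted_sum) (auto simp: case_prod_beta)
  then have "(\<Sum>Q\<in>rects. rect_prod Q) \<le> 4 * (663552 * \<Lambda>\<^sup>2 + 3 * 10 ^ 14 * (real (J + 1) * \<Lambda>\<^sup>2))"
  proof -
    have "(\<Sum>(p, q, s, r)\<in>rects. 1 * rect_prod (p, q, s, r)) = (\<Sum>Q\<in>rects. rect_prod Q)"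
      by (intro sum.cong) auto
    then show "?thesis" if "(\<Sum>(p, q, s, r)\<in>rects. (\<lambda>_. 1) (gcd_dist p q) * rect_prod (p, q, s, r)) \<le> 4 * (663552 * \<Lambda>\<^sup>2 + 3 * 10 ^ 14 * (real (J + 1) * \<Lambda>\<^sup>2))"
      using that by simp
  qed
  also have "\<dots> \<le> 4 * (663552 * (real (J + 1) * \<Lambda>\<^sup>2) + 3 * 10 ^ 14 * (real (J + 1) * \<Lambda>\<^sup>2))"
    by (simp add: mult_le_cancel_right1)
  also have "\<dots> = (4 * (663552 + 3 * 10 ^ 14)) * (real (J + 1) * \<Lambda>\<^sup>2)" by (simp only: distrib_left distrib_right mult.assoc)
  also have "\<dots> \<le> 2 * 10 ^ 15 * (real (J + 1) * \<Lambda>\<^sup>2)" by (intro mult_right_mono) auto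
  finally show ?thesis .
qed

lemma rects_sum_inverse_gcd: "(\<Sum>Q\<in>rects. 1 / gcd_side Q * rect_prod Q) \<le> 4 * (663552 + 768 * sqrt (16 * 10 ^ 13 * zeta32)) * \<Lambda>\<^sup>2"
proof -
  have "(\<Sum>(p, q, s, r)\<in>rects. (\<lambda>n. 1 / real n) (gcd_dist p q) * rect_prod (p, q, s, r)) \<le>
      4 * (663552 * \<Lambda>\<^sup>2 + 768 * sqrt (16 * 10 ^ 13 * zeta32) * \<Lambda>\<^sup>2)"
  proof (rule rects_weighted_sum)
    show "1 / real n \<le> 1" for n by (cases "n = 0") auto
  qed (use light_rects_sum_inverse_gcd in \<open>auto simp: case_prod_beta gcd_side_def\<close>)
  then show ?thesis by (simp add: case_prod_beta gcd_side_def algebra_simps)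
qed

end

section \<open>Dyadic levels of an arbitrary function, and the two rectangle sums\<close>

lemma ex_four_power: "n \<ge> 1 \<Longrightarrow> \<exists>j. 4 ^ j \<le> n \<and> n < 4 ^ Suc j" for n :: nat
proof -
  assume "n \<ge> 1"
  then obtain i where i: "2 ^ i \<le> n" "n < 2 ^ Suc i" using ex_dyadic by blast
  define j where "j = i div 2"
  have "(2 :: nat) ^ (2 * j) \<le> 2 ^ i" "(2 :: nat) ^ Suc i \<le> 2 ^ (2 * Suc j)"
    by (rule power_increasing; simp add: j_def)+
  then have "(4 :: nat) ^ j \<le> 2 ^ i" "(2 :: nat) ^ Suc i \<le> 4 ^ Suc j" by (simp_all only: power_mult) simp_all
  then show ?thesis using i by (intro exI[of _ j]) linarith
qed

text \<open>Level \<open>j\<close> consists of the points of rank \<open>4 ^ j, \<dots>, 4 ^ (j + 1) - 1\<close> when \<open>S\<close> is sorted by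
  decreasing \<open>f\<close>, and \<open>lam j / 2 ^ j\<close> is the largest value on it.\<close>

lemma levels_exist:
  fixes f :: "int \<times> int \<Rightarrow> real"
  assumes S: "finite S" "S \<noteq> {}" and f: "\<And>p. f p \<ge> 0"
  shows "\<exists>lev lam J. level_sets S lev lam J \<and> (\<forall>p\<in>S. f p \<le> lam (lev p) / 2 ^ lev p) \<and>
    (\<Sum>j\<le>J. (lam j)\<^sup>2) \<le> 3 * (\<Sum>p\<in>S. (f p)\<^sup>2) \<and> 4 ^ J \<le> card S"
proof -
  obtain ys where ys: "set ys = S" "distinct ys" using finite_distinct_list[OF S(1)] by blast
  define xs where "xs = sort_key (\<lambda>p. - f p) ys"
  have xs: "set xs = S" "distinct xs" "length xs = card S"
    using ys by (auto simp: xs_def distinct_card)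
  define n where "n = card S"
  have n: "n \<ge> 1" using S by (simp add: n_def Suc_le_eq card_gt_0_iff)
  have sorted: "f (xs ! j) \<le> f (xs ! i)" if "i \<le> j" "j < n" for i j
  proof -
    have "sorted (map (\<lambda>p. - f p) xs)" by (simp add: xs_def)
    from sorted_nth_mono[OF this that(1)] show ?thesis using that xs(3) by (simp add: n_def)
  qed
  have "\<forall>p\<in>S. \<exists>i. i < n \<and> xs ! i = p" using xs by (auto simp: in_set_conv_nth n_def)
  from bchoice[OF this] obtain pos where pos: "\<And>p. p \<in> S \<Longrightarrow> pos p < n" "\<And>p. p \<in> S \<Longrightarrow> xs ! pos p = p" by blast
  define l4 :: "nat \<Rightarrow> nat" where "l4 m = (SOME j. 4 ^ j \<le> m \<and> m < 4 ^ Suc j)" for m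
  have l4: "4 ^ l4 m \<le> m" "m < 4 ^ Suc (l4 m)" if "m \<ge> 1" for m
    using someI_ex[OF ex_four_power[OF that]] by (simp_all add: l4_def)
  define lev where "lev p = l4 (Suc (pos p))" for p
  define J where "J = l4 n"
  define lam where "lam j = (if 4 ^ j \<le> n then 2 ^ j * f (xs ! (4 ^ j - 1)) else 0)" for j :: nat
  have lev1: "4 ^ lev p \<le> n" "4 ^ lev p - 1 \<le> pos p" "pos p < 4 ^ Suc (lev p)" if "p \<in> S" for p
    using l4[of "Suc (pos p)"] pos[OF that] by (auto simp: lev_def)
  have lv: "level_sets S lev lam J"
  proof
    show "lev p \<le> J" if "p \<in> S" for p
    proof -
      have "(4 :: nat) ^ lev p < 4 ^ Suc J" using lev1(1)[OF that] l4(2)[OF n] by (simp add: J_def)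
      then have "lev p < Suc J" by (rule power_less_imp_less_exp[rotated]) simp
      then show ?thesis by simp
    qed
    show "card {p \<in> S. lev p = j} \<le> 4 ^ (j + 1)" for j
    proof -
      have "card {p \<in> S. lev p = j} \<le> card {..<(4 :: nat) ^ (j + 1)}"
      proof (rule card_inj_on_le)
        show "inj_on pos {p \<in> S. lev p = j}" by (rule inj_onI) (metis (no_types, lifting) mem_Collect_eq pos(2))
        show "pos ` {p \<in> S. lev p = j} \<subseteq> {..<4 ^ (j + 1)}" using lev1(3) by auto
      qed simp
      then show ?thesis by simp
    qed
  qed (use S f in \<open>auto simp: lam_def\<close>)
  have dom: "f p \<le> lam (lev p) / 2 ^ lev p" if "p \<in> S" for p
    using sorted[OF lev1(2)[OF that] pos(1)[OF that]] pos(2)[OF that] lev1(1)[OF that] by (simp add: lam_def)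
  \<comment> \<open>\<open>lam\<close> uses the largest value on a level, at index 4 ^ j - 1 counted
    from 0. By monotonicity this value is compared with the preceding block of 3 * 4 ^ m entries, at
    a cost of 4 / 3; the factor 2 is a convenient upper bound.\<close>
  have tele: "(\<Sum>j\<le>m. (lam j)\<^sup>2) \<le> (f (xs ! 0))\<^sup>2 + 2 * (\<Sum>i<4 ^ m. (f (xs ! i))\<^sup>2)" if "4 ^ m \<le> n" for m
    using that
  proof (induction m)
    case 0
    then show ?case using n by (simp add: lam_def)
  next
    case (Suc m)
    have le: "4 ^ m \<le> n" using Suc.prems by simp
    define v where "v = (f (xs ! (4 ^ Suc m - 1)))\<^sup>2"
    have "real (card {4 ^ m..<(4 :: nat) ^ Suc m}) * v \<le> (\<Sum>i\<in>{4 ^ m..<(4 :: nat) ^ Suc m}. (f (xs ! i))\<^sup>2)"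
    proof (rule sum_bounded_below)
      fix i assume "i \<in> {4 ^ m..<(4 :: nat) ^ Suc m}"
      then have "f (xs ! (4 ^ Suc m - 1)) \<le> f (xs ! i)" using Suc.prems by (intro sorted) auto
      then show "v \<le> (f (xs ! i))\<^sup>2" unfolding v_def using f by (intro power_mono) auto
    qed
    moreover have "real (card {4 ^ m..<(4 :: nat) ^ Suc m}) * v = 3 * (4 ^ m * v)" by simp
    ultimately have "3 * (4 ^ m * v) \<le> (\<Sum>i\<in>{4 ^ m..<(4 :: nat) ^ Suc m}. (f (xs ! i))\<^sup>2)" by linarith
    moreover have "(lam (Suc m))\<^sup>2 = 4 * (4 ^ m * v)"
      using Suc.prems by (simp add: lam_def v_def power_mult_distrib two_power_sq)
    moreover have "0 \<le> 4 ^ m * v" by (simp add: v_def)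
    moreover have "(\<Sum>i<(4 :: nat) ^ Suc m. (f (xs ! i))\<^sup>2) = (\<Sum>i<4 ^ m. (f (xs ! i))\<^sup>2) + (\<Sum>i\<in>{4 ^ m..<4 ^ Suc m}. (f (xs ! i))\<^sup>2)"
      using sum.atLeastLessThan_concat[of 0 "4 ^ m" "4 ^ Suc m" "\<lambda>i. (f (xs ! i))\<^sup>2"]
      by (simp add: atLeast0LessThan)
    moreover have "(\<Sum>j\<le>Suc m. (lam j)\<^sup>2) = (\<Sum>j\<le>m. (lam j)\<^sup>2) + (lam (Suc m))\<^sup>2" by simp
    ultimately show ?case using Suc.IH[OF le] by linarith
  qed
  have J: "4 ^ J \<le> n" using l4(1)[OF n] by (simp add: J_def)
  have tot: "(\<Sum>i<n. (f (xs ! i))\<^sup>2) = (\<Sum>p\<in>S. (f p)\<^sup>2)"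
  proof -
    have "(\<Sum>p\<in>S. (f p)\<^sup>2) = sum_list (map (\<lambda>p. (f p)\<^sup>2) xs)" using xs by (simp add: sum_list_distinct_conv_sum_set)
    then show ?thesis by (simp add: sum_list_sum_nth n_def xs(3) atLeast0LessThan)
  qed
  have "(\<Sum>i<4 ^ J. (f (xs ! i))\<^sup>2) \<le> (\<Sum>i<n. (f (xs ! i))\<^sup>2)" using J by (intro sum_mono2) auto
  moreover have "(f (xs ! 0))\<^sup>2 \<le> (\<Sum>i<n. (f (xs ! i))\<^sup>2)" using n by (intro member_le_sum) auto
  ultimately have "(\<Sum>j\<le>J. (lam j)\<^sup>2) \<le> 3 * (\<Sum>p\<in>S. (f p)\<^sup>2)" using tele[OF J] tot by linarith
  then show ?thesis using lv dom J by (intro exI[of _ lev] exI[of _ lam] exI[of _ J]) (simp add: n_def)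
qed

text \<open>Equals \<open>rects\<close>, but outside the locale, because the levels depend on
  f.\<close>

definition rect_set :: "(int \<times> int) set \<Rightarrow> ((int \<times> int) \<times> (int \<times> int) \<times> (int \<times> int) \<times> (int \<times> int)) set" where
  "rect_set S = {(p, q, s, r). p \<in> S \<and> q \<in> S \<and> s \<in> S \<and> r \<in> S \<and> q \<noteq> p \<and> r \<noteq> p \<and>
     idot (q - p) (r - p) = 0 \<and> s = q + r - p}"

definition quad_prod :: "('a \<Rightarrow> real) \<Rightarrow> 'a \<times> 'a \<times> 'a \<times> 'a \<Rightarrow> real" where
  "quad_prod f = (\<lambda>(p, q, s, r). f p * f q * f s * f r)"

lemma quad_prod_nonneg: "(\<And>p. f p \<ge> 0) \<Longrightarrow> quad_prod f Q \<ge> 0"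
  by (auto simp: quad_prod_def split: prod.splits)

text \<open>One constant for both rectangle sums. Each summand is 9 times the constant obtained for
  levels, because \<Lambda> is at most 3 times the squared l2 norm and enters squared.\<close>

definition strichartz_const :: real where
  "strichartz_const = 18 * 10 ^ 15 + 36 * (663552 + 768 * sqrt (16 * 10 ^ 13 * zeta32))"

lemma strichartz_const_pos: "strichartz_const \<ge> 18 * 10 ^ 15" "strichartz_const \<ge> 36 * (663552 + 768 * sqrt (16 * 10 ^ 13 * zeta32))"
  using zeta32_nonneg by (auto simp: strichartz_const_def)

lemma rect_set_sums:
  fixes f :: "int \<times> int \<Rightarrow> real"
  assumes S: "finite S" "S \<noteq> {}" and f: "\<And>p. f p \<ge> 0"
  shows "(\<Sum>Q\<in>rect_set S. quad_prod f Q) \<le> strichartz_const * ((ln (real (card S)) + 1) * (\<Sum>p\<in>S. (f p)\<^sup>2)\<^sup>2)"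
    and "(\<Sum>Q\<in>rect_set S. quad_prod f Q / gcd_side Q) \<le> strichartz_const * (\<Sum>p\<in>S. (f p)\<^sup>2)\<^sup>2"
proof -
  obtain lev lam J where L: "level_sets S lev lam J" "\<And>p. p \<in> S \<Longrightarrow> f p \<le> lam (lev p) / 2 ^ lev p"
    "(\<Sum>j\<le>J. (lam j)\<^sup>2) \<le> 3 * (\<Sum>p\<in>S. (f p)\<^sup>2)" "4 ^ J \<le> card S"
    using levels_exist[of S f, OF S f] by blast
  interpret level_sets S lev lam J by (rule L(1))
  let ?N = "\<Sum>p\<in>S. (f p)\<^sup>2"
  have R: "rect_set S = rects" by (simp add: rect_set_def rects_def)
  have le: "quad_prod f Q \<le> rect_prod Q" if "Q \<in> rects" for Q
  proof -
    obtain p q s r where 1: "Q = (p, q, s, r)" by (metis surj_pair)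
    note m = rects_facts[OF that[unfolded 1]]
    show ?thesis unfolding 1 quad_prod_def rect_prod_def 
      by (simp, intro mult_mono mult_nonneg_nonneg f F_nonneg) 
        (use L(2)[OF m(1)] L(2)[OF m(2)] L(2)[OF m(3)] L(2)[OF m(4)] in \<open>simp_all add: F_def\<close>)
  qed
  have "\<Lambda>\<^sup>2 \<le> (3 * ?N)\<^sup>2" using L(3) Lam_nonneg unfolding \<Lambda>_def[symmetric] by (intro power_mono) auto
  then have Lam: "\<Lambda>\<^sup>2 \<le> 9 * ?N\<^sup>2" by (simp add: power_mult_distrib)
  have J: "real J \<le> ln (real (card S))"
  proof -
    have "exp (1 :: real) \<le> 4" using exp_le by simp
    then have "exp (real J) \<le> 4 ^ J" using power_mono[of "exp 1" "4 :: real" J] by (simp add: exp_of_nat_mult[symmetric])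
    also have "\<dots> \<le> real (card S)" using of_nat_mono[OF L(4), where 'a = real] by simp
    finally show ?thesis by (simp add: ln_ge_iff S card_gt_0_iff)
  qed
  have "(\<Sum>Q\<in>rect_set S. quad_prod f Q) \<le> (\<Sum>Q\<in>rects. rect_prod Q)" unfolding R by (intro sum_mono le)
  also have "\<dots> \<le> 2 * 10 ^ 15 * (real (J + 1) * \<Lambda>\<^sup>2)" by (rule rects_sum)
  also have "\<dots> \<le> 2 * 10 ^ 15 * ((ln (real (card S)) + 1) * (9 * ?N\<^sup>2))"
    using J Lam by (intro mult_left_mono mult_mono) auto
  also have "\<dots> = 18 * 10 ^ 15 * ((ln (real (card S)) + 1) * ?N\<^sup>2)" by simp
  also have "\<dots> \<le> strichartz_const * ((ln (real (card S)) + 1) * ?N\<^sup>2)"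
    using J by (intro mult_right_mono strichartz_const_pos) auto
  finally show "(\<Sum>Q\<in>rect_set S. quad_prod f Q) \<le> strichartz_const * ((ln (real (card S)) + 1) * ?N\<^sup>2)" .
  have "(\<Sum>Q\<in>rect_set S. quad_prod f Q / gcd_side Q) \<le> (\<Sum>Q\<in>rects. 1 / gcd_side Q * rect_prod Q)"
    unfolding R using le by (intro sum_mono) (auto simp: gcd_side_def intro!: divide_right_mono)
  also have "\<dots> \<le> 4 * (663552 + 768 * sqrt (16 * 10 ^ 13 * zeta32)) * \<Lambda>\<^sup>2" by (rule rects_sum_inverse_gcd)
  also have "\<dots> \<le> 4 * (663552 + 768 * sqrt (16 * 10 ^ 13 * zeta32)) * (9 * ?N\<^sup>2)"
    using Lam zeta32_nonneg by (intro mult_left_mono) auto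
  also have "\<dots> = 36 * (663552 + 768 * sqrt (16 * 10 ^ 13 * zeta32)) * ?N\<^sup>2" by simp
  also have "\<dots> \<le> strichartz_const * ?N\<^sup>2" by (intro mult_right_mono strichartz_const_pos) auto
  finally show "(\<Sum>Q\<in>rect_set S. quad_prod f Q / gcd_side Q) \<le> strichartz_const * ?N\<^sup>2" .
qed

text \<open>Let G c be the mass of the fibre of \<phi> over c. Replacing G c * G c' by the mean of
  the squares leaves, for each c, the number of admissible c'. These are congruent to c modulo g and
  closer than K, so there are at most 2 K / g + 1; the squares are the diagonal sum.\<close>

lemma near_diagonal_sum:
  fixes \<phi> :: "'a \<Rightarrow> int" and w :: "'a \<Rightarrow> real" and K g :: nat
  assumes X: "finite X" and w: "\<And>p. w p \<ge> 0" and g: "g \<ge> 1"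
    and dvd: "\<And>p r. p \<in> X \<Longrightarrow> r \<in> X \<Longrightarrow> int g dvd \<phi> r - \<phi> p"
  shows "(\<Sum>(p, r)\<in>{(p, r) \<in> X \<times> X. \<bar>\<phi> r - \<phi> p\<bar> < int K}. w p * w r) \<le>
    (2 * real K / real g + 1) * (\<Sum>(p, r)\<in>{(p, r) \<in> X \<times> X. \<phi> r = \<phi> p}. w p * w r)"
proof -
  define I where "I = \<phi> ` X"
  define G where "G c = (\<Sum>p\<in>{p \<in> X. \<phi> p = c}. w p)" for c
  have finI: "finite I" using X by (simp add: I_def)
  have grp: "(\<Sum>(p, r)\<in>{(p, r) \<in> X \<times> X. R (\<phi> p) (\<phi> r)}. w p * w r) = (\<Sum>c\<in>I. \<Sum>c'\<in>I. if R c c' then G c * G c' else 0)" for R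
  proof -
    have "(\<Sum>(p, r)\<in>{(p, r) \<in> X \<times> X. R (\<phi> p) (\<phi> r)}. w p * w r) = (\<Sum>(p, r)\<in>X \<times> X. if R (\<phi> p) (\<phi> r) then w p * w r else 0)"
      using X by (intro sum.mono_neutral_cong_left) (auto split: if_splits)
    also have "\<dots> = (\<Sum>p\<in>X. \<Sum>r\<in>X. if R (\<phi> p) (\<phi> r) then w p * w r else 0)" by (simp add: sum.cartesian_product)
    also have "\<dots> = (\<Sum>p\<in>X. \<Sum>c'\<in>I. \<Sum>r\<in>{r \<in> X. \<phi> r = c'}. if R (\<phi> p) (\<phi> r) then w p * w r else 0)"
      unfolding I_def by (intro sum.cong refl sum.image_gen X)
    also have "\<dots> = (\<Sum>c\<in>I. \<Sum>p\<in>{p \<in> X. \<phi> p = c}. \<Sum>c'\<in>I. \<Sum>r\<in>{r \<in> X. \<phi> r = c'}. if R (\<phi> p) (\<phi> r) then w p * w r else 0)"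
      unfolding I_def by (rule sum.image_gen[OF X])
    also have "\<dots> = (\<Sum>c\<in>I. \<Sum>p\<in>{p \<in> X. \<phi> p = c}. \<Sum>c'\<in>I. if R c c' then w p * G c' else 0)"
    proof (intro sum.cong refl)
      fix c p c' assume "p \<in> {p \<in> X. \<phi> p = c}"
      then have "(\<Sum>r\<in>{r \<in> X. \<phi> r = c'}. if R (\<phi> p) (\<phi> r) then w p * w r else 0) =
         (\<Sum>r\<in>{r \<in> X. \<phi> r = c'}. if R c c' then w p * w r else 0)" by (intro sum.cong) auto
      then show "(\<Sum>r\<in>{r \<in> X. \<phi> r = c'}. if R (\<phi> p) (\<phi> r) then w p * w r else 0) = (if R c c' then w p * G c' else 0)"
        by (simp add: G_def sum_distrib_left)
    qed
    also have "\<dots> = (\<Sum>c\<in>I. \<Sum>c'\<in>I. if R c c' then G c * G c' else 0)"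
    proof (intro sum.cong refl)
      fix c
      have "(\<Sum>p\<in>{p \<in> X. \<phi> p = c}. \<Sum>c'\<in>I. if R c c' then w p * G c' else 0) =
        (\<Sum>c'\<in>I. \<Sum>p\<in>{p \<in> X. \<phi> p = c}. if R c c' then w p * G c' else 0)" by (rule sum.swap)
      moreover have "(\<Sum>p\<in>{p \<in> X. \<phi> p = c}. if R c c' then w p * G c' else 0) = (if R c c' then G c * G c' else 0)" for c'
        by (simp add: G_def[of c] sum_distrib_right)
      ultimately show "(\<Sum>p\<in>{p \<in> X. \<phi> p = c}. \<Sum>c'\<in>I. if R c c' then w p * G c' else 0) = (\<Sum>c'\<in>I. if R c c' then G c * G c' else 0)"
        by simp
    qed
    finally show ?thesis .
  qed
  have G0: "G c \<ge> 0" for c using w by (simp add: G_def sum_nonneg)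
  have cnt: "real (card {c' \<in> I. \<bar>c' - c\<bar> < int K}) \<le> 2 * real K / real g + 1" if "c \<in> I" for c
  proof -
    let ?k = "\<lambda>c'. (c' - c) div int g"
    have eq: "c' = c + int g * ?k c'" if "c' \<in> I" for c'
    proof -
      have "int g dvd c' - c" using that \<open>c \<in> I\<close> dvd by (auto simp: I_def)
      then show ?thesis by simp
    qed
    have "card {c' \<in> I. \<bar>c' - c\<bar> < int K} \<le> card {- int (K div g)..int (K div g)}"
    proof (rule card_inj_on_le[where f = ?k])
      show "inj_on ?k {c' \<in> I. \<bar>c' - c\<bar> < int K}" by (rule inj_onI) (metis (no_types, lifting) eq mem_Collect_eq)
      show "?k ` {c' \<in> I. \<bar>c' - c\<bar> < int K} \<subseteq> {- int (K div g)..int (K div g)}"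
      proof (rule image_subsetI)
        fix c' assume c': "c' \<in> {c' \<in> I. \<bar>c' - c\<bar> < int K}"
        define k where "k = ?k c'"
        have "c' - c = int g * k" using eq[of c'] c' by (simp add: k_def)
        then have "int g * \<bar>k\<bar> \<le> int K" using c' g by (simp add: abs_mult)
        then have "(int g * \<bar>k\<bar>) div int g \<le> int K div int g" using g by (intro zdiv_mono1) auto
        then have "\<bar>k\<bar> \<le> int K div int g" using g by simp
        then show "?k c' \<in> {- int (K div g)..int (K div g)}" unfolding k_def[symmetric] by (auto simp: zdiv_int)
      qed
    qed simp
    also have "\<dots> = 2 * (K div g) + 1" by simp
    finally have "real (card {c' \<in> I. \<bar>c' - c\<bar> < int K}) \<le> real (2 * (K div g) + 1)" by (rule of_nat_mono)
    moreover have "real (K div g) \<le> real K / real g" by (rule of_nat_div_le_of_nat)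
    ultimately show ?thesis by simp
  qed
  have "(\<Sum>c\<in>I. \<Sum>c'\<in>I. if \<bar>c' - c\<bar> < int K then G c * G c' else 0) \<le>
     (\<Sum>c\<in>I. \<Sum>c'\<in>I. if \<bar>c' - c\<bar> < int K then ((G c)\<^sup>2 + (G c')\<^sup>2) / 2 else 0)"
  proof (intro sum_mono)
    fix c c'
    have "G c * G c' \<le> ((G c)\<^sup>2 + (G c')\<^sup>2) / 2" using sum_squares_bound[of "G c" "G c'"] by simp
    then show "(if \<bar>c' - c\<bar> < int K then G c * G c' else 0) \<le> (if \<bar>c' - c\<bar> < int K then ((G c)\<^sup>2 + (G c')\<^sup>2) / 2 else 0)" by simp
  qed
  also have "\<dots> = (\<Sum>c\<in>I. \<Sum>c'\<in>I. (if \<bar>c' - c\<bar> < int K then (G c)\<^sup>2 / 2 else 0) + (if \<bar>c' - c\<bar> < int K then (G c')\<^sup>2 / 2 else 0))"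
    by (intro sum.cong refl) (simp add: add_divide_distrib)
  also have "\<dots> = (\<Sum>c\<in>I. \<Sum>c'\<in>I. (if \<bar>c' - c\<bar> < int K then (G c)\<^sup>2 / 2 else 0)) +
     (\<Sum>c\<in>I. \<Sum>c'\<in>I. (if \<bar>c' - c\<bar> < int K then (G c')\<^sup>2 / 2 else 0))" by (simp only: sum.distrib)
  also have "(\<Sum>c\<in>I. \<Sum>c'\<in>I. (if \<bar>c' - c\<bar> < int K then (G c')\<^sup>2 / 2 else 0)) = (\<Sum>c\<in>I. \<Sum>c'\<in>I. (if \<bar>c' - c\<bar> < int K then (G c)\<^sup>2 / 2 else 0))"
    by (subst sum.swap) (simp add: abs_minus_commute)
  also have "(\<Sum>c\<in>I. \<Sum>c'\<in>I. (if \<bar>c' - c\<bar> < int K then (G c)\<^sup>2 / 2 else 0)) + (\<Sum>c\<in>I. \<Sum>c'\<in>I. (if \<bar>c' - c\<bar> < int K then (G c)\<^sup>2 / 2 else 0))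
     = (\<Sum>c\<in>I. real (card {c' \<in> I. \<bar>c' - c\<bar> < int K}) * (G c)\<^sup>2)"
    unfolding sum.distrib[symmetric] using finI
    by (intro sum.cong refl) (simp add: sum_distrib_left[symmetric] sum.If_cases Int_def)
  also have "\<dots> \<le> (\<Sum>c\<in>I. (2 * real K / real g + 1) * (G c)\<^sup>2)"
    by (intro sum_mono mult_right_mono cnt) auto
  also have "\<dots> = (2 * real K / real g + 1) * (\<Sum>c\<in>I. \<Sum>c'\<in>I. if c' = c then G c * G c' else 0)"
    using finI by (simp add: sum_distrib_left power2_eq_square)
  finally show ?thesis using grp[of "\<lambda>c c'. \<bar>c' - c\<bar> < int K"] grp[of "\<lambda>c c'. c' = c"] by simp
qed

section \<open>Parallelograms with small defect\<close>

definition near_rects :: "(int \<times> int) set \<Rightarrow> nat \<Rightarrow> ((int \<times> int) \<times> (int \<times> int) \<times> (int \<times> int) \<times> (int \<times> int)) set" where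
  "near_rects S K = {(p, q, s, r). p \<in> S \<and> q \<in> S \<and> s \<in> S \<and> r \<in> S \<and> s = q + r - p \<and> \<bar>idot (q - p) (r - p)\<bar> < int K}"

text \<open>For a fixed side vector a = q - p the defect is the difference of the inner products of
  a with r and p, a multiple of the gcd of a. \<open>near_diagonal_sum\<close> with weights f p * f
  (p + a) therefore reduces everything to exact right angles, where both parts of
  \<open>rect_set_sums\<close> apply.\<close>

lemma near_rects_sum:
  fixes f :: "int \<times> int \<Rightarrow> real"
  assumes S: "finite S" "S \<noteq> {}" and f: "\<And>p. f p \<ge> 0" and K: "K \<ge> 1"
  shows "(\<Sum>Q\<in>near_rects S K. quad_prod f Q) \<le>
    3 * strichartz_const * (real K + ln (real (card S)) + 1) * (\<Sum>p\<in>S. (f p)\<^sup>2)\<^sup>2"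
proof -
  define N where "N = (\<Sum>p\<in>S. (f p)\<^sup>2)"
  \<comment> \<open>The degenerate parallelograms, here with q = p and in \<open>V0\<close> with r =
    p, consist of two doubled vertices; their sums are at most the square of the l2 sum.\<close>
  define E where "E = {(p, q, s, r) \<in> near_rects S K. q = p}"
  define U where "U = {(p, q, s, r) \<in> near_rects S K. q \<noteq> p}"
  define V where "V = {(p, q, s, r). p \<in> S \<and> q \<in> S \<and> s \<in> S \<and> r \<in> S \<and> s = q + r - p \<and> q \<noteq> p \<and> idot (q - p) (r - p) = 0}"
  define V0 where "V0 = {(p, q, s, r) \<in> V. r = p}"
  have sub4: "E \<subseteq> S \<times> S \<times> S \<times> S" "U \<subseteq> S \<times> S \<times> S \<times> S" "V \<subseteq> S \<times> S \<times> S \<times> S" "V0 \<subseteq> S \<times> S \<times> S \<times> S"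
    "rect_set S \<subseteq> S \<times> S \<times> S \<times> S"
    by (auto simp: E_def U_def V_def V0_def near_rects_def rect_set_def)
  have fin4: "finite (S \<times> S \<times> S \<times> S)" using S by simp
  note fin = sub4[THEN finite_subset, OF fin4]
  have qn: "0 \<le> quad_prod f Q" for Q by (rule quad_prod_nonneg) (rule f)
  have N0: "0 \<le> N" by (simp add: N_def sum_nonneg)
  have Eb: "(\<Sum>Q\<in>E. quad_prod f Q) \<le> N * N"
    unfolding N_def
    by (rule sum_le_product[where ?m1.0 = "\<lambda>(p, q, s, r). p" and ?m2.0 = "\<lambda>(p, q, s, r). r"])
      (use S in \<open>auto simp: E_def near_rects_def inj_on_def quad_prod_def power2_eq_square\<close>)
  have V0b: "(\<Sum>Q\<in>V0. quad_prod f Q) \<le> N * N"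
    unfolding N_def
    by (rule sum_le_product[where ?m1.0 = "\<lambda>(p, q, s, r). p" and ?m2.0 = "\<lambda>(p, q, s, r). q"])
      (use S in \<open>auto simp: V0_def V_def inj_on_def quad_prod_def power2_eq_square\<close>)
  let ?wt = "\<lambda>Q. (2 * real K / gcd_side Q + 1) * quad_prod f Q"
  have g0: "0 \<le> gcd_side Q" for Q by (simp add: gcd_side_def case_prod_beta)
  have wt0: "0 \<le> ?wt Q" for Q using g0 qn by (intro mult_nonneg_nonneg add_nonneg_nonneg divide_nonneg_nonneg) auto
  define d where "d = (\<lambda>(p :: int \<times> int, q :: int \<times> int, s :: int \<times> int, r :: int \<times> int). q - p)"
  define D where "D = d ` U"
  have finD: "finite D" using fin by (simp add: D_def)
  have one: "(\<Sum>Q\<in>{Q \<in> U. d Q = a}. quad_prod f Q) \<le> (\<Sum>Q\<in>{Q \<in> V. d Q = a}. ?wt Q)" if a: "a \<in> D" for a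
  proof -
    have a0: "a \<noteq> 0" using a by (auto simp: D_def U_def d_def zero_prod_def)
    define X where "X = {p \<in> S. p + a \<in> S}"
    define w where "w p = f p * f (p + a)" for p
    have finX: "finite X" using S by (simp add: X_def)
    have g1: "gcd_dist 0 a \<ge> 1" using a0 by (intro gcd_dist_pos) auto
    have "(\<Sum>Q\<in>{Q \<in> U. d Q = a}. quad_prod f Q) \<le>
        (\<Sum>z\<in>{(p, r) \<in> X \<times> X. \<bar>idot a r - idot a p\<bar> < int K}. (\<lambda>(p, r). w p * w r) z)"
    proof (rule sum_inj_le[where h = "\<lambda>(p, q, s, r). (p, r)"])
      show "inj_on (\<lambda>(p, q, s, r). (p, r)) {Q \<in> U. d Q = a}"
        by (auto simp: inj_on_def U_def near_rects_def d_def)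
      show "finite {(p, r) \<in> X \<times> X. \<bar>idot a r - idot a p\<bar> < int K}"
        by (rule finite_subset[of _ "X \<times> X"]) (use finX in auto)
      have e: "\<exists>p r. Q = (p, p + a, r + a, r) \<and> p \<in> X \<and> r \<in> X \<and> \<bar>idot a (r - p)\<bar> < int K"
        if "Q \<in> {Q \<in> U. d Q = a}" for Q
      proof -
        obtain p q s r where 1: "Q = (p, q, s, r)" by (metis surj_pair)
        have "q = p + a" using that 1 by (auto simp: d_def)
        then show ?thesis using that 1 by (auto simp: U_def near_rects_def X_def algebra_simps)
      qed
      show "(\<lambda>(p, q, s, r). (p, r)) ` {Q \<in> U. d Q = a} \<subseteq> {(p, r) \<in> X \<times> X. \<bar>idot a r - idot a p\<bar> < int K}"
      proof (rule image_subsetI)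
        fix Q assume "Q \<in> {Q \<in> U. d Q = a}"
        from e[OF this] show "(case Q of (p, q, s, r) \<Rightarrow> (p, r)) \<in> {(p, r) \<in> X \<times> X. \<bar>idot a r - idot a p\<bar> < int K}"
          by (auto simp: idot_def algebra_simps)
      qed
      fix Q assume "Q \<in> {Q \<in> U. d Q = a}"
      from e[OF this] show "quad_prod f Q = (case case Q of (p, q, s, r) \<Rightarrow> (p, r) of (p, r) \<Rightarrow> w p * w r)"
        by (auto simp: quad_prod_def w_def)
    qed (auto simp: w_def f)
    also have "\<dots> \<le> (2 * real K / real (gcd_dist 0 a) + 1) * (\<Sum>(p, r)\<in>{(p, r) \<in> X \<times> X. idot a r = idot a p}. w p * w r)"
    proof (rule near_diagonal_sum[OF finX _ g1])
      show "0 \<le> w p" for p using f by (simp add: w_def)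
      show "int (gcd_dist 0 a) dvd idot a r - idot a p" for p r
        by (simp add: gcd_dist_def idot_def)
    qed
    also have "(\<Sum>(p, r)\<in>{(p, r) \<in> X \<times> X. idot a r = idot a p}. w p * w r) \<le> (\<Sum>Q\<in>{Q \<in> V. d Q = a}. quad_prod f Q)"
    proof (rule sum_inj_le[where h = "\<lambda>(p, r). (p, p + a, r + a, r)"])
      show "(\<lambda>(p, r). (p, p + a, r + a, r)) ` {(p, r) \<in> X \<times> X. idot a r = idot a p} \<subseteq> {Q \<in> V. d Q = a}"
        using a0 by (auto simp: V_def X_def d_def idot_def algebra_simps)
      show "finite {Q \<in> V. d Q = a}" using fin by simp
    qed (use qn in \<open>auto simp: inj_on_def quad_prod_def w_def\<close>)
    then have "(2 * real K / real (gcd_dist 0 a) + 1) * (\<Sum>(p, r)\<in>{(p, r) \<in> X \<times> X. idot a r = idot a p}. w p * w r) \<le>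
       (2 * real K / real (gcd_dist 0 a) + 1) * (\<Sum>Q\<in>{Q \<in> V. d Q = a}. quad_prod f Q)"
      by (rule mult_left_mono) simp
    also have "\<dots> = (\<Sum>Q\<in>{Q \<in> V. d Q = a}. ?wt Q)"
      unfolding sum_distrib_left by (intro sum.cong refl) (auto simp: d_def gcd_side_def gcd_dist_def)
    finally show ?thesis .
  qed
  have "(\<Sum>Q\<in>U. quad_prod f Q) = (\<Sum>a\<in>D. \<Sum>Q\<in>{Q \<in> U. d Q = a}. quad_prod f Q)"
    unfolding D_def by (rule sum.image_gen) (rule fin)
  also have "\<dots> \<le> (\<Sum>a\<in>D. \<Sum>Q\<in>{Q \<in> V. d Q = a}. ?wt Q)" by (intro sum_mono one)
  also have "\<dots> = (\<Sum>a\<in>D. \<Sum>Q\<in>{Q \<in> {Q \<in> V. d Q \<in> D}. d Q = a}. ?wt Q)"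
    by (intro sum.cong refl) auto
  also have "\<dots> = (\<Sum>Q\<in>{Q \<in> V. d Q \<in> D}. ?wt Q)"
    by (rule sum.group) (use fin finD in auto)
  also have "\<dots> \<le> (\<Sum>Q\<in>V0 \<union> rect_set S. ?wt Q)"
    by (rule sum_mono2) (use fin wt0 in \<open>auto simp: V0_def V_def rect_set_def\<close>)
  also have "\<dots> \<le> (\<Sum>Q\<in>V0. ?wt Q) + (\<Sum>Q\<in>rect_set S. ?wt Q)"
    using fin wt0 by (intro sum_union_le)
  \<comment> \<open>The crude bound g at least 1 suffices for degenerate rectangles, as their sum
    carries no logarithm.\<close>
  also have "(\<Sum>Q\<in>V0. ?wt Q) \<le> (\<Sum>Q\<in>V0. (2 * real K + 1) * quad_prod f Q)"
  proof (intro sum_mono mult_right_mono qn add_right_mono)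
    fix Q assume "Q \<in> V0"
    then have "gcd_side Q \<ge> 1" by (auto simp: V0_def V_def gcd_side_def dest!: gcd_dist_pos[OF not_sym])
    then show "2 * real K / gcd_side Q \<le> 2 * real K" 
      using mult_left_mono[of 1 "gcd_side Q" "real K"] by (simp add: divide_le_eq)
  qed
  also have "\<dots> \<le> (2 * real K + 1) * (N * N)"
    unfolding sum_distrib_left[symmetric] by (intro mult_left_mono V0b) auto
  also have "(\<Sum>Q\<in>rect_set S. ?wt Q) = 2 * real K * (\<Sum>Q\<in>rect_set S. quad_prod f Q / gcd_side Q) + (\<Sum>Q\<in>rect_set S. quad_prod f Q)"
    by (simp add: sum_distrib_left sum.distrib distrib_right)
  also have "\<dots> \<le> 2 * real K * (strichartz_const * N\<^sup>2) + strichartz_const * ((ln (real (card S)) + 1) * N\<^sup>2)"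
    unfolding N_def by (intro add_mono mult_left_mono rect_set_sums S f) auto
  finally have Ub: "(\<Sum>Q\<in>U. quad_prod f Q) \<le> (2 * real K + 1) * (N * N) +
     (2 * real K * (strichartz_const * N\<^sup>2) + strichartz_const * ((ln (real (card S)) + 1) * N\<^sup>2))" by simp
  have "near_rects S K = E \<union> U" by (auto simp: E_def U_def)
  then have "(\<Sum>Q\<in>near_rects S K. quad_prod f Q) \<le> (\<Sum>Q\<in>E. quad_prod f Q) + (\<Sum>Q\<in>U. quad_prod f Q)"
    using fin qn by (simp add: sum_union_le)
  also have "\<dots> \<le> (2 * real K + 2 + 2 * real K * strichartz_const + strichartz_const * (ln (real (card S)) + 1)) * N\<^sup>2"
    using Eb Ub by (simp add: power2_eq_square algebra_simps)
  also have "\<dots> \<le> (3 * strichartz_const * (real K + ln (real (card S)) + 1)) * N\<^sup>2"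
  proof (rule mult_right_mono)
    have "1 \<le> card S" using S by (simp add: Suc_le_eq card_gt_0_iff)
    then have ln0: "0 \<le> ln (real (card S))" by simp
    have C: "4 \<le> strichartz_const" using strichartz_const_pos(1) by simp
    have "2 * real K + 2 \<le> 4 * real K" using K by simp
    also have "\<dots> \<le> strichartz_const * real K" using C by (intro mult_right_mono) auto
    finally have 1: "2 * real K + 2 \<le> strichartz_const * real K" .
    have "0 \<le> strichartz_const * (ln (real (card S)) + 1)" using C ln0 by (intro mult_nonneg_nonneg) auto
    then show "2 * real K + 2 + 2 * real K * strichartz_const + strichartz_const * (ln (real (card S)) + 1) \<le>
       3 * strichartz_const * (real K + ln (real (card S)) + 1)" using 1 by (simp add: algebra_simps)
  qed simp
  finally show ?thesis unfolding N_def .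
qed

section \<open>Fourier analysis on the torus\<close>

lemma integral_cis_int:
  "integral (cbox 0 (2 * pi)) (\<lambda>t. cis (of_int n * t)) = (if n = 0 then complex_of_real (2 * pi) else 0)"
proof (cases "n = 0")
  case True
  then show ?thesis by (simp add: scaleR_conv_of_real)
next
  case False
  define F where "F z = exp (\<i> * of_int n * z) / (\<i> * of_int n)" for z :: complex
  have d: "(F has_field_derivative exp (\<i> * of_int n * z)) (at z)" for z
    unfolding F_def using False by (auto intro!: derivative_eq_intros)
  have "((\<lambda>t. exp (\<i> * of_int n * of_real t)) has_integral F (of_real (2 * pi)) - F (of_real 0)) {0..2 * pi}"
    by (intro fundamental_theorem_of_calculus has_vector_derivative_real_field DERIV_subset[OF d]) auto
  moreover have "F (of_real (2 * pi)) = F (of_real 0)"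
    using exp_integer_2pi[of "of_int n"] by (simp add: F_def mult_ac)
  ultimately have "((\<lambda>t. exp (\<i> * of_int n * of_real t)) has_integral 0) {0..2 * pi}" by simp
  moreover have "(\<lambda>t. exp (\<i> * of_int n * of_real t)) = (\<lambda>t. cis (of_int n * t))"
    by (simp add: cis_conv_exp mult_ac)
  ultimately show ?thesis using False by (simp add: integral_unique)
qed

lemma continuous_on_cis_comp [continuous_intros]:
  "continuous_on A g \<Longrightarrow> continuous_on A (\<lambda>x. cis (g x))"
  unfolding cis_conv_exp by (intro continuous_intros)

lemma integral_cis_int2:
  "integral torus_box (\<lambda>x. cis (of_int m * fst x + of_int k * snd x)) =
    (if m = 0 \<and> k = 0 then complex_of_real ((2 * pi) ^ 2) else 0)"
proof -
  have "integral torus_box (\<lambda>x. cis (of_int m * fst x + of_int k * snd x)) =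
    integral (cbox 0 (2 * pi)) (\<lambda>x. integral (cbox 0 (2 * pi)) (\<lambda>y. cis (of_int m * fst (x, y) + of_int k * snd (x, y))))"
    unfolding torus_box_def by (rule integral_prod_continuous) (intro continuous_intros)
  also have "\<dots> = integral (cbox 0 (2 * pi)) (\<lambda>x. cis (of_int m * x) * integral (cbox 0 (2 * pi)) (\<lambda>y. cis (of_int k * y)))"
    by (simp only: fst_conv snd_conv cis_mult[symmetric] integral_mult_right)
  also have "\<dots> = integral (cbox 0 (2 * pi)) (\<lambda>x. cis (of_int m * x)) * integral (cbox 0 (2 * pi)) (\<lambda>y. cis (of_int k * y))"
    by (rule integral_mult_left)
  finally show ?thesis unfolding integral_cis_int by (simp add: power2_eq_square)
qed

definition time_box :: "(real \<times> real \<times> real) set" where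
  "time_box = cbox (0, 0, 0) (2 * pi, 2 * pi, 2 * pi)"

lemma integral_cis_int3:
  "integral time_box (\<lambda>p. cis (of_int l * fst p + (of_int m * fst (snd p) + of_int k * snd (snd p)))) =
    (if l = 0 \<and> m = 0 \<and> k = 0 then complex_of_real ((2 * pi) ^ 3) else 0)"
proof -
  have "integral time_box (\<lambda>p. cis (of_int l * fst p + (of_int m * fst (snd p) + of_int k * snd (snd p)))) =
    integral (cbox 0 (2 * pi)) (\<lambda>t. integral (cbox (0, 0) (2 * pi, 2 * pi))
      (\<lambda>x. cis (of_int l * fst (t, x) + (of_int m * fst (snd (t, x)) + of_int k * snd (snd (t, x))))))"
    unfolding time_box_def by (rule integral_prod_continuous) (intro continuous_intros)
  also have "\<dots> = integral (cbox 0 (2 * pi)) (\<lambda>t. cis (of_int l * t) *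
      integral torus_box (\<lambda>x. cis (of_int m * fst x + of_int k * snd x)))"
    unfolding torus_box_def
    by (simp only: fst_conv snd_conv cis_mult[symmetric, of "of_int l * _"] integral_mult_right)
  also have "\<dots> = integral (cbox 0 (2 * pi)) (\<lambda>t. cis (of_int l * t)) *
      integral torus_box (\<lambda>x. cis (of_int m * fst x + of_int k * snd x))"
    by (rule integral_mult_left)
  finally show ?thesis unfolding integral_cis_int integral_cis_int2 by (simp add: power2_eq_square power3_eq_cube)
qed

text \<open>Parseval as an inequality for exponentials whose frequencies \<omega> may repeat: all
  pairs with equal frequency survive and are estimated by absolute values.\<close>

lemma trig_sum_L2_bound:
  fixes \<theta> :: "'b \<Rightarrow> 'a :: euclidean_space \<Rightarrow> real" and z :: "'b \<Rightarrow> complex"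
  assumes A: "finite A" and cont: "\<And>\<alpha>. continuous_on (cbox a b) (\<theta> \<alpha>)"
    and orth: "\<And>\<alpha> \<beta>. \<alpha> \<in> A \<Longrightarrow> \<beta> \<in> A \<Longrightarrow>
      integral (cbox a b) (\<lambda>x. cis (\<theta> \<alpha> x - \<theta> \<beta> x)) = (if \<omega> \<alpha> = \<omega> \<beta> then complex_of_real V else 0)"
    and V: "V \<ge> 0"
  shows "integral (cbox a b) (\<lambda>x. (norm (\<Sum>\<alpha>\<in>A. z \<alpha> * cis (\<theta> \<alpha> x)))\<^sup>2) \<le>
    V * (\<Sum>(\<alpha>, \<beta>)\<in>{(\<alpha>, \<beta>) \<in> A \<times> A. \<omega> \<alpha> = \<omega> \<beta>}. norm (z \<alpha>) * norm (z \<beta>))"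
proof -
  let ?g = "\<lambda>x. \<Sum>\<alpha>\<in>A. \<Sum>\<beta>\<in>A. z \<alpha> * cnj (z \<beta>) * cis (\<theta> \<alpha> x - \<theta> \<beta> x)"
  have e: "(norm (\<Sum>\<alpha>\<in>A. z \<alpha> * cis (\<theta> \<alpha> x)))\<^sup>2 = (Re \<circ> ?g) x" for x
  proof -
    define s where "s = (\<Sum>\<alpha>\<in>A. z \<alpha> * cis (\<theta> \<alpha> x))"
    have "s * cnj s = ?g x"
    proof -
      have c: "cis (u - v) = cis u * cnj (cis v)" for u v by (simp add: cis_cnj cis_mult)
      show ?thesis unfolding s_def cnj_sum sum_product c complex_cnj_mult by (simp only: mult_ac)
    qed
    then have "complex_of_real ((norm s)\<^sup>2) = ?g x" by (simp only: complex_norm_square)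
    then have "Re (complex_of_real ((norm s)\<^sup>2)) = Re (?g x)" by simp
    then show ?thesis by (simp add: s_def)
  qed
  have ci: "continuous_on (cbox a b) (\<lambda>x. z \<alpha> * cnj (z \<beta>) * cis (\<theta> \<alpha> x - \<theta> \<beta> x))" for \<alpha> \<beta>
    by (intro continuous_intros cont)
  have int: "?g integrable_on cbox a b"
    by (intro integrable_sum A integrable_continuous ci)
  have "integral (cbox a b) (\<lambda>x. (norm (\<Sum>\<alpha>\<in>A. z \<alpha> * cis (\<theta> \<alpha> x)))\<^sup>2) = integral (cbox a b) (Re \<circ> ?g)"
    using e by (intro arg_cong[where f = "integral (cbox a b)"] ext)
  also have "\<dots> = Re (integral (cbox a b) ?g)" by (rule integral_linear[OF int bounded_linear_Re])
  also have "integral (cbox a b) ?g = (\<Sum>\<alpha>\<in>A. \<Sum>\<beta>\<in>A. z \<alpha> * cnj (z \<beta>) * (if \<omega> \<alpha> = \<omega> \<beta> then complex_of_real V else 0))"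
  proof -
    have "integral (cbox a b) ?g = (\<Sum>\<alpha>\<in>A. integral (cbox a b) (\<lambda>x. \<Sum>\<beta>\<in>A. z \<alpha> * cnj (z \<beta>) * cis (\<theta> \<alpha> x - \<theta> \<beta> x)))"
      by (intro integral_sum A integrable_sum integrable_continuous ci)
    also have "\<dots> = (\<Sum>\<alpha>\<in>A. \<Sum>\<beta>\<in>A. integral (cbox a b) (\<lambda>x. z \<alpha> * cnj (z \<beta>) * cis (\<theta> \<alpha> x - \<theta> \<beta> x)))"
      by (intro sum.cong refl integral_sum A integrable_continuous ci)
    also have "\<dots> = (\<Sum>\<alpha>\<in>A. \<Sum>\<beta>\<in>A. z \<alpha> * cnj (z \<beta>) * (if \<omega> \<alpha> = \<omega> \<beta> then complex_of_real V else 0))"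
      by (intro sum.cong refl) (simp only: integral_mult_right orth)
    finally show ?thesis .
  qed
  also have "Re (\<Sum>\<alpha>\<in>A. \<Sum>\<beta>\<in>A. z \<alpha> * cnj (z \<beta>) * (if \<omega> \<alpha> = \<omega> \<beta> then complex_of_real V else 0)) \<le>
     norm (\<Sum>\<alpha>\<in>A. \<Sum>\<beta>\<in>A. z \<alpha> * cnj (z \<beta>) * (if \<omega> \<alpha> = \<omega> \<beta> then complex_of_real V else 0))"
    by (rule complex_Re_le_cmod)
  also have "\<dots> \<le> (\<Sum>\<alpha>\<in>A. \<Sum>\<beta>\<in>A. if \<omega> \<alpha> = \<omega> \<beta> then V * (norm (z \<alpha>) * norm (z \<beta>)) else 0)"
    using V by (intro sum_norm_le order_trans[OF norm_sum] sum_mono) (auto simp: norm_mult)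
  also have "\<dots> = (\<Sum>(\<alpha>, \<beta>)\<in>A \<times> A. if \<omega> \<alpha> = \<omega> \<beta> then V * (norm (z \<alpha>) * norm (z \<beta>)) else 0)"
    by (simp add: sum.cartesian_product)
  also have "\<dots> = (\<Sum>(\<alpha>, \<beta>)\<in>{(\<alpha>, \<beta>) \<in> A \<times> A. \<omega> \<alpha> = \<omega> \<beta>}. V * (norm (z \<alpha>) * norm (z \<beta>)))"
    using A by (intro sum.mono_neutral_cong_right) (auto split: if_splits)
  also have "\<dots> = V * (\<Sum>(\<alpha>, \<beta>)\<in>{(\<alpha>, \<beta>) \<in> A \<times> A. \<omega> \<alpha> = \<omega> \<beta>}. norm (z \<alpha>) * norm (z \<beta>))"
    by (simp add: sum_distrib_left case_prod_beta)
  finally show ?thesis .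
qed

lemma set_lint_continuous:
  fixes f :: "'a :: euclidean_space \<Rightarrow> 'b :: euclidean_space"
  assumes "continuous_on (cbox a b) f"
  shows "(LINT x : cbox a b | lebesgue. f x) = integral (cbox a b) f"
  using set_lebesgue_integral_eq_integral(2)[OF absolutely_integrable_continuous[OF assms]] .

lemma set_lint_sum:
  fixes f :: "'i \<Rightarrow> 'a \<Rightarrow> 'b :: {banach, second_countable_topology}"
  assumes "\<And>i. i \<in> I \<Longrightarrow> set_integrable M A (f i)"
  shows "(LINT x : A | M. \<Sum>i\<in>I. f i x) = (\<Sum>i\<in>I. LINT x : A | M. f i x)"
  using assms unfolding set_lebesgue_integral_def set_integrable_def scaleR_sum_right
  by (rule Bochner_Integration.integral_sum)

text \<open>Expands the squared norm of \<phi> - P, which is nonnegative, for the partial Fourier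
  sum P. An upper bound on the norm of P suffices, together with the exact value of the mixed
  term.\<close>

lemma bessel_inequality:
  assumes phi: "in_L2_torus \<phi>" and S: "finite S"
  shows "(2 * pi) ^ 2 * (\<Sum>\<xi>\<in>S. (norm (fourier_coeff \<phi> \<xi>))\<^sup>2) \<le> (LINT x : torus_box | lebesgue. (norm (\<phi> x))\<^sup>2)"
proof -
  define e where "e \<xi> x = cis (of_int (fst \<xi>) * fst x + of_int (snd \<xi>) * snd x)" for \<xi> :: "int \<times> int" and x :: "real \<times> real"
  let ?c = "fourier_coeff \<phi>"
  have ce: "continuous_on A (e \<xi>)" for A \<xi> unfolding e_def by (intro continuous_intros)
  have ebm: "e \<xi> \<in> borel_measurable lebesgue" for \<xi>
    using borel_measurable_continuous_onI[OF ce[of UNIV \<xi>]] by (simp add: measurable_completion)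
  have "continuous_on UNIV (\<lambda>x. cnj (e \<xi> x))" for \<xi> by (intro continuous_intros ce)
  then have cbm: "(\<lambda>x. cnj (e \<xi> x)) \<in> borel_measurable lebesgue" for \<xi>
    using borel_measurable_continuous_onI[of "\<lambda>x. cnj (e \<xi> x)"] by (simp add: measurable_completion)
  have cnje: "cnj (e \<xi> x) = exp (- \<i> * complex_of_real (real_of_int (fst \<xi>) * fst x + real_of_int (snd \<xi>) * snd x))" for \<xi> x
  proof -
    have "cnj (e \<xi> x) = cis (- (of_int (fst \<xi>) * fst x + of_int (snd \<xi>) * snd x))" by (simp add: e_def cis_cnj)
    also have "\<dots> = exp (- \<i> * complex_of_real (real_of_int (fst \<xi>) * fst x + real_of_int (snd \<xi>) * snd x))"
      unfolding cis_conv_exp by (rule arg_cong[where f = exp]) (simp add: algebra_simps)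
    finally show ?thesis .
  qed
  have ee: "e \<xi> x * cnj (e \<xi> x) = 1" for \<xi> x by (simp add: e_def cis_cnj cis_mult)
  have ne: "norm (e \<xi> x) = 1" for \<xi> x by (simp add: e_def)
  have c_def: "(2 * pi) ^ 2 *\<^sub>R ?c \<xi> = (LINT x : torus_box | lebesgue. \<phi> x * cnj (e \<xi> x))" for \<xi>
    unfolding fourier_coeff_def cnje by (simp add: power2_eq_square)
  have intg: "set_integrable lebesgue torus_box (\<lambda>x. (norm (\<phi> x))\<^sup>2)" using phi by (simp add: in_L2_torus_def)
  show ?thesis
  proof (cases "set_borel_measurable lebesgue torus_box \<phi>")
    case False
    \<comment> \<open>\<open>in_L2_torus\<close> speaks of the modulus only, so \<phi> itself may be
      non-measurable. Then its product with a character is not integrable either, as multiplying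
      back would make \<phi> measurable, and the integral takes its default value 0: all
      coefficients vanish.\<close>
    have "?c \<xi> = 0" for \<xi>
    proof -
      have "\<not> set_integrable lebesgue torus_box (\<lambda>x. \<phi> x * cnj (e \<xi> x))"
      proof
        assume "set_integrable lebesgue torus_box (\<lambda>x. \<phi> x * cnj (e \<xi> x))"
        then have "(\<lambda>x. indicator torus_box x *\<^sub>R (\<phi> x * cnj (e \<xi> x))) \<in> borel_measurable lebesgue"
          unfolding set_integrable_def by (rule borel_measurable_integrable)
        then have "(\<lambda>x. (indicator torus_box x *\<^sub>R (\<phi> x * cnj (e \<xi> x))) * e \<xi> x) \<in> borel_measurable lebesgue"
          using ebm by (rule borel_measurable_times)
        also have "(\<lambda>x. (indicator torus_box x *\<^sub>R (\<phi> x * cnj (e \<xi> x))) * e \<xi> x) = (\<lambda>x. indicator torus_box x *\<^sub>R \<phi> x)"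
          using ee by (intro ext) (simp add: mult.assoc mult.commute[of "cnj _"])
        finally show False using False by (simp add: set_borel_measurable_def)
      qed
      then have "(LINT x : torus_box | lebesgue. \<phi> x * cnj (e \<xi> x)) = 0"
        unfolding set_integrable_def set_lebesgue_integral_def by (rule not_integrable_integral_eq)
      then show ?thesis using c_def[of \<xi>] by simp
    qed
    then show ?thesis unfolding set_lebesgue_integral_def by (simp add: integral_nonneg_AE)
  next
    case True
    have bm: "set_borel_measurable lebesgue torus_box (\<lambda>x. \<phi> x * g x)" if "g \<in> borel_measurable lebesgue" for g
    proof -
      have "(\<lambda>x. (indicator torus_box x *\<^sub>R \<phi> x) * g x) \<in> borel_measurable lebesgue"
        using True that unfolding set_borel_measurable_def by (rule borel_measurable_times)
      then show ?thesis unfolding set_borel_measurable_def by simp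
    qed
    have tb: "torus_box = cbox (0, 0) (2 * pi, 2 * pi)" by (simp add: torus_box_def)
    have "set_integrable lebesgue torus_box (\<lambda>x. 1 + (norm (\<phi> x))\<^sup>2)"
      by (intro set_integral_add intg) (simp add: tb absolutely_integrable_continuous)
    then have phi1: "set_integrable lebesgue torus_box (\<lambda>x. \<phi> x * cnj (e \<xi> x))" for \<xi>
    proof (rule set_integrable_bound)
      show "set_borel_measurable lebesgue torus_box (\<lambda>x. \<phi> x * cnj (e \<xi> x))"
        by (intro bm cbm)
      \<comment> \<open>Square integrability gives integrability on the box, which has finite
        measure.\<close>
      have "norm (\<phi> x) \<le> 1 + (norm (\<phi> x))\<^sup>2" for x
        using sum_squares_bound[of 1 "norm (\<phi> x)"] norm_ge_zero[of "\<phi> x"]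
        unfolding one_power2 mult_1_right by linarith
      then show "AE x in lebesgue. x \<in> torus_box \<longrightarrow> norm (\<phi> x * cnj (e \<xi> x)) \<le> norm (1 + (norm (\<phi> x))\<^sup>2)"
        by (simp add: norm_mult ne)
    qed
    define P where "P x = (\<Sum>\<xi>\<in>S. ?c \<xi> * e \<xi> x)" for x
    have cP: "continuous_on A P" for A unfolding P_def by (intro continuous_intros ce)
    have Pint: "set_integrable lebesgue torus_box (\<lambda>x. (norm (P x))\<^sup>2)"
      unfolding tb by (intro absolutely_integrable_continuous continuous_intros cP)
    have PL: "(LINT x : torus_box | lebesgue. (norm (P x))\<^sup>2) \<le> (2 * pi) ^ 2 * (\<Sum>\<xi>\<in>S. (norm (?c \<xi>))\<^sup>2)"
    proof -
      have "(LINT x : torus_box | lebesgue. (norm (P x))\<^sup>2) = integral torus_box (\<lambda>x. (norm (P x))\<^sup>2)"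
        unfolding tb by (intro set_lint_continuous continuous_intros cP)
      also have "\<dots> \<le> (2 * pi) ^ 2 * (\<Sum>(\<alpha>, \<beta>)\<in>{(\<alpha>, \<beta>) \<in> S \<times> S. \<alpha> = \<beta>}. norm (?c \<alpha>) * norm (?c \<beta>))"
        unfolding P_def e_def tb
      proof (rule trig_sum_L2_bound[where \<omega> = "\<lambda>\<alpha>. \<alpha>"])
        show "integral (cbox (0, 0) (2 * pi, 2 * pi)) (\<lambda>x. cis (of_int (fst \<alpha>) * fst x + of_int (snd \<alpha>) * snd x -
            (of_int (fst \<beta>) * fst x + of_int (snd \<beta>) * snd x))) = (if \<alpha> = \<beta> then complex_of_real ((2 * pi) ^ 2) else 0)"
          for \<alpha> \<beta> :: "int \<times> int"
          using integral_cis_int2[of "fst \<alpha> - fst \<beta>" "snd \<alpha> - snd \<beta>"]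
          by (simp add: torus_box_def prod_eq_iff algebra_simps)
      qed (auto intro!: S continuous_intros)
      also have "(\<Sum>(\<alpha>, \<beta>)\<in>{(\<alpha>, \<beta>) \<in> S \<times> S. \<alpha> = \<beta>}. norm (?c \<alpha>) * norm (?c \<beta>)) \<le> (\<Sum>\<xi>\<in>S. (norm (?c \<xi>))\<^sup>2)"
        by (rule sum_inj_le[where h = fst]) (auto simp: inj_on_def S power2_eq_square)
      finally show ?thesis by (simp add: mult_left_mono)
    qed
    have cross_int: "set_integrable lebesgue torus_box (\<lambda>x. \<phi> x * cnj (P x))"
    proof -
      have "set_integrable lebesgue torus_box (\<lambda>x. \<Sum>\<xi>\<in>S. cnj (?c \<xi>) * (\<phi> x * cnj (e \<xi> x)))"
        by (intro absolutely_integrable_sum S set_integrable_mult_right phi1)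
      then show ?thesis by (simp add: P_def sum_distrib_left mult_ac)
    qed
    have cross: "(LINT x : torus_box | lebesgue. \<phi> x * cnj (P x)) = complex_of_real ((2 * pi) ^ 2 * (\<Sum>\<xi>\<in>S. (norm (?c \<xi>))\<^sup>2))"
    proof -
      have "(LINT x : torus_box | lebesgue. \<phi> x * cnj (P x)) = (LINT x : torus_box | lebesgue. \<Sum>\<xi>\<in>S. cnj (?c \<xi>) * (\<phi> x * cnj (e \<xi> x)))"
        by (simp add: P_def sum_distrib_left mult_ac)
      also have "\<dots> = (\<Sum>\<xi>\<in>S. LINT x : torus_box | lebesgue. cnj (?c \<xi>) * (\<phi> x * cnj (e \<xi> x)))"
        by (intro set_lint_sum set_integrable_mult_right phi1)
      also have "\<dots> = (\<Sum>\<xi>\<in>S. cnj (?c \<xi>) * ((2 * pi) ^ 2 *\<^sub>R ?c \<xi>))"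
        by (simp only: set_integral_mult_right c_def)
      also have "\<dots> = (\<Sum>\<xi>\<in>S. complex_of_real ((2 * pi) ^ 2 * (norm (?c \<xi>))\<^sup>2))"
      proof (intro sum.cong refl)
        fix \<xi>
        have "complex_of_real ((norm (?c \<xi>))\<^sup>2) = ?c \<xi> * cnj (?c \<xi>)" by (rule complex_norm_square)
        then show "cnj (?c \<xi>) * ((2 * pi) ^ 2 *\<^sub>R ?c \<xi>) = complex_of_real ((2 * pi) ^ 2 * (norm (?c \<xi>))\<^sup>2)"
          unfolding of_real_mult by (simp add: scaleR_conv_of_real mult_ac)
      qed
      finally show ?thesis by (simp add: sum_distrib_left)
    qed
    have Re_int: "set_integrable lebesgue torus_box (\<lambda>x. Re (\<phi> x * cnj (P x)))"
      using integrable_Re[OF cross_int[unfolded set_integrable_def]] by (simp add: set_integrable_def)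
    have Re_cross: "(LINT x : torus_box | lebesgue. Re (\<phi> x * cnj (P x))) = (2 * pi) ^ 2 * (\<Sum>\<xi>\<in>S. (norm (?c \<xi>))\<^sup>2)"
    proof -
      have "(LINT x : torus_box | lebesgue. Re (\<phi> x * cnj (P x))) = Re (LINT x : torus_box | lebesgue. \<phi> x * cnj (P x))"
        using integral_Re[OF cross_int[unfolded set_integrable_def]] by (simp add: set_lebesgue_integral_def)
      then show ?thesis unfolding cross by simp
    qed
    have "0 \<le> (LINT x : torus_box | lebesgue. (norm (\<phi> x - P x))\<^sup>2)"
      unfolding set_lebesgue_integral_def by (simp add: integral_nonneg_AE)
    also have "\<dots> = (LINT x : torus_box | lebesgue. (norm (\<phi> x))\<^sup>2 + (norm (P x))\<^sup>2 - 2 * Re (\<phi> x * cnj (P x)))"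
    proof -
      have "(norm (u - v))\<^sup>2 = (norm u)\<^sup>2 + (norm v)\<^sup>2 - 2 * Re (u * cnj v)" for u v :: complex
        unfolding cmod_power2 by (simp add: power2_eq_square algebra_simps)
      then show ?thesis by simp
    qed
    also have "\<dots> = (LINT x : torus_box | lebesgue. (norm (\<phi> x))\<^sup>2) + (LINT x : torus_box | lebesgue. (norm (P x))\<^sup>2) -
       2 * (LINT x : torus_box | lebesgue. Re (\<phi> x * cnj (P x)))"
  proof -
      have R2: "set_integrable lebesgue torus_box (\<lambda>x. 2 * Re (\<phi> x * cnj (P x)))"
        by (rule set_integrable_mult_right) (rule Re_int)
      show ?thesis
        unfolding set_integral_diff(2)[OF set_integral_add(1)[OF intg Pint] R2] set_integral_add(2)[OF intg Pint]
          set_integral_mult_right ..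
    qed
    finally show ?thesis using PL unfolding Re_cross by linarith
  qed
qed

section \<open>From the space-time norm to parallelograms\<close>

lemma dirichlet_kernel_lower_bound:
  assumes "0 \<le> t" "t * real K \<le> 1"
  shows "real K / 2 \<le> norm (\<Sum>k<K. cis (real k * t))"
proof -
  have "real K / 2 = (\<Sum>k<K. 1 / 2)" by simp
  also have "\<dots> \<le> (\<Sum>k<K. cos (real k * t))"
  proof (rule sum_mono)
    fix k assume "k \<in> {..<K}"
    then have "real k * t \<le> real K * t" using assms by (intro mult_right_mono) auto
    \<comment> \<open>All angles stay in [0, 1], below pi / 3, where the cosine is at least 1 /
      2.\<close>
    also have "\<dots> \<le> pi / 3" using assms pi_gt3 by (simp add: mult.commute)
    finally have "cos (pi / 3) \<le> cos (real k * t)" using assms by (intro cos_monotone_0_pi_le) auto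
    then show "1 / 2 \<le> cos (real k * t)" by (simp add: cos_60)
  qed
  also have "\<dots> = Re (\<Sum>k<K. cis (real k * t))" by simp
  also have "\<dots> \<le> norm (\<Sum>k<K. cis (real k * t))" by (rule complex_Re_le_cmod)
  finally show ?thesis .
qed

text \<open>The product of kernel and u^2 is a trigonometric sum indexed by (k, \<xi>, \<eta>).
  Equal frequencies of (k, \<xi>, \<eta>) and (k', \<xi>', \<eta>') make \<xi>, \<xi>', \<eta>,
  \<eta>' a parallelogram whose defect is governed by k - k', and k' is forced by the other data.
  This leaves K choices of k, and 4 / K^2 from the kernel becomes 4 / K.\<close>

lemma schrod_L4_le_near_rects:
  assumes S: "finite S" and K: "K \<ge> 1" and T: "0 \<le> T" "T * real K \<le> 1"
  shows "(LINT p : {0..T} \<times> torus_box | lebesgue. (norm (schrod_proj S \<phi> (fst p) (snd p))) ^ 4) \<le>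
    4 * (2 * pi) ^ 3 / real K * (\<Sum>Q\<in>near_rects S K. quad_prod (\<lambda>\<xi>. norm (fourier_coeff \<phi> \<xi>)) Q)"
proof -
  let ?c = "fourier_coeff \<phi>"
  define sq :: "int \<times> int \<Rightarrow> int" where "sq \<xi> = (fst \<xi>)\<^sup>2 + (snd \<xi>)\<^sup>2" for \<xi>
  define th where "th \<xi> p = of_int (fst \<xi>) * fst (snd p) + of_int (snd \<xi>) * snd (snd p) - fst p * of_int (sq \<xi>)"
    for \<xi> :: "int \<times> int" and p :: "real \<times> real \<times> real"
  define u where "u p = (\<Sum>\<xi>\<in>S. ?c \<xi> * cis (th \<xi> p))" for p
  have u: "schrod_proj S \<phi> (fst p) (snd p) = u p" for p
    unfolding schrod_proj_def u_def th_def sq_def cis_conv_exp by simp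
  define A where "A = {..<K} \<times> S \<times> S"
  define z where "z = (\<lambda>(k :: nat, \<xi>, \<eta>). ?c \<xi> * ?c \<eta>)"
  define \<Theta> where "\<Theta> = (\<lambda>(k :: nat, \<xi>, \<eta>) p. real k * fst p + th \<xi> p + th \<eta> p)"
  define \<omega> where "\<omega> = (\<lambda>(k :: nat, \<xi>, \<eta>). (int k - sq \<xi> - sq \<eta>, \<xi> + \<eta>))"
  define D where "D t = (\<Sum>k<K. cis (real k * t))" for t
  have finA: "finite A" using S by (simp add: A_def)
  have cth: "continuous_on B (th \<xi>)" for B \<xi> unfolding th_def by (intro continuous_intros)
  have cu: "continuous_on B u" for B unfolding u_def by (intro continuous_intros cth)
  have cT: "continuous_on B (\<Theta> \<alpha>)" for B \<alpha>
    unfolding \<Theta>_def case_prod_beta by (intro continuous_intros cth)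
  let ?v = "\<lambda>p. \<Sum>\<alpha>\<in>A. z \<alpha> * cis (\<Theta> \<alpha> p)"
  have cv: "continuous_on B ?v" for B by (intro continuous_intros cT)
  have v: "?v p = D (fst p) * (u p)\<^sup>2" for p
  proof -
    have "D (fst p) * (u p)\<^sup>2 = (\<Sum>k<K. \<Sum>\<xi>\<in>S. \<Sum>\<eta>\<in>S. cis (real k * fst p) * ((?c \<xi> * cis (th \<xi> p)) * (?c \<eta> * cis (th \<eta> p))))"
      unfolding D_def u_def power2_eq_square sum_product by (simp only: sum_distrib_left sum_distrib_right)
    also have "\<dots> = (\<Sum>k<K. \<Sum>\<xi>\<in>S. \<Sum>\<eta>\<in>S. z (k, \<xi>, \<eta>) * cis (\<Theta> (k, \<xi>, \<eta>) p))"
      by (intro sum.cong refl) (simp add: z_def \<Theta>_def cis_mult[symmetric])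
    also have "\<dots> = ?v p" unfolding A_def sum.cartesian_product by (intro sum.cong refl) auto
    finally show ?thesis by simp
  qed
  have T1: "T \<le> 1" using T K mult_left_mono[of 1 "real K" T] by simp
  have box: "{0..T} \<times> torus_box = cbox (0, 0, 0) (T, 2 * pi, 2 * pi)"
    unfolding torus_box_def cbox_Pair_eq[symmetric] by (simp add: cbox_Pair_eq)
  have sub: "cbox (0, 0, 0) (T, 2 * pi, 2 * pi) \<subseteq> time_box"
    unfolding time_box_def cbox_Pair_eq using T1 pi_gt3 by auto
  have int: "f integrable_on cbox (0, 0, 0) (T, 2 * pi, 2 * pi)" "f integrable_on time_box"
    if "\<And>B. continuous_on B f" for f :: "real \<times> real \<times> real \<Rightarrow> real"
    unfolding time_box_def by (intro integrable_continuous that)+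
  have cu4: "continuous_on B (\<lambda>p. (norm (u p)) ^ 4)" for B by (intro continuous_intros cu)
  have cv2: "continuous_on B (\<lambda>p. 4 / (real K)\<^sup>2 * (norm (?v p))\<^sup>2)" for B by (intro continuous_intros cv)
  have "(LINT p : {0..T} \<times> torus_box | lebesgue. (norm (schrod_proj S \<phi> (fst p) (snd p))) ^ 4) =
      integral (cbox (0, 0, 0) (T, 2 * pi, 2 * pi)) (\<lambda>p. (norm (u p)) ^ 4)"
    unfolding u box by (rule set_lint_continuous[OF cu4])
  also have "\<dots> \<le> integral (cbox (0, 0, 0) (T, 2 * pi, 2 * pi)) (\<lambda>p. 4 / (real K)\<^sup>2 * (norm (?v p))\<^sup>2)"
  proof (intro integral_le int cu4 cv2)
    fix p :: "real \<times> real \<times> real" assume "p \<in> cbox (0, 0, 0) (T, 2 * pi, 2 * pi)"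
    then have t: "0 \<le> fst p" "fst p \<le> T" by (auto simp: cbox_Pair_eq)
    have "fst p * real K \<le> T * real K" using t by (intro mult_right_mono) auto
    then have "real K / 2 \<le> norm (D (fst p))" unfolding D_def using t T by (intro dirichlet_kernel_lower_bound) auto
    then have "(real K / 2)\<^sup>2 \<le> (norm (D (fst p)))\<^sup>2" by (intro power_mono) auto
    then have "(real K / 2)\<^sup>2 * (norm (u p)) ^ 4 \<le> (norm (D (fst p)))\<^sup>2 * (norm (u p)) ^ 4"
      by (intro mult_right_mono) auto
    also have "\<dots> = (norm (?v p))\<^sup>2" unfolding v by (simp add: norm_mult norm_power power_mult_distrib)
    finally have "(norm (u p)) ^ 4 * (real K)\<^sup>2 \<le> 4 * (norm (?v p))\<^sup>2" by (simp add: power_divide algebra_simps)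
    then show "(norm (u p)) ^ 4 \<le> 4 / (real K)\<^sup>2 * (norm (?v p))\<^sup>2" using K by (simp add: field_simps)
  qed
  \<comment> \<open>The nonnegative integrand may be extended to the full period in time, where
    exponentials with integer frequencies are orthogonal.\<close>
  also have "\<dots> \<le> integral time_box (\<lambda>p. 4 / (real K)\<^sup>2 * (norm (?v p))\<^sup>2)"
    by (intro integral_subset_le sub int cv2) auto
  also have "\<dots> = 4 / (real K)\<^sup>2 * integral time_box (\<lambda>p. (norm (?v p))\<^sup>2)" by (rule integral_mult_right)
  also have "integral time_box (\<lambda>p. (norm (?v p))\<^sup>2) \<le>
      (2 * pi) ^ 3 * (\<Sum>(\<alpha>, \<beta>)\<in>{(\<alpha>, \<beta>) \<in> A \<times> A. \<omega> \<alpha> = \<omega> \<beta>}. norm (z \<alpha>) * norm (z \<beta>))"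
    unfolding time_box_def
  proof (rule trig_sum_L2_bound[OF finA cT])
    fix \<alpha> \<beta> :: "nat \<times> (int \<times> int) \<times> (int \<times> int)"
    obtain k \<xi> \<eta> where a: "\<alpha> = (k, \<xi>, \<eta>)" by (metis surj_pair)
    obtain k' \<xi>' \<eta>' where b: "\<beta> = (k', \<xi>', \<eta>')" by (metis surj_pair)
    define l m n where "l = int k - sq \<xi> - sq \<eta> - (int k' - sq \<xi>' - sq \<eta>')"
      and "m = fst \<xi> + fst \<eta> - fst \<xi>' - fst \<eta>'" and "n = snd \<xi> + snd \<eta> - snd \<xi>' - snd \<eta>'"
    have "\<Theta> \<alpha> p - \<Theta> \<beta> p = of_int l * fst p + (of_int m * fst (snd p) + of_int n * snd (snd p))" for p
      by (simp add: \<Theta>_def a b th_def l_def m_def n_def algebra_simps)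
    moreover have "\<omega> \<alpha> = \<omega> \<beta> \<longleftrightarrow> l = 0 \<and> m = 0 \<and> n = 0"
      by (auto simp: \<omega>_def a b l_def m_def n_def prod_eq_iff)
    ultimately show "integral (cbox (0, 0, 0) (2 * pi, 2 * pi, 2 * pi)) (\<lambda>x. cis (\<Theta> \<alpha> x - \<Theta> \<beta> x)) =
       (if \<omega> \<alpha> = \<omega> \<beta> then complex_of_real ((2 * pi) ^ 3) else 0)"
      using integral_cis_int3[of l m n] by (simp only: time_box_def)
  qed simp
  also have "(\<Sum>(\<alpha>, \<beta>)\<in>{(\<alpha>, \<beta>) \<in> A \<times> A. \<omega> \<alpha> = \<omega> \<beta>}. norm (z \<alpha>) * norm (z \<beta>)) \<le>
      (\<Sum>k<K. 1) * (\<Sum>Q\<in>near_rects S K. quad_prod (\<lambda>\<xi>. norm (?c \<xi>)) Q)"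
  proof (rule sum_le_product[where ?m1.0 = "\<lambda>((k, \<xi>, \<eta>), (k', \<xi>', \<eta>')). k" and ?m2.0 = "\<lambda>((k, \<xi>, \<eta>), (k', \<xi>', \<eta>')). (\<xi>, \<xi>', \<eta>, \<eta>')"])
    let ?R = "{(\<alpha>, \<beta>) \<in> A \<times> A. \<omega> \<alpha> = \<omega> \<beta>}"
    let ?m1 = "\<lambda>((k :: nat, \<xi> :: int \<times> int, \<eta> :: int \<times> int), (k' :: nat, \<xi>' :: int \<times> int, \<eta>' :: int \<times> int)). k"
    let ?m2 = "\<lambda>((k :: nat, \<xi> :: int \<times> int, \<eta> :: int \<times> int), (k' :: nat, \<xi>' :: int \<times> int, \<eta>' :: int \<times> int)). (\<xi>, \<xi>', \<eta>, \<eta>')"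
    have R: "\<exists>k \<xi> \<eta> k' \<xi>' \<eta>'. t = ((k, \<xi>, \<eta>), (k', \<xi>', \<eta>')) \<and> k < K \<and> k' < K \<and> \<xi> \<in> S \<and> \<eta> \<in> S \<and> \<xi>' \<in> S \<and> \<eta>' \<in> S \<and>
        int k' = int k - sq \<xi> - sq \<eta> + sq \<xi>' + sq \<eta>' \<and> \<eta> = \<xi>' + \<eta>' - \<xi>" if t: "t \<in> ?R" for t
    proof -
      obtain k \<xi> \<eta> k' \<xi>' \<eta>' where 1: "t = ((k, \<xi>, \<eta>), (k', \<xi>', \<eta>'))" by (metis surj_pair)
      have "int k - sq \<xi> - sq \<eta> = int k' - sq \<xi>' - sq \<eta>'" "\<xi> + \<eta> = \<xi>' + \<eta>'"
        using t by (auto simp: 1 \<omega>_def)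
      then have "int k' = int k - sq \<xi> - sq \<eta> + sq \<xi>' + sq \<eta>'" "\<eta> = \<xi>' + \<eta>' - \<xi>" by (simp_all add: algebra_simps)
      then show ?thesis using t 1 by (auto simp: A_def)
    qed
    show "inj_on (\<lambda>t. (?m1 t, ?m2 t)) ?R"
    proof (rule inj_onI)
      fix t t' assume t: "t \<in> ?R" "t' \<in> ?R" "(?m1 t, ?m2 t) = (?m1 t', ?m2 t')"
      obtain k \<xi> \<eta> k' \<xi>' \<eta>' where 1: "t = ((k, \<xi>, \<eta>), (k', \<xi>', \<eta>'))" "int k' = int k - sq \<xi> - sq \<eta> + sq \<xi>' + sq \<eta>'"
        using R[OF t(1)] by blast
      obtain l \<zeta> \<rho> l' \<zeta>' \<rho>' where 2: "t' = ((l, \<zeta>, \<rho>), (l', \<zeta>', \<rho>'))" "int l' = int l - sq \<zeta> - sq \<rho> + sq \<zeta>' + sq \<rho>'"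
        using R[OF t(2)] by blast
      show "t = t'" using t(3) 1 2 by simp
    qed
    show "?m1 ` ?R \<subseteq> {..<K}"
    proof (rule image_subsetI)
      fix t assume "t \<in> ?R"
      from R[OF this] show "?m1 t \<in> {..<K}" by auto
    qed
    show "?m2 ` ?R \<subseteq> near_rects S K"
    proof (rule image_subsetI)
      fix t assume t: "t \<in> ?R"
      obtain k \<xi> \<eta> k' \<xi>' \<eta>' where 1: "t = ((k, \<xi>, \<eta>), (k', \<xi>', \<eta>'))" "k < K" "k' < K" "\<xi> \<in> S" "\<eta> \<in> S" "\<xi>' \<in> S" "\<eta>' \<in> S"
        "int k' = int k - sq \<xi> - sq \<eta> + sq \<xi>' + sq \<eta>'" "\<eta> = \<xi>' + \<eta>' - \<xi>"
        using R[OF t] by blast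
      \<comment> \<open>Along a parallelogram the difference of the sums of squares is twice the
        inner product at a vertex. It equals k - k', which is smaller than K in modulus.\<close>
      have "sq \<xi> + sq \<eta> - sq \<xi>' - sq \<eta>' = 2 * idot (\<xi>' - \<xi>) (\<eta>' - \<xi>)"
        unfolding sq_def idot_def 1(9) by (simp add: power2_eq_square algebra_simps)
      then have "\<bar>idot (\<xi>' - \<xi>) (\<eta>' - \<xi>)\<bar> < int K" using 1(2,3,8) by linarith
      then show "?m2 t \<in> near_rects S K" using 1 by (simp add: near_rects_def)
    qed
    fix t assume "t \<in> ?R"
    from R[OF this] show "(case t of (\<alpha>, \<beta>) \<Rightarrow> norm (z \<alpha>) * norm (z \<beta>)) = 1 * quad_prod (\<lambda>\<xi>. norm (?c \<xi>)) (?m2 t)"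
      by (auto simp: z_def quad_prod_def norm_mult)
  next
    show "finite (near_rects S K)"
      by (rule finite_subset[of _ "S \<times> S \<times> S \<times> S"]) (use S in \<open>auto simp: near_rects_def\<close>)
  qed (auto intro: quad_prod_nonneg)
  finally have "(LINT p : {0..T} \<times> torus_box | lebesgue. (norm (schrod_proj S \<phi> (fst p) (snd p))) ^ 4) \<le>
     4 / (real K)\<^sup>2 * ((2 * pi) ^ 3 * ((\<Sum>k<K. 1) * (\<Sum>Q\<in>near_rects S K. quad_prod (\<lambda>\<xi>. norm (?c \<xi>)) Q)))"
    by (simp add: mult_left_mono divide_right_mono)
  also have "\<dots> = 4 * (2 * pi) ^ 3 / real K * (\<Sum>Q\<in>near_rects S K. quad_prod (\<lambda>\<xi>. norm (?c \<xi>)) Q)"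
    using K by (simp add: power2_eq_square field_simps)
  finally show ?thesis .
qed

theorem theorem1p2:
  shows "\<exists>c > 0. \<forall>(S :: (int \<times> int) set) (\<phi> :: real \<times> real \<Rightarrow> complex).
           finite S \<and> S \<noteq> {} \<and> in_L2_torus \<phi> \<longrightarrow>
           L4_norm_time_torus (1 / logm (real (card S))) (schrod_proj S \<phi>) \<le> c * L2_norm_torus \<phi>"
proof -
  \<comment> \<open>48 is 4 from the kernel, 3 from \<open>near_rects_sum\<close>, and 4 from
    comparing its logarithm with K. One factor 1 / (2 * pi) remains since Bessel is used squared,
    with (2 * pi)^4, against the volume (2 * pi)^3.\<close>
  define C where "C = 48 * strichartz_const / (2 * pi)"
  have sc: "strichartz_const > 0" using strichartz_const_pos(1) by simp
  then have C: "C > 0" by (simp add: C_def)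
  have main: "L4_norm_time_torus (1 / logm (real (card S))) (schrod_proj S \<phi>) \<le> C powr (1 / 4) * L2_norm_torus \<phi>"
    if S: "finite S" "S \<noteq> {}" and phi: "in_L2_torus \<phi>" for S \<phi>
  proof -
    define M where "M = logm (real (card S))"
    define K where "K = nat \<lfloor>M\<rfloor>"
    define N where "N = (\<Sum>\<xi>\<in>S. (norm (fourier_coeff \<phi> \<xi>))\<^sup>2)"
    define I where "I = (LINT x : torus_box | lebesgue. (norm (\<phi> x))\<^sup>2)"
    have M: "M \<ge> 1" "ln (real (card S)) \<le> M" by (simp_all add: M_def logm_def)
    have K: "real K \<le> M" "M < real K + 1" "K \<ge> 1" using M unfolding K_def by linarith+
    have K1: "1 \<le> real K" using K(3) by simp
    have N: "0 \<le> N" "(2 * pi) ^ 2 * N \<le> I" using bessel_inequality[OF phi S(1)] by (simp_all add: N_def I_def sum_nonneg)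
    have I0: "0 \<le> I" using N by (meson order_trans zero_le_mult_iff zero_le_power2)
    let ?L = "LINT p : {0..1 / M} \<times> torus_box | lebesgue. (norm (schrod_proj S \<phi> (fst p) (snd p))) ^ 4"
    have "?L \<le> 4 * (2 * pi) ^ 3 / real K * (\<Sum>Q\<in>near_rects S K. quad_prod (\<lambda>\<xi>. norm (fourier_coeff \<phi> \<xi>)) Q)"
      using K M S by (intro schrod_L4_le_near_rects) (auto simp: field_simps)
    also have "\<dots> \<le> 4 * (2 * pi) ^ 3 / real K * (3 * strichartz_const * (real K + ln (real (card S)) + 1) * N\<^sup>2)"
      unfolding N_def using S K by (intro mult_left_mono near_rects_sum) auto
    \<comment> \<open>ln (card S) is at most M, which is below K + 1, so the bracket is at most 2 K
      + 2 and hence at most 4 K. The K then cancels the factor 1 / K.\<close>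
    also have "\<dots> \<le> 4 * (2 * pi) ^ 3 / real K * (3 * strichartz_const * (4 * real K) * N\<^sup>2)"
      using M K K1 sc by (intro mult_left_mono mult_right_mono) auto
    also have "\<dots> = 48 * strichartz_const / (2 * pi) * ((2 * pi) ^ 2 * N)\<^sup>2"
      using K1 by (simp add: field_simps eval_nat_numeral)
    also have "\<dots> \<le> C * I\<^sup>2"
      unfolding C_def using N sc by (intro mult_left_mono power_mono) auto
    finally have L: "?L \<le> C * I\<^sup>2" .
    have L0: "0 \<le> ?L" unfolding set_lebesgue_integral_def by (simp add: integral_nonneg_AE)
    have "L4_norm_time_torus (1 / logm (real (card S))) (schrod_proj S \<phi>) = ?L powr (1 / 4)"
      by (simp add: L4_norm_time_torus_def M_def)
    also have "\<dots> \<le> (C * I\<^sup>2) powr (1 / 4)" using L L0 by (intro powr_mono2) auto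
    also have "\<dots> = C powr (1 / 4) * (I\<^sup>2) powr (1 / 4)" using C by (simp add: powr_mult)
    also have "(I\<^sup>2) powr (1 / 4) = sqrt I"
    proof (cases "I = 0")
      case False
      then have "(I\<^sup>2) powr (1 / 4) = (I powr 2) powr (1 / 4)" using I0 by simp
      also have "\<dots> = I powr (1 / 2)" by (simp only: powr_powr) simp
      finally show ?thesis using I0 by (simp add: powr_half_sqrt)
    qed simp
    finally show ?thesis by (simp add: L2_norm_torus_def I_def)
  qed
  show ?thesis
    by (rule exI[of _ "C powr (1 / 4)"]) (use main C in auto)
qed

end
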